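(* Let $u\in C_{+,\log}$ be (log, exp)-convex. Let $\mathcal K_u$ and $\mathcal G_u$ be the projective limits of the families $\{\mathcal K_{u,p};\,p\ge0\}$ and $\{\mathcal G_{u,p};\,p\ge0\}$, respectively. Then $\mathcal K_u=\mathcal G_u$, and their respective topologies, given by the families of norms $\{\|\cdot\|_{u,p};\,p\ge0\}$ and $\{|\!|\!|\cdot|\!|\!|_{u,p};\,p\ge0\}$, coincide.
   Context: Let $\mathcal E$ be a real nuclear space with topology given by a sequence of inner product norms $\{|\cdot|_p\}_{p=0}^\infty$; $\mathcal E_p$ is the completion of $\mathcal E$ with respect to $|\cdot|_p$. Standing assumptions: (a) there is a constant $0<\rho<1$ with $|\cdot|_0\le\rho|\cdot|_1\le\cdots\le\rho^p|\cdot|_p\le\cdots$; (b) for any $p\ge0$ there is $q\ge p$ such that the inclusion $i_{q,p}:\mathcal E_q\to\mathcal E_p$ is Hilbert-Schmidt. For $p\ge q$ one regards $\mathcal E\subset\mathcal E_p\subset\mathcal E_q\subset\mathcal E_0$. The subscript $c$ denotes complexification, with norms extended to complexifications and tensor powers as Hilbert norms (same symbols). $\mathcal E_0$ is identified with its dual; $|\cdot|_{-p}$ is the dual norm of $|\cdot|_p$, so $|\xi|_{-p}=\sup\{|\langle\xi,\eta\rangle|:\eta\in\mathcal E_{p,c},|\eta|_p\le1\}$ for $\xi\in\mathcal E_c$, where $\langle\cdot,\cdot\rangle$ is the complex bilinear extension of the inner product of $\mathcal E_0$ (also used on tensor powers). $\widehat\otimes n$ denotes the symmetric $n$-th Hilbert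 tensor power. A function $F:\mathcal E_c\to\mathbb C$ is holomorphic on $\mathcal E_c$ if for all $\xi,\eta\in\mathcal E_c$ the function $z\mapsto F(z\xi+\eta)$ is entire on $\mathbb C$. $C_{+,\log}$ denotes the set of all positive continuous functions $u:[0,\infty)\to(0,\infty)$ with $\lim_{r\to\infty}\frac{\log u(r)}{\log r}=\infty$; its Legendre transform is $\ell_u(t)=\inf_{r>0}u(r)/r^t$, $t\ge0$. A positive continuous $u$ on $[0,\infty)$ is (log, exp)-convex if $x\mapsto\log u(e^x)$ is convex on $\mathbb R$. For holomorphic $F$ on $\mathcal E_c$ with expansion $F(\xi)=\sum_{n=0}^\infty\langle f_n,\xi^{\otimes n}\rangle$, $f_n\in\mathcal E_{p,c}^{\widehat\otimes n}$, put $\|F\|_{u,p}=\left(\sum_{n=0}^\infty\frac{1}{\ell_u(n)}|f_n|_p^2\right)^{1/2}$, and $\mathcal K_{u,p}=\{F:\ \|F\|_{u,p}<\infty\}$ with this norm. For holomorphic $F$ on $\mathcal E_c$ put $|\!|\!|F|\!|\!|_{u,p}=\sup_{\xi\in\mathcal E_c}|F(\xi)|\,u(|\xi|_{-p}^2)^{-1/2}$, and $\mathcal G_{u,p}=\{F:\ |\!|\!|F|\!|\!|_{u,p}<\infty\}$ with this norm. Here $p$ ranges over nonnegative integers; the projective limits are the intersections $\bigcap_p\mathcal K_{u,p}$, $\bigcap_p\mathcal G_{u,p}$ with the locally convex topologies generated by the respective norms. *)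

theory Defs
  imports "HOL-Analysis.Analysis"
begin

section \<open>Inner products on subspaces and Hilbert space completions\<close>

definition inner_product_on :: "'a::real_vector set \<Rightarrow> ('a \<Rightarrow> 'a \<Rightarrow> real) \<Rightarrow> bool" where
  "inner_product_on V g \<longleftrightarrow> subspace V \<and>
     (\<forall>x\<in>V. \<forall>y\<in>V. g x y = g y x) \<and>
     (\<forall>x\<in>V. \<forall>y\<in>V. \<forall>z\<in>V. g (x + y) z = g x z + g y z) \<and>
     (\<forall>c. \<forall>x\<in>V. \<forall>y\<in>V. g (c *\<^sub>R x) y = c * g x y) \<and>
     (\<forall>x\<in>V. x \<noteq> 0 \<longrightarrow> g x x > 0)"

definition ip_norm :: "('a \<Rightarrow> 'a \<Rightarrow> real) \<Rightarrow> 'a \<Rightarrow> real" where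
  "ip_norm g x = sqrt (g x x)"

definition ip_dense :: "('a::real_vector \<Rightarrow> 'a \<Rightarrow> real) \<Rightarrow> 'a set \<Rightarrow> 'a set \<Rightarrow> bool" where
  "ip_dense g D V \<longleftrightarrow> D \<subseteq> V \<and> (\<forall>x\<in>V. \<forall>\<epsilon>>0. \<exists>y\<in>D. ip_norm g (x - y) < \<epsilon>)"

definition ip_complete :: "'a::real_vector set \<Rightarrow> ('a \<Rightarrow> 'a \<Rightarrow> real) \<Rightarrow> bool" where
  "ip_complete V g \<longleftrightarrow>
     (\<forall>X. (\<forall>k::nat. X k \<in> V) \<and> (\<forall>\<epsilon>>0. \<exists>N. \<forall>j\<ge>N. \<forall>k\<ge>N. ip_norm g (X j - X k) < \<epsilon>) \<longrightarrow>
        (\<exists>x\<in>V. (\<lambda>k. ip_norm g (X k - x)) \<longlonglongrightarrow> 0))"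

text \<open>\<open>(V, g)\<close> is the completion of \<open>D\<close> with respect to the norm of \<open>g\<close>: a Hilbert space that
  contains \<open>D\<close> as a dense subspace. This determines it up to a unique isometry fixing \<open>D\<close>.\<close>

definition hilbert_completion :: "'a::real_vector set \<Rightarrow> 'a set \<Rightarrow> ('a \<Rightarrow> 'a \<Rightarrow> real) \<Rightarrow> bool" where
  "hilbert_completion D V g \<longleftrightarrow>
     subspace D \<and> inner_product_on V g \<and> ip_complete V g \<and> ip_dense g D V"

definition orthonormal_basis_of ::
    "'a::real_vector set \<Rightarrow> ('a \<Rightarrow> 'a \<Rightarrow> real) \<Rightarrow> 'a set \<Rightarrow> bool" where
  "orthonormal_basis_of V g B \<longleftrightarrow> B \<subseteq> V \<and>
     (\<forall>e\<in>B. \<forall>e'\<in>B. g e e' = (if e = e' then 1 else 0)) \<and> ip_dense g (span B) V"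

definition hilbert_schmidt ::
    "'a::real_vector set \<Rightarrow> ('a \<Rightarrow> 'a \<Rightarrow> real) \<Rightarrow> ('b \<Rightarrow> 'b \<Rightarrow> real) \<Rightarrow> ('a \<Rightarrow> 'b) \<Rightarrow> bool" where
  "hilbert_schmidt V g h T \<longleftrightarrow>
     (\<exists>B. orthonormal_basis_of V g B \<and> (\<lambda>e. (ip_norm h (T e))\<^sup>2) summable_on B)"

section \<open>The chain of Hilbert spaces of a nuclear space\<close>

text \<open>The ambient type is the Hilbert space \<open>\<E>\<^sub>0\<close>, and \<open>(H p, ip p)\<close> is the completion \<open>\<E>\<^sub>p\<close>,
  regarded as a subspace of \<open>\<E>\<^sub>0\<close>. The norm inequality is required on all of \<open>H (Suc p)\<close> and
  not just on \<open>E\<close>: it passes from \<open>E\<close> to the completion by continuity, and it expresses that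
  \<open>H (Suc p) \<subseteq> H p\<close> is the continuous extension of the identity of \<open>E\<close>.\<close>

locale nuclear_space_chain =
  fixes E :: "'a::{real_inner, complete_space} set"
    and H :: "nat \<Rightarrow> 'a set"
    and ip :: "nat \<Rightarrow> 'a \<Rightarrow> 'a \<Rightarrow> real"
    and \<rho> :: real
  assumes completion: "hilbert_completion E (H p) (ip p)"
    and ambient: "H 0 = UNIV" "ip 0 = inner"
    and inclusion: "H (Suc p) \<subseteq> H p"
    and rho: "0 < \<rho>" "\<rho> < 1"
    and norm_le: "x \<in> H (Suc p) \<Longrightarrow> ip_norm (ip p) x \<le> \<rho> * ip_norm (ip (Suc p)) x"
    and nuclear: "\<exists>q\<ge>p. hilbert_schmidt (H q) (ip q) (ip p) (\<lambda>x. x)"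

section \<open>Complexification\<close>

text \<open>The pair \<open>(x, y)\<close> stands for \<open>x + \<i>y\<close>; the complexification of a subspace \<open>V\<close> is \<open>V \<times> V\<close>.\<close>

type_synonym 'a cplx = "'a \<times> 'a"

definition cscale :: "complex \<Rightarrow> 'a::real_vector cplx \<Rightarrow> 'a cplx" where
  "cscale z \<xi> = (Re z *\<^sub>R fst \<xi> - Im z *\<^sub>R snd \<xi>, Re z *\<^sub>R snd \<xi> + Im z *\<^sub>R fst \<xi>)"

text \<open>The Hermitian extension (linear in the first argument) and the bilinear extension of a
  real inner product.\<close>

definition herm :: "('a \<Rightarrow> 'a \<Rightarrow> real) \<Rightarrow> 'a cplx \<Rightarrow> 'a cplx \<Rightarrow> complex" where
  "herm g \<xi> \<eta> = Complex (g (fst \<xi>) (fst \<eta>) + g (snd \<xi>) (snd \<eta>))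
                        (g (snd \<xi>) (fst \<eta>) - g (fst \<xi>) (snd \<eta>))"

definition bilin :: "('a \<Rightarrow> 'a \<Rightarrow> real) \<Rightarrow> 'a cplx \<Rightarrow> 'a cplx \<Rightarrow> complex" where
  "bilin g \<xi> \<eta> = Complex (g (fst \<xi>) (fst \<eta>) - g (snd \<xi>) (snd \<eta>))
                         (g (fst \<xi>) (snd \<eta>) + g (snd \<xi>) (fst \<eta>))"

definition cnorm :: "('a \<Rightarrow> 'a \<Rightarrow> real) \<Rightarrow> 'a cplx \<Rightarrow> real" where
  "cnorm g \<xi> = sqrt (Re (herm g \<xi> \<xi>))"

definition dual_norm ::
    "'a::real_inner set \<Rightarrow> ('a \<Rightarrow> 'a \<Rightarrow> real) \<Rightarrow> 'a cplx \<Rightarrow> real" where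
  "dual_norm V g \<xi> = Sup {cmod (bilin inner \<xi> \<eta>) | \<eta>. \<eta> \<in> V \<times> V \<and> cnorm g \<eta> \<le> 1}"

section \<open>Symmetric Hilbert tensor powers\<close>

text \<open>A list of pairs \<open>(c, x)\<close> denotes the algebraic tensor
  \<open>\<Sum> c \<cdot> x 0 \<otimes> \<dots> \<otimes> x (n - 1)\<close>; only the values \<open>x i\<close> with \<open>i < n\<close> are relevant.\<close>

type_synonym 'a formal_tensor = "(complex \<times> (nat \<Rightarrow> 'a cplx)) list"

definition formal_tensors :: "'a set \<Rightarrow> nat \<Rightarrow> 'a formal_tensor set" where
  "formal_tensors V n = {t. \<forall>(c, x) \<in> set t. \<forall>i<n. x i \<in> V \<times> V}"

definition tensor_diff :: "'a formal_tensor \<Rightarrow> 'a formal_tensor \<Rightarrow> 'a formal_tensor" where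
  "tensor_diff s t = s @ map (\<lambda>(c, x). (- c, x)) t"

definition tensor_herm ::
    "('a \<Rightarrow> 'a \<Rightarrow> real) \<Rightarrow> nat \<Rightarrow> 'a formal_tensor \<Rightarrow> 'a formal_tensor \<Rightarrow> complex" where
  "tensor_herm g n s t =
     (\<Sum>(c, x)\<leftarrow>s. \<Sum>(d, y)\<leftarrow>t. c * cnj d * (\<Prod>i<n. herm g (x i) (y i)))"

definition formal_norm :: "('a \<Rightarrow> 'a \<Rightarrow> real) \<Rightarrow> nat \<Rightarrow> 'a formal_tensor \<Rightarrow> real" where
  "formal_norm g n t = sqrt (Re (tensor_herm g n t t))"

text \<open>The bilinear pairing of \<open>\<E>\<^sub>0\<close> of an algebraic tensor with \<open>y 0 \<otimes> \<dots> \<otimes> y (n - 1)\<close>.\<close>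

definition tensor_pair :: "nat \<Rightarrow> 'a::real_inner formal_tensor \<Rightarrow> (nat \<Rightarrow> 'a cplx) \<Rightarrow> complex" where
  "tensor_pair n t y = (\<Sum>(c, x)\<leftarrow>t. c * (\<Prod>i<n. bilin inner (x i) (y i)))"

text \<open>An element of the completed tensor power of \<open>\<E>\<^sub>p \<subseteq> \<E>\<^sub>0\<close> lies in the completed tensor
  power of \<open>\<E>\<^sub>0\<close>, where it is determined by its pairings with the tensors
  \<open>y 0 \<otimes> \<dots> \<otimes> y (n - 1)\<close>. It is represented by the function \<open>f\<close> that maps \<open>y\<close> to this pairing.
  The next predicate says that the sequence \<open>t\<close> of algebraic tensors is Cauchy for the
  Hilbert norm and converges to the element \<open>f\<close>.\<close>

definition tensor_seq ::
    "'a::real_inner set \<Rightarrow> ('a \<Rightarrow> 'a \<Rightarrow> real) \<Rightarrow> nat \<Rightarrow> (nat \<Rightarrow> 'a formal_tensor) \<Rightarrow>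
     ((nat \<Rightarrow> 'a cplx) \<Rightarrow> complex) \<Rightarrow> bool" where
  "tensor_seq V g n t f \<longleftrightarrow>
     (\<forall>k. t k \<in> formal_tensors V n) \<and>
     (\<forall>\<epsilon>>0. \<exists>N. \<forall>j\<ge>N. \<forall>k\<ge>N. formal_norm g n (tensor_diff (t j) (t k)) < \<epsilon>) \<and>
     (\<forall>y. (\<lambda>k. tensor_pair n (t k) y) \<longlonglongrightarrow> f y)"

definition sym_tensor_power ::
    "'a::real_inner set \<Rightarrow> ('a \<Rightarrow> 'a \<Rightarrow> real) \<Rightarrow> nat \<Rightarrow> ((nat \<Rightarrow> 'a cplx) \<Rightarrow> complex) set" where
  "sym_tensor_power V g n =
     {f. (\<exists>t. tensor_seq V g n t f) \<and> (\<forall>\<pi> y. \<pi> permutes {..<n} \<longrightarrow> f (y \<circ> \<pi>) = f y)}"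

text \<open>The norm of \<open>f\<close> is the limit of the norms along a sequence representing \<open>f\<close>. The limit is
  the same for all such sequences (the tensor power of \<open>\<E>\<^sub>p \<subseteq> \<E>\<^sub>0\<close> is again injective), so the
  infimum is over a singleton.\<close>

definition tensor_norm ::
    "'a::real_inner set \<Rightarrow> ('a \<Rightarrow> 'a \<Rightarrow> real) \<Rightarrow> nat \<Rightarrow> ((nat \<Rightarrow> 'a cplx) \<Rightarrow> complex) \<Rightarrow> real" where
  "tensor_norm V g n f =
     Inf {r. \<exists>t. tensor_seq V g n t f \<and> (\<lambda>k. formal_norm g n (t k)) \<longlonglongrightarrow> r}"

section \<open>Holomorphic functions on the complexified nuclear space\<close>

text \<open>A function on \<open>E \<times> E\<close> is represented by the function on the ambient type that vanishes
  outside \<open>E \<times> E\<close>.\<close>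

definition holo_functions :: "'a::real_vector set \<Rightarrow> ('a cplx \<Rightarrow> complex) set" where
  "holo_functions E =
     {F. (\<forall>\<xi>. \<xi> \<notin> E \<times> E \<longrightarrow> F \<xi> = 0) \<and>
         (\<forall>\<xi>\<in>E \<times> E. \<forall>\<eta>\<in>E \<times> E. (\<lambda>z. F (cscale z \<xi> + \<eta>)) holomorphic_on UNIV)}"

definition tensor_expansion ::
    "'a::real_inner set \<Rightarrow> 'a set \<Rightarrow> ('a \<Rightarrow> 'a \<Rightarrow> real) \<Rightarrow> ('a cplx \<Rightarrow> complex) \<Rightarrow>
     (nat \<Rightarrow> (nat \<Rightarrow> 'a cplx) \<Rightarrow> complex) \<Rightarrow> bool" where
  "tensor_expansion E V g F f \<longleftrightarrow>
     (\<forall>n. f n \<in> sym_tensor_power V g n) \<and> (\<forall>\<xi>\<in>E \<times> E. (\<lambda>n. f n (\<lambda>_. \<xi>)) sums F \<xi>)"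

section \<open>Growth functions\<close>

definition C_plus_log :: "(real \<Rightarrow> real) set" where
  "C_plus_log = {u. continuous_on {0..} u \<and> (\<forall>r\<ge>0. u r > 0) \<and>
                    filterlim (\<lambda>r. ln (u r) / ln r) at_top at_top}"

definition log_exp_convex :: "(real \<Rightarrow> real) \<Rightarrow> bool" where
  "log_exp_convex u \<longleftrightarrow> convex_on UNIV (\<lambda>x. ln (u (exp x)))"

definition legendre :: "(real \<Rightarrow> real) \<Rightarrow> real \<Rightarrow> real" where
  "legendre u t = (INF r\<in>{0<..}. u r / r powr t)"

section \<open>The spaces and their projective limits\<close>

definition K_space ::
    "'a::real_inner set \<Rightarrow> (real \<Rightarrow> real) \<Rightarrow> 'a set \<Rightarrow> ('a \<Rightarrow> 'a \<Rightarrow> real) \<Rightarrow>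
     ('a cplx \<Rightarrow> complex) set" where
  "K_space E u V g =
     {F \<in> holo_functions E. \<exists>f. tensor_expansion E V g F f \<and>
        summable (\<lambda>n. 1 / legendre u (real n) * (tensor_norm V g n (f n))\<^sup>2)}"

definition K_norm ::
    "'a::real_inner set \<Rightarrow> (real \<Rightarrow> real) \<Rightarrow> 'a set \<Rightarrow> ('a \<Rightarrow> 'a \<Rightarrow> real) \<Rightarrow>
     ('a cplx \<Rightarrow> complex) \<Rightarrow> real" where
  "K_norm E u V g F =
     (let f = (THE f. tensor_expansion E V g F f)
      in sqrt (\<Sum>n. 1 / legendre u (real n) * (tensor_norm V g n (f n))\<^sup>2))"

definition G_weighted ::
    "(real \<Rightarrow> real) \<Rightarrow> 'a::real_inner set \<Rightarrow> ('a \<Rightarrow> 'a \<Rightarrow> real) \<Rightarrow>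
     ('a cplx \<Rightarrow> complex) \<Rightarrow> 'a cplx \<Rightarrow> real" where
  "G_weighted u V g F \<xi> = cmod (F \<xi>) * u ((dual_norm V g \<xi>)\<^sup>2) powr (- 1 / 2)"

definition G_space ::
    "'a::real_inner set \<Rightarrow> (real \<Rightarrow> real) \<Rightarrow> 'a set \<Rightarrow> ('a \<Rightarrow> 'a \<Rightarrow> real) \<Rightarrow>
     ('a cplx \<Rightarrow> complex) set" where
  "G_space E u V g = {F \<in> holo_functions E. bdd_above (G_weighted u V g F ` (E \<times> E))}"

definition G_norm ::
    "'a::real_inner set \<Rightarrow> (real \<Rightarrow> real) \<Rightarrow> 'a set \<Rightarrow> ('a \<Rightarrow> 'a \<Rightarrow> real) \<Rightarrow>
     ('a cplx \<Rightarrow> complex) \<Rightarrow> real" where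
  "G_norm E u V g F = (SUP \<xi>\<in>E \<times> E. G_weighted u V g F \<xi>)"

definition K_limit ::
    "'a::real_inner set \<Rightarrow> (real \<Rightarrow> real) \<Rightarrow> (nat \<Rightarrow> 'a set) \<Rightarrow> (nat \<Rightarrow> 'a \<Rightarrow> 'a \<Rightarrow> real) \<Rightarrow>
     ('a cplx \<Rightarrow> complex) set" where
  "K_limit E u H ip = (\<Inter>p. K_space E u (H p) (ip p))"

definition G_limit ::
    "'a::real_inner set \<Rightarrow> (real \<Rightarrow> real) \<Rightarrow> (nat \<Rightarrow> 'a set) \<Rightarrow> (nat \<Rightarrow> 'a \<Rightarrow> 'a \<Rightarrow> real) \<Rightarrow>
     ('a cplx \<Rightarrow> complex) set" where
  "G_limit E u H ip = (\<Inter>p. G_space E u (H p) (ip p))"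

definition norms_topology ::
    "('b \<Rightarrow> complex) set \<Rightarrow> (nat \<Rightarrow> ('b \<Rightarrow> complex) \<Rightarrow> real) \<Rightarrow> ('b \<Rightarrow> complex) topology" where
  "norms_topology X N =
     topology_generated_by
       {{G \<in> X. N p (\<lambda>\<xi>. G \<xi> - F \<xi>) < r} | p F r. F \<in> X \<and> r > 0}"

end

theory Submission
  imports Defs "HOL-Complex_Analysis.Complex_Analysis"
begin

text \<open>
  Each of the two norms of a function is bounded by a multiple of the other one at a higher level
  of the chain. The link between them is the expansion of the function in homogeneous terms.

  From \<open>K\<close> to \<open>G\<close> (\<open>K_to_G\<close>). A tensor of norm \<open>a n\<close> over \<open>H p\<close> takes at most the value
  \<open>a n * N p \<xi> ^ n\<close> at \<open>\<xi>\<close>, where \<open>N p\<close> is the dual norm. By the definition of the Legendre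
  transform, \<open>legendre u n * r ^ n \<le> u r\<close>. Passing from level \<open>p + 1\<close> to level \<open>p\<close> gains a factor
  \<open>\<rho>\<close> in the dual norm, so the Cauchy--Schwarz inequality leaves a geometric series with ratio
  \<open>\<rho>\<^sup>2\<close>.

  From \<open>G\<close> to \<open>K\<close> (\<open>G_to_K\<close>). The \<open>n\<close>-th term of the expansion of \<open>F\<close> is the \<open>n\<close>-fold
  directional derivative at zero divided by \<open>fact n\<close> (\<open>taylor_form\<close>), a symmetric multilinear form
  on \<open>E\<close>. Cauchy's
  inequality in each direction, followed by an optimization of the radius, bounds it by
  \<open>exp (n + 1) * sqrt (legendre u n)\<close> times the norm of \<open>F\<close> and the product of the dual norms of
  the arguments. Here the convexity hypothesis serves: it makes \<open>u\<close> monotone, so that the growth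
  bound at the boundary of a ball holds inside. A form that is bounded for the dual norm of \<open>H p\<close>
  is in general not a Hilbert tensor over \<open>H p\<close>, but it is one over \<open>H q\<close> if the inclusion of
  \<open>H p\<close> into \<open>H q\<close> is Hilbert--Schmidt, with norm bounded by the \<open>n\<close>-th power of the
  Hilbert--Schmidt norm (\<open>dual_basis\<close>, \<open>tensor_of_form\<close>). Raising \<open>p\<close> makes that norm at most
  \<open>exp (- 1) / sqrt 2\<close>, which absorbs the exponential factor.

  The norms of \<open>K\<close> refer to the coefficients of an expansion, so the coefficients have to be
  unique (\<open>tensor_expansion_unique\<close>): scaling the argument separates the homogeneous terms,
  polarization recovers a symmetric form from its diagonal, and density of \<open>E\<close> extends the
  equality to all arguments. For the topologies the two-sided comparison of norms has to be
  combined with the triangle inequalities, since balls around arbitrary centres generate them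
  (\<open>openin_norms_topology_mono\<close>).

  The Hilbert spaces of the chain are subspaces of one ambient type, each with its own inner
  product. Their elementary theory is therefore developed for an inner product on a subspace,
  up to the Gram--Schmidt process, Parseval's identity and the Riesz representation.
\<close>

section \<open>Inner products on a subspace\<close>

locale ip_space =
  fixes V :: "'a::real_vector set" and g :: "'a \<Rightarrow> 'a \<Rightarrow> real"
  assumes ip: "inner_product_on V g"
begin

lemma subspace: "subspace V"
  and sym: "x \<in> V \<Longrightarrow> y \<in> V \<Longrightarrow> g x y = g y x"
  and add_left: "x \<in> V \<Longrightarrow> y \<in> V \<Longrightarrow> z \<in> V \<Longrightarrow> g (x + y) z = g x z + g y z"
  and scale_left: "x \<in> V \<Longrightarrow> y \<in> V \<Longrightarrow> g (c *\<^sub>R x) y = c * g x y"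
  and pos: "x \<in> V \<Longrightarrow> x \<noteq> 0 \<Longrightarrow> g x x > 0"
  using ip by (simp_all add: inner_product_on_def)

lemma mem [simp]:
  shows "0 \<in> V" "x \<in> V \<Longrightarrow> y \<in> V \<Longrightarrow> x + y \<in> V" "x \<in> V \<Longrightarrow> y \<in> V \<Longrightarrow> x - y \<in> V"
    "x \<in> V \<Longrightarrow> c *\<^sub>R x \<in> V" "x \<in> V \<Longrightarrow> - x \<in> V"
  using subspace subspace_0 subspace_add subspace_diff subspace_scale subspace_neg by metis+

lemma sum_mem [simp]: "(\<And>i. i \<in> I \<Longrightarrow> f i \<in> V) \<Longrightarrow> sum f I \<in> V"
  using subspace subspace_sum by blast

lemma zero_left [simp]: "y \<in> V \<Longrightarrow> g 0 y = 0"
  using scale_left[of 0 y 0] by simp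

lemma zero_right [simp]: "y \<in> V \<Longrightarrow> g y 0 = 0"
  using sym[of y 0] by simp

lemma add_right: "x \<in> V \<Longrightarrow> y \<in> V \<Longrightarrow> z \<in> V \<Longrightarrow> g z (x + y) = g z x + g z y"
  using add_left sym by (metis mem(2))

lemma scale_right: "x \<in> V \<Longrightarrow> y \<in> V \<Longrightarrow> g y (c *\<^sub>R x) = c * g y x"
  using scale_left sym by (metis mem(4))

lemma diff_left: "x \<in> V \<Longrightarrow> y \<in> V \<Longrightarrow> z \<in> V \<Longrightarrow> g (x - y) z = g x z - g y z"
  using add_left[of "x - y" y z] by simp

lemma diff_right: "x \<in> V \<Longrightarrow> y \<in> V \<Longrightarrow> z \<in> V \<Longrightarrow> g z (x - y) = g z x - g z y"
  using add_right[of "x - y" y z] by simp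

lemma sum_left:
  assumes "\<And>i. i \<in> I \<Longrightarrow> f i \<in> V" "z \<in> V"
  shows "g (sum f I) z = (\<Sum>i\<in>I. g (f i) z)"
  using assms by (induction I rule: infinite_finite_induct) (auto simp: add_left)

lemma sum_right:
  assumes "\<And>i. i \<in> I \<Longrightarrow> f i \<in> V" "z \<in> V"
  shows "g z (sum f I) = (\<Sum>i\<in>I. g z (f i))"
  using assms by (induction I rule: infinite_finite_induct) (auto simp: add_right)

lemma nonneg: "x \<in> V \<Longrightarrow> g x x \<ge> 0"
  using pos[of x] by (cases "x = 0") auto

lemma norm_nonneg [simp]: "x \<in> V \<Longrightarrow> ip_norm g x \<ge> 0"
  by (simp add: ip_norm_def nonneg)

lemma norm_sq: "x \<in> V \<Longrightarrow> (ip_norm g x)\<^sup>2 = g x x"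
  by (simp add: ip_norm_def nonneg)

lemma norm_eq_0: "x \<in> V \<Longrightarrow> ip_norm g x = 0 \<longleftrightarrow> x = 0"
  using pos[of x] by (cases "x = 0") (auto simp: ip_norm_def)

lemma cauchy_schwarz:
  assumes "x \<in> V" "y \<in> V"
  shows "\<bar>g x y\<bar> \<le> ip_norm g x * ip_norm g y"
proof (cases "y = 0")
  case True
  then show ?thesis using assms by simp
next
  case False
  define c where "c = g x y / g y y"
  have y: "g y y > 0" using pos False assms by blast
  have "0 \<le> g (x - c *\<^sub>R y) (x - c *\<^sub>R y)" using assms by (intro nonneg) auto
  also have "\<dots> = g x x - 2 * c * g x y + c * c * g y y"
    using assms sym[of x y] by (simp add: diff_left diff_right scale_left scale_right algebra_simps)
  also have "\<dots> = g x x - (g x y)\<^sup>2 / g y y"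
    using y by (simp add: c_def field_simps power2_eq_square)
  finally have "(g x y)\<^sup>2 \<le> g x x * g y y" using y by (simp add: field_simps)
  then have "sqrt ((g x y)\<^sup>2) \<le> sqrt (g x x * g y y)" by (rule real_sqrt_le_mono)
  then show ?thesis by (simp add: ip_norm_def real_sqrt_mult)
qed

lemma norm_triangle:
  assumes "x \<in> V" "y \<in> V"
  shows "ip_norm g (x + y) \<le> ip_norm g x + ip_norm g y"
proof (rule power2_le_imp_le)
  have "(ip_norm g (x + y))\<^sup>2 = g x x + 2 * g x y + g y y"
    using assms sym[of x y] by (simp add: norm_sq add_left add_right)
  also have "\<dots> \<le> g x x + 2 * (ip_norm g x * ip_norm g y) + g y y"
    using cauchy_schwarz[OF assms] by linarith
  also have "\<dots> = (ip_norm g x + ip_norm g y)\<^sup>2"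
    using assms by (simp add: power2_sum norm_sq)
  finally show "(ip_norm g (x + y))\<^sup>2 \<le> (ip_norm g x + ip_norm g y)\<^sup>2" .
qed (use assms in auto)

lemma norm_minus_commute: "x \<in> V \<Longrightarrow> y \<in> V \<Longrightarrow> ip_norm g (x - y) = ip_norm g (y - x)"
  by (simp add: ip_norm_def diff_left diff_right)

lemma tendsto_ip_left:
  assumes "\<And>k. X k \<in> V" "x \<in> V" "y \<in> V" "(\<lambda>k. ip_norm g (X k - x)) \<longlonglongrightarrow> 0"
  shows "(\<lambda>k. g (X k) y) \<longlonglongrightarrow> g x y"
proof -
  have "(\<lambda>k. g (X k) y - g x y) \<longlonglongrightarrow> 0"
  proof (rule Lim_null_comparison)
    show "\<forall>\<^sub>F k in sequentially. norm (g (X k) y - g x y) \<le> ip_norm g (X k - x) * ip_norm g y"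
      using assms cauchy_schwarz[of "X _ - x" y] by (auto simp: diff_left)
    show "(\<lambda>k. ip_norm g (X k - x) * ip_norm g y) \<longlonglongrightarrow> 0"
      using tendsto_mult_right[OF assms(4), of "ip_norm g y"] by simp
  qed
  then show ?thesis by (rule LIM_zero_cancel)
qed

lemma orthogonal_to_dense:
  assumes "ip_dense g D V" "a \<in> V" "\<And>y. y \<in> D \<Longrightarrow> g a y = 0"
  shows "a = 0"
proof (rule ccontr)
  assume "a \<noteq> 0"
  then have n: "ip_norm g a > 0" using norm_eq_0[of a] norm_nonneg[of a] assms by linarith
  then obtain y where y: "y \<in> D" "ip_norm g (a - y) < ip_norm g a"
    using assms unfolding ip_dense_def by blast
  have yV: "y \<in> V" using assms y unfolding ip_dense_def by blast
  have "(ip_norm g a)\<^sup>2 = g a (a - y)" using assms y yV by (simp add: norm_sq diff_right)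
  also have "\<dots> \<le> ip_norm g a * ip_norm g (a - y)"
    using cauchy_schwarz[of a "a - y"] assms yV by auto
  also have "\<dots> < ip_norm g a * ip_norm g a" using n y by simp
  finally show False by (simp add: power2_eq_square)
qed

text \<open>Zero vectors are admitted in an orthonormal sequence: this way the Gram--Schmidt process
  and the enumeration of a countable basis never have to skip an index, whether or not the
  space is infinite-dimensional.\<close>

definition orthoseq :: "(nat \<Rightarrow> 'a) \<Rightarrow> bool" where
  "orthoseq d \<longleftrightarrow> (\<forall>k. d k \<in> V) \<and> (\<forall>j k. j \<noteq> k \<longrightarrow> g (d j) (d k) = 0) \<and>
     (\<forall>k. g (d k) (d k) = 1 \<or> d k = 0)"

definition total :: "(nat \<Rightarrow> 'a) \<Rightarrow> bool" where
  "total d \<longleftrightarrow> (\<forall>a\<in>V. (\<forall>k. g a (d k) = 0) \<longrightarrow> a = 0)"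

lemma orthoseqD:
  assumes "orthoseq d"
  shows "d k \<in> V" "j \<noteq> k \<Longrightarrow> g (d j) (d k) = 0" "g (d k) (d k) = 1 \<or> d k = 0"
    "g (d k) (d k) \<le> 1"
proof -
  show "d k \<in> V" "j \<noteq> k \<Longrightarrow> g (d j) (d k) = 0" and *: "g (d k) (d k) = 1 \<or> d k = 0"
    using assms by (auto simp: orthoseq_def)
  show "g (d k) (d k) \<le> 1" using * by auto
qed

lemma ip_combination_basis:
  assumes "orthoseq d" "finite I"
  shows "g (\<Sum>k\<in>I. c k *\<^sub>R d k) (d i) = (if i \<in> I then c i * g (d i) (d i) else 0)"
proof -
  have "g (\<Sum>k\<in>I. c k *\<^sub>R d k) (d i) = (\<Sum>k\<in>I. c k * g (d k) (d i))"
    using assms by (subst sum_left) (auto simp: scale_left orthoseqD[OF assms(1)])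
  also have "\<dots> = (\<Sum>k\<in>I. if k = i then c i * g (d i) (d i) else 0)"
    using assms by (intro sum.cong) (auto simp: orthoseqD[OF assms(1)])
  finally show ?thesis using assms by simp
qed

lemma norm_combination:
  assumes "orthoseq d" "finite I"
  shows "g (\<Sum>k\<in>I. c k *\<^sub>R d k) (\<Sum>k\<in>I. c k *\<^sub>R d k) \<le> (\<Sum>k\<in>I. (c k)\<^sup>2)"
proof -
  have "g (\<Sum>k\<in>I. c k *\<^sub>R d k) (\<Sum>k\<in>I. c k *\<^sub>R d k)
      = (\<Sum>i\<in>I. c i * g (\<Sum>k\<in>I. c k *\<^sub>R d k) (d i))"
    using assms by (subst sum_right) (auto simp: scale_right orthoseqD[OF assms(1)])
  also have "\<dots> = (\<Sum>i\<in>I. (c i)\<^sup>2 * g (d i) (d i))"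
    using assms by (intro sum.cong) (auto simp: ip_combination_basis power2_eq_square)
  also have "\<dots> \<le> (\<Sum>i\<in>I. (c i)\<^sup>2 * 1)"
    using assms by (intro sum_mono mult_left_mono) (auto simp: orthoseqD[OF assms(1)])
  finally show ?thesis by simp
qed

lemma basis_coefficient:
  assumes "orthoseq d" "a \<in> V"
  shows "g (d k) a * g (d k) (d k) = g (d k) a"
  using orthoseqD(3)[OF assms(1), of k] assms by auto

lemma bessel:
  assumes "orthoseq d" "a \<in> V"
  shows "(\<Sum>k<m. (g (d k) a)\<^sup>2) \<le> g a a"
proof -
  define s where "s = (\<Sum>k<m. g (d k) a *\<^sub>R d k)"
  have sV: "s \<in> V" using assms by (auto simp: s_def orthoseqD[OF assms(1)])
  have sa: "g s a = (\<Sum>k<m. (g (d k) a)\<^sup>2)"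
    unfolding s_def using assms
    by (subst sum_left) (auto simp: scale_left orthoseqD[OF assms(1)] power2_eq_square)
  have "g s s \<le> (\<Sum>k<m. (g (d k) a)\<^sup>2)"
    unfolding s_def using assms by (intro norm_combination) auto
  moreover have "0 \<le> g (a - s) (a - s)" using sV assms by (intro nonneg) auto
  then have "0 \<le> g a a - 2 * g s a + g s s"
    using sV assms sym[of a s] by (simp add: diff_left diff_right)
  ultimately show ?thesis using sa by linarith
qed

lemma orthogonal_series_converges:
  assumes "ip_complete V g" "orthoseq d" "summable (\<lambda>k. (c k)\<^sup>2)"
  shows "\<exists>a\<in>V. (\<lambda>m. ip_norm g ((\<Sum>k<m. c k *\<^sub>R d k) - a)) \<longlonglongrightarrow> 0"
proof -
  define s where "s m = (\<Sum>k<m. c k *\<^sub>R d k)" for m :: nat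
  have sV: "s m \<in> V" for m using assms by (auto simp: s_def orthoseqD[OF assms(2)])
  have tail: "(ip_norm g (s n - s m))\<^sup>2 \<le> (\<Sum>k\<in>{m..<n}. (c k)\<^sup>2)" if "m \<le> n" for m n
  proof -
    have *: "s n - s m = (\<Sum>k\<in>{m..<n}. c k *\<^sub>R d k)"
      unfolding s_def using sum_diff_nat_ivl[of 0 m n "\<lambda>k. c k *\<^sub>R d k"] that
      by (simp add: lessThan_atLeast0)
    have "(ip_norm g (s n - s m))\<^sup>2 = g (s n - s m) (s n - s m)" by (intro norm_sq mem sV)
    then show ?thesis
      unfolding * using norm_combination[OF assms(2), of "{m..<n}" c] by simp
  qed
  have "\<exists>N. \<forall>j\<ge>N. \<forall>k\<ge>N. ip_norm g (s j - s k) < e" if e: "e > 0" for e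
  proof -
    have "e\<^sup>2 > 0" using e by simp
    then obtain N where N: "\<And>m n. m \<ge> N \<Longrightarrow> norm (\<Sum>k\<in>{m..<n}. (c k)\<^sup>2) < e\<^sup>2"
      using assms(3)[unfolded summable_Cauchy, rule_format, of "e\<^sup>2"] by blast
    have *: "ip_norm g (s n - s m) < e" if "N \<le> m" "m \<le> n" for m n
    proof -
      have "(ip_norm g (s n - s m))\<^sup>2 < e\<^sup>2" using tail[OF that(2)] N[OF that(1), of n] by simp
      then show ?thesis using e by (simp add: power2_less_imp_less)
    qed
    have "ip_norm g (s j - s k) < e" if "N \<le> j" "N \<le> k" for j k
      using *[of j k] *[of k j] that norm_minus_commute[OF sV sV, of j k] nat_le_linear[of j k]
      by metis
    then show ?thesis by blast
  qed
  then have "\<exists>a\<in>V. (\<lambda>m. ip_norm g (s m - a)) \<longlonglongrightarrow> 0"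
    using assms(1)[unfolded ip_complete_def, rule_format, of s] sV by blast
  then show ?thesis unfolding s_def .
qed

text \<open>In a complete space the projections onto a total orthonormal sequence exist as limits,
  so the orthogonal complement of the sequence being trivial already gives the expansion of
  every vector.\<close>

lemma basis_expansion:
  assumes "ip_complete V g" "orthoseq d" "total d" "a \<in> V"
  shows "(\<lambda>m. ip_norm g ((\<Sum>k<m. g (d k) a *\<^sub>R d k) - a)) \<longlonglongrightarrow> 0"
proof -
  have "summable (\<lambda>k. (g (d k) a)\<^sup>2)"
  proof (rule bounded_imp_summable[where B = "g a a"])
    show "(\<Sum>k\<le>m. (g (d k) a)\<^sup>2) \<le> g a a" for m
      using bessel[OF assms(2,4), of "Suc m"] by (simp only: lessThan_Suc_atMost)
  qed simp
  then obtain b where b: "b \<in> V" "(\<lambda>m. ip_norm g ((\<Sum>k<m. g (d k) a *\<^sub>R d k) - b)) \<longlonglongrightarrow> 0"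
    using orthogonal_series_converges[OF assms(1,2), of "\<lambda>k. g (d k) a"] by blast
  have "g (a - b) (d i) = 0" for i
  proof -
    have 1: "(\<lambda>m. g (\<Sum>k<m. g (d k) a *\<^sub>R d k) (d i)) \<longlonglongrightarrow> g b (d i)"
      by (intro tendsto_ip_left b orthoseqD[OF assms(2)] sum_mem mem)
    have 2: "\<forall>\<^sub>F m in sequentially. g (\<Sum>k<m. g (d k) a *\<^sub>R d k) (d i) = g (d i) a"
      using eventually_gt_at_top[of i]
    proof eventually_elim
      case (elim m)
      then show ?case
        by (simp add: ip_combination_basis[OF assms(2)] basis_coefficient[OF assms(2,4)])
    qed
    have "g b (d i) = g (d i) a"
      by (rule LIMSEQ_unique[OF 1 tendsto_eventually[OF 2]])
    then show ?thesis
      using diff_left[OF assms(4) b(1) orthoseqD(1)[OF assms(2)], of i]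
        sym[OF assms(4) orthoseqD(1)[OF assms(2)], of i] by simp
  qed
  then have "a - b = 0"
    using assms(3)[unfolded total_def, rule_format, OF mem(3)[OF assms(4) b(1)]] by blast
  then have "b = a" by simp
  then show ?thesis using b(2) by (simp only:)
qed

lemma parseval:
  assumes "ip_complete V g" "orthoseq d" "total d" "a \<in> V"
  shows "(\<lambda>k. (g (d k) a)\<^sup>2) sums g a a"
proof -
  have "(\<lambda>m. g (\<Sum>k<m. g (d k) a *\<^sub>R d k) a) \<longlonglongrightarrow> g a a"
    by (intro tendsto_ip_left basis_expansion[OF assms] assms(4) orthoseqD[OF assms(2)] sum_mem mem)
  moreover have "(\<lambda>m. g (\<Sum>k<m. g (d k) a *\<^sub>R d k) a) = (\<lambda>m. \<Sum>k<m. (g (d k) a)\<^sup>2)"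
  proof
    fix m
    have "g (\<Sum>k<m. g (d k) a *\<^sub>R d k) a = (\<Sum>k<m. g (g (d k) a *\<^sub>R d k) a)"
      by (intro sum_left assms(4) orthoseqD[OF assms(2)] mem)
    also have "\<dots> = (\<Sum>k<m. (g (d k) a)\<^sup>2)"
      by (simp add: scale_left[OF orthoseqD(1)[OF assms(2)] assms(4)] power2_eq_square)
    finally show "g (\<Sum>k<m. g (d k) a *\<^sub>R d k) a = (\<Sum>k<m. (g (d k) a)\<^sup>2)" .
  qed
  ultimately show ?thesis unfolding sums_def by metis
qed

text \<open>The coefficients of the representing vector can only be the values of the functional on the
  basis. Testing the functional on its own partial sums shows that they are square summable.\<close>

lemma riesz:
  assumes "ip_complete V g" "orthoseq d" "total d"
    and add: "\<And>x y. x \<in> V \<Longrightarrow> y \<in> V \<Longrightarrow> \<phi> (x + y) = \<phi> x + \<phi> y"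
    and scale: "\<And>c x. x \<in> V \<Longrightarrow> \<phi> (c *\<^sub>R x) = c * \<phi> x"
    and bound: "\<And>x. x \<in> V \<Longrightarrow> \<bar>\<phi> x\<bar> \<le> C * ip_norm g x"
  shows "\<exists>r\<in>V. \<forall>a\<in>V. g r a = \<phi> a"
proof -
  define s where "s m = (\<Sum>k<m. \<phi> (d k) *\<^sub>R d k)" for m :: nat
  have sV: "s m \<in> V" for m using assms(2) by (auto simp: s_def orthoseqD[OF assms(2)])
  have \<phi>0: "\<phi> 0 = 0" using scale[of 0 0] by simp
  have \<phi>sum: "\<phi> (\<Sum>k<m. c k *\<^sub>R d k) = (\<Sum>k<m. c k * \<phi> (d k))" for c and m :: nat
    using assms(2) by (induction m) (auto simp: \<phi>0 add scale orthoseqD[OF assms(2)])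
  have bdd: "(\<Sum>k<m. (\<phi> (d k))\<^sup>2) \<le> C\<^sup>2" for m
  proof -
    define S where "S = (\<Sum>k<m. (\<phi> (d k))\<^sup>2)"
    have S0: "S \<ge> 0" unfolding S_def by (intro sum_nonneg) auto
    have "S = \<phi> (s m)" unfolding S_def s_def \<phi>sum by (simp add: power2_eq_square)
    then have "S\<^sup>2 \<le> (C * ip_norm g (s m))\<^sup>2"
      using bound[OF sV, of m] S0 by (intro power_mono) auto
    also have "\<dots> = C\<^sup>2 * g (s m) (s m)" using sV by (simp add: power_mult_distrib norm_sq)
    also have "\<dots> \<le> C\<^sup>2 * S" unfolding S_def s_def
      using assms(2) by (intro mult_left_mono norm_combination) auto
    finally have "S * S \<le> C\<^sup>2 * S" by (simp only: power2_eq_square)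
    then have "S \<le> C\<^sup>2" using S0 by (cases "S = 0") (auto intro: mult_right_le_imp_le)
    then show ?thesis unfolding S_def .
  qed
  have "summable (\<lambda>k. (\<phi> (d k))\<^sup>2)"
  proof (rule bounded_imp_summable[where B = "C\<^sup>2"])
    show "(\<Sum>k\<le>m. (\<phi> (d k))\<^sup>2) \<le> C\<^sup>2" for m
      using bdd[of "Suc m"] by (simp only: lessThan_Suc_atMost)
  qed simp
  then obtain r where r: "r \<in> V" "(\<lambda>m. ip_norm g (s m - r)) \<longlonglongrightarrow> 0"
    using orthogonal_series_converges[OF assms(1,2), of "\<lambda>k. \<phi> (d k)", folded s_def] by blast
  have "g r a = \<phi> a" if a: "a \<in> V" for a
  proof -
    let ?P = "\<lambda>m. \<Sum>k<m. g (d k) a *\<^sub>R d k"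
    have PV: "?P m \<in> V" for m using assms(2) by (auto simp: orthoseqD[OF assms(2)])
    have 1: "(\<lambda>m. g (s m) a) \<longlonglongrightarrow> g r a"
      by (intro tendsto_ip_left r sV a)
    have "g (s m) a = \<phi> (?P m)" for m
      unfolding \<phi>sum unfolding s_def using assms(2) a
      by (subst sum_left) (auto simp: scale_left orthoseqD[OF assms(2)] mult.commute)
    then have 2: "(\<lambda>m. g (s m) a) = (\<lambda>m. \<phi> (?P m))" by (rule ext)
    have 3: "(\<lambda>m. \<phi> (?P m)) \<longlonglongrightarrow> \<phi> a"
    proof (rule LIM_zero_cancel, rule Lim_null_comparison)
      show "\<forall>\<^sub>F m in sequentially. norm (\<phi> (?P m) - \<phi> a) \<le> C * ip_norm g (?P m - a)"
      proof (rule always_eventually, rule allI)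
        fix m
        have "\<phi> (?P m - a) = \<phi> (?P m) - \<phi> a"
          using add[OF mem(3)[OF PV[of m] a] a] by simp
        then show "norm (\<phi> (?P m) - \<phi> a) \<le> C * ip_norm g (?P m - a)"
          using bound[OF mem(3)[OF PV[of m] a]] by simp
      qed
      show "(\<lambda>m. C * ip_norm g (?P m - a)) \<longlonglongrightarrow> 0"
        using tendsto_mult_left[OF basis_expansion[OF assms(1-3) a], of C] by simp
    qed
    show ?thesis by (rule LIMSEQ_unique[OF 1[unfolded 2] 3])
  qed
  then show ?thesis using r by blast
qed

lemma gram_schmidt_step:
  assumes "finite D" "D \<subseteq> V" "x \<in> V"
    "\<And>e e'. e \<in> D \<Longrightarrow> e' \<in> D \<Longrightarrow> e \<noteq> e' \<Longrightarrow> g e e' = 0"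
    "\<And>e. e \<in> D \<Longrightarrow> g e e = 1 \<or> e = 0"
  shows "\<exists>w\<in>V. (\<forall>e\<in>D. g w e = 0) \<and> (g w w = 1 \<or> w = 0) \<and>
    x \<in> span (insert w D) \<and> w \<in> span (insert x D)"
proof -
  define p where "p = (\<Sum>e\<in>D. g x e *\<^sub>R e)"
  define v where "v = x - p"
  have pV: "p \<in> V" and vV: "v \<in> V" using assms by (auto simp: p_def v_def subset_iff)
  have ps: "p \<in> span D" unfolding p_def by (intro span_sum span_scale span_base)
  have orth: "g v e = 0" if e: "e \<in> D" for e
  proof -
    have "g p e = (\<Sum>e'\<in>D. g x e' * g e' e)"
      unfolding p_def using assms(2) e
      by (subst sum_left) (auto simp: subset_iff intro!: sum.cong scale_left)
    also have "\<dots> = (\<Sum>e'\<in>D. if e' = e then g x e * g e e else 0)"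
      using assms e by (intro sum.cong) auto
    also have "\<dots> = g x e" using assms(1,3) assms(5)[OF e] e by auto
    finally show ?thesis using assms e pV by (auto simp: v_def diff_left)
  qed
  define w where "w = (1 / ip_norm g v) *\<^sub>R v"
  have wV: "w \<in> V" using vV by (auto simp: w_def)
  have "g w e = 0" if "e \<in> D" for e
    using orth[OF that] vV assms that unfolding w_def by (auto simp: scale_left)
  moreover have "g w w = 1 \<or> w = 0"
  proof (cases "v = 0")
    case False
    then have "g w w = 1"
      using vV pos[OF vV] norm_eq_0[OF vV] norm_sq[OF vV] unfolding w_def
      by (simp add: scale_left scale_right power2_eq_square)
    then show ?thesis ..
  qed (simp add: w_def)
  moreover have "x \<in> span (insert w D)"
  proof -
    have "v = ip_norm g v *\<^sub>R w" using norm_eq_0[OF vV] by (auto simp: w_def)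
    then have "v \<in> span (insert w D)" by (metis insertI1 span_base span_scale)
    moreover have "p \<in> span (insert w D)" using ps span_mono[of D "insert w D"] by blast
    ultimately have "v + p \<in> span (insert w D)" by (rule span_add)
    then show ?thesis by (simp add: v_def)
  qed
  moreover have "w \<in> span (insert x D)"
  proof -
    have "p \<in> span (insert x D)" using ps span_mono[of D "insert x D"] by blast
    then have "v \<in> span (insert x D)"
      unfolding v_def by (intro span_diff[OF span_base]) auto
    then show ?thesis unfolding w_def by (rule span_scale)
  qed
  ultimately show ?thesis using wV by blast
qed

lemma gram_schmidt:
  assumes x: "\<And>n. x n \<in> V"
  shows "\<exists>d. orthoseq d \<and> (\<forall>n. x n \<in> span (d ` {..n})) \<and> (\<forall>n. d n \<in> span (x ` {..n}))"
proof -
  define P where "P n w D \<longleftrightarrow> w \<in> V \<and> (\<forall>e\<in>D. g w e = 0) \<and> (g w w = 1 \<or> w = 0) \<and>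
    x n \<in> span (insert w D) \<and> w \<in> span (insert (x n) D)" for n w D
  \<comment> \<open>Well-founded recursion on the index: each vector depends on the set of its predecessors.\<close>
  have "\<exists>d. \<forall>n. d n = (SOME w. P n w (d ` {..<n}))"
  proof -
    define R where "R = (\<lambda>(f::nat \<Rightarrow> 'a) n. SOME w. P n w (f ` {..<n}))"
    define d where "d = wfrec {(m, n). m < n} R"
    have "d n = R d n" for n
    proof -
      have "adm_wf {(m, n). m < n} R"
        unfolding adm_wf_def
      proof (intro allI impI)
        fix f h :: "nat \<Rightarrow> 'a" and n
        assume "\<forall>z. (z, n) \<in> {(m, n). m < n} \<longrightarrow> f z = h z"
        then have "f ` {..<n} = h ` {..<n}" by (intro image_cong) auto
        then show "R f n = R h n" by (simp add: R_def)
      qed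
      moreover have "wf {(m::nat, n). m < n}" by (rule wf)
      ultimately show ?thesis unfolding d_def using wfrec_fixpoint by metis
    qed
    then show ?thesis unfolding R_def by blast
  qed
  then obtain d where d: "\<And>n. d n = (SOME w. P n w (d ` {..<n}))" by blast
  have step: "P n (d n) (d ` {..<n})" for n
  proof (induction n rule: less_induct)
    case (less n)
    have "\<exists>w. P n w (d ` {..<n})"
    proof -
      have orth: "g (d j) (d k) = 0" if "j < n" "k < n" "d j \<noteq> d k" for j k
      proof (cases "j < k")
        case True
        then have "g (d k) (d j) = 0" using less[OF that(2)] unfolding P_def by auto
        then show ?thesis using less[OF that(1)] less[OF that(2)] sym unfolding P_def by metis
      next
        case False
        then have "k < j" using that by (cases "j = k") auto
        then show ?thesis using less[OF that(1)] unfolding P_def by auto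
      qed
      have "\<exists>w\<in>V. (\<forall>e\<in>d ` {..<n}. g w e = 0) \<and> (g w w = 1 \<or> w = 0) \<and>
          x n \<in> span (insert w (d ` {..<n})) \<and> w \<in> span (insert (x n) (d ` {..<n}))"
      proof (rule gram_schmidt_step)
        show "d ` {..<n} \<subseteq> V" using less unfolding P_def by auto
        fix e assume "e \<in> d ` {..<n}"
        then show "g e e = 1 \<or> e = 0" using less unfolding P_def by auto
      qed (use x orth in auto)
      then show ?thesis unfolding P_def by blast
    qed
    then show ?case unfolding d[of n] by (rule someI_ex)
  qed
  have insert_eq: "insert (d n) (d ` {..<n}) = d ` {..n}" for n
    by (auto simp: le_less)
  have "orthoseq d"
    unfolding orthoseq_def
  proof (intro conjI allI impI)
    fix j k :: nat
    show "d k \<in> V" "g (d k) (d k) = 1 \<or> d k = 0" using step[of k] unfolding P_def by auto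
    assume "j \<noteq> k"
    then consider "j < k" | "k < j" by linarith
    then show "g (d j) (d k) = 0"
    proof cases
      case 1
      then have "g (d k) (d j) = 0" using step[of k] unfolding P_def by auto
      then show ?thesis using step[of j] step[of k] sym unfolding P_def by metis
    qed (use step[of j] in \<open>auto simp: P_def\<close>)
  qed
  moreover have "x n \<in> span (d ` {..n})" for n
    using step[of n] unfolding P_def insert_eq by blast
  moreover have "d n \<in> span (x ` {..n})" for n
  proof (induction n rule: less_induct)
    case (less n)
    have "d ` {..<n} \<subseteq> span (x ` {..n})"
    proof
      fix e assume "e \<in> d ` {..<n}"
      then obtain m where m: "m < n" "e = d m" by auto
      then have "e \<in> span (x ` {..m})" using less by blast
      moreover have "x ` {..m} \<subseteq> x ` {..n}" using m by auto
      ultimately show "e \<in> span (x ` {..n})" using span_mono by blast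
    qed
    then have "insert (x n) (d ` {..<n}) \<subseteq> span (x ` {..n})" by (auto intro: span_base)
    then have "span (insert (x n) (d ` {..<n})) \<subseteq> span (x ` {..n})"
      by (rule span_minimal) simp
    then show ?case using step[of n] unfolding P_def by blast
  qed
  ultimately show ?thesis by blast
qed

lemma ip_zero_on_span:
  assumes "a \<in> V" "X \<subseteq> V" "\<And>x. x \<in> X \<Longrightarrow> g a x = 0" "y \<in> span X"
  shows "g a y = 0"
proof -
  have "y \<in> V \<and> g a y = 0"
    using assms(4)
  proof (induction rule: span_induct_alt)
    case (step c x y)
    then show ?case using assms by (auto simp: add_right scale_right subset_iff)
  qed (use assms in auto)
  then show ?thesis ..
qed

lemma countable_total_orthoseq:
  assumes "\<And>n. x n \<in> V" "total x"
  shows "\<exists>d. orthoseq d \<and> total d \<and> (\<forall>n. d n \<in> span (range x))"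
proof -
  obtain d where "orthoseq d \<and> (\<forall>n. x n \<in> span (d ` {..n})) \<and> (\<forall>n. d n \<in> span (x ` {..n}))"
    using gram_schmidt[of x, OF assms(1)] ..
  then have d: "orthoseq d" "\<And>n. x n \<in> span (d ` {..n})" "\<And>n. d n \<in> span (x ` {..n})"
    by simp_all
  have "total d"
    unfolding total_def
  proof (intro ballI impI)
    fix a assume a: "a \<in> V" "\<forall>k. g a (d k) = 0"
    have "g a (x n) = 0" for n
    proof (rule ip_zero_on_span[OF a(1) _ _ d(2)[of n]])
      show "d ` {..n} \<subseteq> V" using orthoseqD(1)[OF d(1)] by auto
      show "g a e = 0" if "e \<in> d ` {..n}" for e using that a(2) by auto
    qed
    then show "a = 0" using assms(2)[unfolded total_def, rule_format, OF a(1)] by simp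
  qed
  moreover have "d n \<in> span (range x)" for n
    using d(3)[of n] span_mono[of "x ` {..n}" "range x"] by (meson image_mono subset_UNIV subsetD)
  ultimately show ?thesis using d(1) by (intro exI[of _ d] conjI allI)
qed

text \<open>The sequence is obtained from an enumeration of \<open>S\<close> that is continued by zeros.\<close>

lemma finite_coordinates:
  assumes "finite S" "S \<subseteq> V"
  shows "\<exists>d m. orthoseq d \<and> (\<forall>x\<in>S. \<forall>y\<in>V. g x y = (\<Sum>k<m::nat. g (d k) x * g (d k) y))"
proof -
  obtain xs where xs: "set xs = S" using finite_list[OF assms(1)] by blast
  define x where "x n = (if n < length xs then xs ! n else 0)" for n
  have xV: "x n \<in> V" for n using assms xs by (auto simp: x_def)
  obtain d where "orthoseq d \<and> (\<forall>n. x n \<in> span (d ` {..n})) \<and> (\<forall>n. d n \<in> span (x ` {..n}))"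
    using gram_schmidt[of x, OF xV] ..
  then have d: "orthoseq d" "\<And>n. x n \<in> span (d ` {..n})" by simp_all
  let ?m = "length xs"
  have "g z y = (\<Sum>k<?m. g (d k) z * g (d k) y)" if z: "z \<in> S" and y: "y \<in> V" for z y
  proof -
    obtain n where n: "n < ?m" "z = xs ! n" using z xs by (metis in_set_conv_nth)
    have "d ` {..n} \<subseteq> d ` {..<?m}" using n by auto
    then have "span (d ` {..n}) \<subseteq> span (d ` {..<?m})" by (rule span_mono)
    then have "z \<in> span (d ` {..<?m})" using d(2)[of n] n by (auto simp: x_def)
    then have "z \<in> V \<and> g z y = (\<Sum>k<?m. g (d k) z * g (d k) y)"
    proof (induction rule: span_induct_alt)
      case base
      then show ?case using y by (auto simp: orthoseqD[OF d(1)])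
    next
      case (step c e w)
      then obtain i where i: "i < ?m" "e = d i" by auto
      have eV: "e \<in> V" using i orthoseqD(1)[OF d(1)] by simp
      have "(\<Sum>k<?m. g (d k) e * g (d k) y) = (\<Sum>k<?m. if k = i then g (d i) y else 0)"
      proof (intro sum.cong refl)
        fix k
        show "g (d k) e * g (d k) y = (if k = i then g (d i) y else 0)"
          using basis_coefficient[OF d(1) y, of i] i by (auto simp: orthoseqD[OF d(1)] mult.commute)
      qed
      then have e: "(\<Sum>k<?m. g (d k) e * g (d k) y) = g e y" using i by simp
      have "(\<Sum>k<?m. g (d k) (c *\<^sub>R e + w) * g (d k) y)
          = c * (\<Sum>k<?m. g (d k) e * g (d k) y) + (\<Sum>k<?m. g (d k) w * g (d k) y)"
        using eV step
        by (simp add: add_right scale_right orthoseqD[OF d(1)] sum_distrib_left sum.distrib algebra_simps)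
      then show ?case using e eV step y by (auto simp: add_left scale_left)
    qed
    then show ?thesis ..
  qed
  then show ?thesis using d(1) by (intro exI[of _ d] exI[of _ ?m] conjI ballI)
qed

end

section \<open>Algebraic tensors\<close>

definition vec_coord :: "('a \<Rightarrow> 'a \<Rightarrow> real) \<Rightarrow> (nat \<Rightarrow> 'a) \<Rightarrow> 'a cplx \<Rightarrow> nat \<Rightarrow> complex" where
  "vec_coord g d x k = Complex (g (d k) (fst x)) (g (d k) (snd x))"

text \<open>The multi-index \<open>j\<close> stands for the product \<open>d (j 0) \<otimes> \<dots> \<otimes> d (j (n - 1))\<close>.\<close>

definition tensor_coord ::
    "('a \<Rightarrow> 'a \<Rightarrow> real) \<Rightarrow> (nat \<Rightarrow> 'a) \<Rightarrow> nat \<Rightarrow> 'a formal_tensor \<Rightarrow> (nat \<Rightarrow> nat) \<Rightarrow> complex" where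
  "tensor_coord g d n t j = (\<Sum>(c, x)\<leftarrow>t. c * (\<Prod>i<n. vec_coord g d (x i) (j i)))"

lemma tensor_coord_append [simp]:
  "tensor_coord g d n (s @ t) j = tensor_coord g d n s j + tensor_coord g d n t j"
  by (simp add: tensor_coord_def)

lemma tensor_coord_diff [simp]:
  "tensor_coord g d n (tensor_diff s t) j = tensor_coord g d n s j - tensor_coord g d n t j"
proof -
  have "(\<Sum>(c, x)\<leftarrow>map (\<lambda>(c, x). (- c, x)) t. c * P x) = - (\<Sum>(c, x)\<leftarrow>t. c * P x)"
    for P :: "(nat \<Rightarrow> 'a cplx) \<Rightarrow> complex"
    by (induction t) auto
  then show ?thesis by (simp add: tensor_coord_def tensor_diff_def)
qed

lemma formal_tensors_append:
  "s \<in> formal_tensors V n \<Longrightarrow> t \<in> formal_tensors V n \<Longrightarrow> s @ t \<in> formal_tensors V n"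
  by (auto simp: formal_tensors_def)

lemma formal_tensors_diff:
  "s \<in> formal_tensors V n \<Longrightarrow> t \<in> formal_tensors V n \<Longrightarrow> tensor_diff s t \<in> formal_tensors V n"
  by (auto simp: formal_tensors_def tensor_diff_def)

lemma sum_list_of_sums:
  fixes f :: "'b \<Rightarrow> 'c \<Rightarrow> 'd::comm_monoid_add"
  shows "(\<Sum>x\<leftarrow>xs. \<Sum>j\<in>I. f x j) = (\<Sum>j\<in>I. \<Sum>x\<leftarrow>xs. f x j)"
  by (induction xs) (auto simp: sum.distrib)

lemma sum_list_of_sums2:
  fixes f :: "'b \<Rightarrow> 'c \<Rightarrow> 'b \<Rightarrow> 'c \<Rightarrow> 'e \<Rightarrow> 'd::comm_monoid_add"
  shows "(\<Sum>(c, x)\<leftarrow>s. \<Sum>(e, y)\<leftarrow>t. \<Sum>j\<in>I. f c x e y j) =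
    (\<Sum>j\<in>I. \<Sum>(c, x)\<leftarrow>s. \<Sum>(e, y)\<leftarrow>t. f c x e y j)"
  by (simp add: case_prod_unfold sum_list_of_sums)

lemma sum_list_product:
  fixes f h :: "'b \<Rightarrow> 'c \<Rightarrow> complex"
  shows "(\<Sum>(c, x)\<leftarrow>s. \<Sum>(e, y)\<leftarrow>t. f c x * h e y) = (\<Sum>(c, x)\<leftarrow>s. f c x) * (\<Sum>(e, y)\<leftarrow>t. h e y)"
  by (induction s) (auto simp: case_prod_beta sum_list_const_mult distrib_right)

text \<open>The Hermitian form on algebraic tensors is a Gram form: after a Gram--Schmidt process on
  the finitely many vectors involved it is a finite sum of products of coordinates. This carries
  its positivity, the Cauchy--Schwarz inequality and the triangle inequality.\<close>

lemma tensor_herm_coordinates: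
  assumes "ip_space V g" "set ts \<subseteq> formal_tensors V n"
  obtains d and m :: nat where
    "\<And>s t. s \<in> set ts \<Longrightarrow> t \<in> set ts \<Longrightarrow> tensor_herm g n s t =
       (\<Sum>j\<in>PiE {..<n} (\<lambda>_. {..<m}). tensor_coord g d n s j * cnj (tensor_coord g d n t j))"
proof -
  interpret ip_space V g by (rule assms)
  define S where "S = (\<Union>t\<in>set ts. \<Union>(c, x)\<in>set t. \<Union>i\<in>{..<n}. {fst (x i), snd (x i)})"
  have xV: "x i \<in> V \<times> V" if "t \<in> set ts" "(c, x) \<in> set t" "i < n" for t c x i
    using assms(2) that unfolding formal_tensors_def by fastforce
  have "finite S" unfolding S_def by (intro finite_UN_I) auto
  moreover have "S \<subseteq> V" unfolding S_def using xV by (fastforce simp: mem_Times_iff)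
  ultimately obtain d m where
    d: "\<forall>x\<in>S. \<forall>y\<in>V. g x y = (\<Sum>k<m::nat. g (d k) x * g (d k) y)"
    using finite_coordinates by blast
  have herm: "herm g x y = (\<Sum>k<m. vec_coord g d x k * cnj (vec_coord g d y k))"
    if "fst x \<in> S" "snd x \<in> S" "y \<in> V \<times> V" for x y
    using that d unfolding herm_def vec_coord_def
    by (intro complex_eqI) (auto simp: sum.distrib sum_subtractf)
  have prod: "(\<Prod>i<n. herm g (x i) (y i)) =
      (\<Sum>j\<in>PiE {..<n} (\<lambda>_. {..<m}). (\<Prod>i<n. vec_coord g d (x i) (j i)) *
         cnj (\<Prod>i<n. vec_coord g d (y i) (j i)))"
    if "s \<in> set ts" "(c, x) \<in> set s" "t \<in> set ts" "(e, y) \<in> set t" for s t c e x y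
  proof -
    have "(\<Prod>i<n. herm g (x i) (y i)) =
        (\<Prod>i<n. \<Sum>k<m. vec_coord g d (x i) k * cnj (vec_coord g d (y i) k))"
    proof (intro prod.cong refl herm)
      fix i assume i: "i \<in> {..<n}"
      show "fst (x i) \<in> S" "snd (x i) \<in> S" unfolding S_def using that i by fastforce+
      show "y i \<in> V \<times> V" using xV that i by blast
    qed
    also have "\<dots> = (\<Sum>j\<in>PiE {..<n} (\<lambda>_. {..<m}).
        \<Prod>i<n. vec_coord g d (x i) (j i) * cnj (vec_coord g d (y i) (j i)))"
      by (subst prod_sum_PiE) auto
    finally show ?thesis by (simp add: prod.distrib)
  qed
  show ?thesis
  proof
    fix s t assume st: "s \<in> set ts" "t \<in> set ts"
    let ?I = "PiE {..<n} (\<lambda>_. {..<m})"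
    let ?X = "\<lambda>x j. \<Prod>i<n. vec_coord g d (x i) (j i)"
    have "tensor_herm g n s t =
        (\<Sum>(c, x)\<leftarrow>s. \<Sum>(e, y)\<leftarrow>t. \<Sum>j\<in>?I. (c * ?X x j) * cnj (e * ?X y j))"
      unfolding tensor_herm_def
    proof (intro arg_cong[where f = sum_list] map_cong refl, clarsimp, 
           intro arg_cong[where f = sum_list] map_cong refl, clarsimp)
      fix c x e y assume "(c, x) \<in> set s" "(e, y) \<in> set t"
      from prod[OF st(1) this(1) st(2) this(2)]
      show "c * cnj e * (\<Prod>i<n. herm g (x i) (y i)) =
          (\<Sum>j\<in>?I. c * ?X x j * (cnj e * (\<Prod>i<n. cnj (vec_coord g d (y i) (j i)))))"
        by (simp add: sum_distrib_left algebra_simps)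
    qed
    also have "\<dots> = (\<Sum>j\<in>?I. \<Sum>(c, x)\<leftarrow>s. \<Sum>(e, y)\<leftarrow>t. (c * ?X x j) * cnj (e * ?X y j))"
      by (rule sum_list_of_sums2)
    also have "\<dots> = (\<Sum>j\<in>?I. tensor_coord g d n s j * cnj (tensor_coord g d n t j))"
    proof (intro sum.cong refl)
      fix j
      have *: "cnj (\<Sum>(e, y)\<leftarrow>t. e * ?X y j) = (\<Sum>(e, y)\<leftarrow>t. cnj (e * ?X y j))"
        by (induction t) auto
      show "(\<Sum>(c, x)\<leftarrow>s. \<Sum>(e, y)\<leftarrow>t. (c * ?X x j) * cnj (e * ?X y j)) =
          tensor_coord g d n s j * cnj (tensor_coord g d n t j)"
        unfolding tensor_coord_def * by (rule sum_list_product)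
    qed
    finally show "tensor_herm g n s t =
      (\<Sum>j\<in>?I. tensor_coord g d n s j * cnj (tensor_coord g d n t j))" .
  qed
qed

lemma formal_norm_coordinates:
  assumes "ip_space V g" "set ts \<subseteq> formal_tensors V n"
  shows "\<exists>I d. finite I \<and>
    (\<forall>t\<in>set ts. formal_norm g n t = L2_set (\<lambda>j. cmod (tensor_coord g d n t j)) I) \<and>
    (\<forall>s\<in>set ts. \<forall>t\<in>set ts.
       tensor_herm g n s t = (\<Sum>j\<in>I. tensor_coord g d n s j * cnj (tensor_coord g d n t j)))"
proof -
  obtain d and m :: nat where d:
    "\<And>s t. s \<in> set ts \<Longrightarrow> t \<in> set ts \<Longrightarrow> tensor_herm g n s t =
       (\<Sum>j\<in>PiE {..<n} (\<lambda>_. {..<m}). tensor_coord g d n s j * cnj (tensor_coord g d n t j))"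
    using tensor_herm_coordinates[OF assms] by blast
  show ?thesis
  proof (intro exI conjI ballI)
    show "finite (PiE {..<n} (\<lambda>_. {..<m}))" by (intro finite_PiE) auto
    fix t assume t: "t \<in> set ts"
    show "formal_norm g n t =
        L2_set (\<lambda>j. cmod (tensor_coord g d n t j)) (PiE {..<n} (\<lambda>_. {..<m}))"
      unfolding formal_norm_def d[OF t t] L2_set_def
      by (simp add: cmod_power2 flip: power2_eq_square)
  qed (rule d)
qed

lemma formal_norm_nonneg:
  assumes "ip_space V g" "t \<in> formal_tensors V n"
  shows "formal_norm g n t \<ge> 0"
proof -
  have ts: "set [t] \<subseteq> formal_tensors V n" using assms by simp
  obtain I d where "finite I"
    "\<forall>u\<in>set [t]. formal_norm g n u = L2_set (\<lambda>j. cmod (tensor_coord g d n u j)) I"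
    "\<forall>u\<in>set [t]. \<forall>v\<in>set [t].
       tensor_herm g n u v = (\<Sum>j\<in>I. tensor_coord g d n u j * cnj (tensor_coord g d n v j))"
    using formal_norm_coordinates[OF assms(1) ts] by blast
  then show ?thesis by simp
qed

lemma tensor_cauchy_schwarz:
  assumes "ip_space V g" "s \<in> formal_tensors V n" "t \<in> formal_tensors V n"
  shows "cmod (tensor_herm g n s t) \<le> formal_norm g n s * formal_norm g n t"
proof -
  have ts: "set [s, t] \<subseteq> formal_tensors V n" using assms by simp
  obtain I d where I: "finite I"
    "\<forall>u\<in>set [s, t]. formal_norm g n u = L2_set (\<lambda>j. cmod (tensor_coord g d n u j)) I"
    "\<forall>u\<in>set [s, t]. \<forall>v\<in>set [s, t].
       tensor_herm g n u v = (\<Sum>j\<in>I. tensor_coord g d n u j * cnj (tensor_coord g d n v j))"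
    using formal_norm_coordinates[OF assms(1) ts] by blast
  have st: "tensor_herm g n s t = (\<Sum>j\<in>I. tensor_coord g d n s j * cnj (tensor_coord g d n t j))"
    using I(3) by simp
  have "cmod (tensor_herm g n s t) \<le>
      (\<Sum>j\<in>I. \<bar>cmod (tensor_coord g d n s j)\<bar> * \<bar>cmod (tensor_coord g d n t j)\<bar>)"
    unfolding st by (rule order_trans[OF norm_sum]) (simp add: norm_mult)
  also have "\<dots> \<le> formal_norm g n s * formal_norm g n t"
    using L2_set_mult_ineq[of "\<lambda>j. cmod (tensor_coord g d n s j)" "\<lambda>j. cmod (tensor_coord g d n t j)" I] I(2)
    by simp
  finally show ?thesis .
qed

lemma L2_set_triangle_complex:
  assumes "\<And>j. j \<in> I \<Longrightarrow> cmod (a j) \<le> cmod (b j) + cmod (c j)"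
  shows "L2_set (\<lambda>j. cmod (a j)) I \<le> L2_set (\<lambda>j. cmod (b j)) I + L2_set (\<lambda>j. cmod (c j)) I"
proof -
  have "L2_set (\<lambda>j. cmod (a j)) I \<le> L2_set (\<lambda>j. cmod (b j) + cmod (c j)) I"
    using assms by (intro L2_set_mono) auto
  also have "\<dots> \<le> L2_set (\<lambda>j. cmod (b j)) I + L2_set (\<lambda>j. cmod (c j)) I"
    by (rule L2_set_triangle_ineq)
  finally show ?thesis .
qed

lemma formal_norm_append:
  assumes "ip_space V g" "s \<in> formal_tensors V n" "t \<in> formal_tensors V n"
  shows "formal_norm g n (s @ t) \<le> formal_norm g n s + formal_norm g n t"
proof -
  have ts: "set [s, t, s @ t] \<subseteq> formal_tensors V n" using assms formal_tensors_append by auto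
  obtain I d where "finite I"
    "\<forall>u\<in>set [s, t, s @ t]. formal_norm g n u = L2_set (\<lambda>j. cmod (tensor_coord g d n u j)) I"
    "\<forall>u\<in>set [s, t, s @ t]. \<forall>v\<in>set [s, t, s @ t].
       tensor_herm g n u v = (\<Sum>j\<in>I. tensor_coord g d n u j * cnj (tensor_coord g d n v j))"
    using formal_norm_coordinates[OF assms(1) ts] by blast
  then show ?thesis by (simp add: L2_set_triangle_complex norm_triangle_ineq)
qed

lemma formal_norm_difference:
  assumes "ip_space V g" "s \<in> formal_tensors V n" "t \<in> formal_tensors V n"
  shows "\<bar>formal_norm g n s - formal_norm g n t\<bar> \<le> formal_norm g n (tensor_diff s t)"
proof -
  have ts: "set [s, t, tensor_diff s t] \<subseteq> formal_tensors V n"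
    using assms formal_tensors_diff by auto
  obtain I d where I: "finite I"
    "\<forall>u\<in>set [s, t, tensor_diff s t]. formal_norm g n u = L2_set (\<lambda>j. cmod (tensor_coord g d n u j)) I"
    "\<forall>u\<in>set [s, t, tensor_diff s t]. \<forall>v\<in>set [s, t, tensor_diff s t].
       tensor_herm g n u v = (\<Sum>j\<in>I. tensor_coord g d n u j * cnj (tensor_coord g d n v j))"
    using formal_norm_coordinates[OF assms(1) ts] by blast
  have tri: "cmod b \<le> cmod (a - b) + cmod a" for a b :: complex
    by (metis add.commute norm_minus_commute norm_triangle_sub)
  have "formal_norm g n s \<le> formal_norm g n (tensor_diff s t) + formal_norm g n t"
    using I(2) by (simp add: L2_set_triangle_complex norm_triangle_sub add.commute)
  moreover have "formal_norm g n t \<le> formal_norm g n (tensor_diff s t) + formal_norm g n s"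
    using I(2) by (simp add: L2_set_triangle_complex tri)
  ultimately show ?thesis by linarith
qed

lemma formal_norm_diff_append:
  assumes "ip_space V g" "s \<in> formal_tensors V n" "t \<in> formal_tensors V n"
    "s' \<in> formal_tensors V n" "t' \<in> formal_tensors V n"
  shows "formal_norm g n (tensor_diff (s @ s') (t @ t')) \<le>
    formal_norm g n (tensor_diff s t) + formal_norm g n (tensor_diff s' t')"
proof -
  let ?l = "[tensor_diff (s @ s') (t @ t'), tensor_diff s t, tensor_diff s' t']"
  have ts: "set ?l \<subseteq> formal_tensors V n"
    by (simp add: assms formal_tensors_diff formal_tensors_append)
  obtain I d where I: "finite I"
    "\<forall>u\<in>set ?l. formal_norm g n u = L2_set (\<lambda>j. cmod (tensor_coord g d n u j)) I"
    "\<forall>u\<in>set ?l. \<forall>v\<in>set ?l.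
       tensor_herm g n u v = (\<Sum>j\<in>I. tensor_coord g d n u j * cnj (tensor_coord g d n v j))"
    using formal_norm_coordinates[OF assms(1) ts] by blast
  have "cmod (a + a' - (b + b')) \<le> cmod (a - b) + cmod (a' - b')" for a a' b b' :: complex
    using norm_triangle_ineq[of "a - b" "a' - b'"] by (simp add: algebra_simps)
  then show ?thesis using I(2) by (simp add: L2_set_triangle_complex)
qed

section \<open>The norm of a symmetric tensor power\<close>

lemma tensor_seqD:
  assumes "tensor_seq V g n t f"
  shows "t k \<in> formal_tensors V n" "(\<lambda>k. tensor_pair n (t k) y) \<longlonglongrightarrow> f y"
    "\<And>\<epsilon>. \<epsilon> > 0 \<Longrightarrow> \<exists>N. \<forall>j\<ge>N. \<forall>k\<ge>N. formal_norm g n (tensor_diff (t j) (t k)) < \<epsilon>"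
  using assms by (simp_all add: tensor_seq_def)

lemma tensor_seq_norms_converge:
  fixes V :: "'a::real_inner set"
  assumes "ip_space V g" "tensor_seq V g n t f"
  obtains r where "(\<lambda>k. formal_norm g n (t k)) \<longlonglongrightarrow> r" "r \<ge> 0"
proof -
  have "Cauchy (\<lambda>k. formal_norm g n (t k))"
  proof (rule CauchyI)
    fix e :: real assume "e > 0"
    from tensor_seqD(3)[OF assms(2) this] obtain N where
      N: "\<forall>j\<ge>N. \<forall>k\<ge>N. formal_norm g n (tensor_diff (t j) (t k)) < e" ..
    show "\<exists>M. \<forall>m\<ge>M. \<forall>k\<ge>M. norm (formal_norm g n (t m) - formal_norm g n (t k)) < e"
    proof (intro exI[of _ N] allI impI)
      fix m k assume "N \<le> m" "N \<le> k"
      then show "norm (formal_norm g n (t m) - formal_norm g n (t k)) < e"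
        using N formal_norm_difference[OF assms(1) tensor_seqD(1)[OF assms(2), of m]
            tensor_seqD(1)[OF assms(2), of k]] by fastforce
    qed
  qed
  then obtain r where r: "(\<lambda>k. formal_norm g n (t k)) \<longlonglongrightarrow> r"
    using Cauchy_convergent_iff convergent_def by blast
  have "r \<ge> 0"
    by (rule LIMSEQ_le_const[OF r])
      (use formal_norm_nonneg[OF assms(1) tensor_seqD(1)[OF assms(2)]] in blast)
  then show ?thesis using that r by blast
qed

lemma tensor_limit_nonneg:
  fixes V :: "'a::real_inner set"
  assumes "ip_space V g" "tensor_seq V g n t f" "(\<lambda>k. formal_norm g n (t k)) \<longlonglongrightarrow> r"
  shows "r \<ge> 0"
  by (rule LIMSEQ_le_const[OF assms(3)])
    (use formal_norm_nonneg[OF assms(1) tensor_seqD(1)[OF assms(2)]] in blast)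

text \<open>As the norm is an infimum over all representing sequences, an estimate from below has to hold
  along each of them, while any single one gives an estimate from above.\<close>

lemma tensor_norm_lower:
  fixes V :: "'a::real_inner set"
  assumes "ip_space V g" "f \<in> sym_tensor_power V g n"
    and "\<And>t r. tensor_seq V g n t f \<Longrightarrow> (\<lambda>k. formal_norm g n (t k)) \<longlonglongrightarrow> r \<Longrightarrow> a \<le> r"
  shows "a \<le> tensor_norm V g n f"
proof -
  obtain t where t: "tensor_seq V g n t f" using assms(2) unfolding sym_tensor_power_def by blast
  obtain r where "(\<lambda>k. formal_norm g n (t k)) \<longlonglongrightarrow> r"
    using tensor_seq_norms_converge[OF assms(1) t] .
  then have "{r. \<exists>t. tensor_seq V g n t f \<and> (\<lambda>k. formal_norm g n (t k)) \<longlonglongrightarrow> r} \<noteq> {}"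
    using t by blast
  then show ?thesis unfolding tensor_norm_def by (rule cInf_greatest) (use assms(3) in blast)
qed

lemma tensor_norm_nonneg:
  fixes V :: "'a::real_inner set"
  assumes "ip_space V g" "f \<in> sym_tensor_power V g n"
  shows "tensor_norm V g n f \<ge> 0"
  using tensor_norm_lower[OF assms] tensor_limit_nonneg[OF assms(1)] by blast

lemma tensor_norm_le_limit:
  fixes V :: "'a::real_inner set"
  assumes "ip_space V g" "tensor_seq V g n t f" "(\<lambda>k. formal_norm g n (t k)) \<longlonglongrightarrow> r"
  shows "tensor_norm V g n f \<le> r"
  unfolding tensor_norm_def
proof (rule cInf_lower)
  show "r \<in> {r. \<exists>t. tensor_seq V g n t f \<and> (\<lambda>k. formal_norm g n (t k)) \<longlonglongrightarrow> r}"
    using assms(2,3) by blast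
  show "bdd_below {r. \<exists>t. tensor_seq V g n t f \<and> (\<lambda>k. formal_norm g n (t k)) \<longlonglongrightarrow> r}"
    by (rule bdd_belowI[of _ 0]) (use tensor_limit_nonneg[OF assms(1)] in blast)
qed

lemma tensor_norm_le:
  fixes V :: "'a::real_inner set"
  assumes "ip_space V g" "tensor_seq V g n t f" "\<And>k. formal_norm g n (t k) \<le> C"
  shows "tensor_norm V g n f \<le> C"
proof -
  obtain r where r: "(\<lambda>k. formal_norm g n (t k)) \<longlonglongrightarrow> r"
    using tensor_seq_norms_converge[OF assms(1,2)] .
  have "r \<le> C" by (rule LIMSEQ_le_const2[OF r]) (use assms(3) in blast)
  then show ?thesis using tensor_norm_le_limit[OF assms(1,2) r] by linarith
qed

lemma tensor_seq_append:
  fixes V :: "'a::real_inner set"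
  assumes "ip_space V g" "tensor_seq V g n s f" "tensor_seq V g n t h"
  shows "tensor_seq V g n (\<lambda>k. s k @ t k) (\<lambda>y. f y + h y)"
  unfolding tensor_seq_def
proof (intro conjI allI impI)
  note s = tensor_seqD[OF assms(2)] and t = tensor_seqD[OF assms(3)]
  show "s k @ t k \<in> formal_tensors V n" for k
    by (rule formal_tensors_append[OF s(1) t(1)])
  show "(\<lambda>k. tensor_pair n (s k @ t k) y) \<longlonglongrightarrow> f y + h y" for y
    using tendsto_add[OF s(2) t(2), of y y] by (simp add: tensor_pair_def)
  fix e :: real assume "e > 0"
  then have "e / 2 > 0" by simp
  from s(3)[OF this] t(3)[OF this] obtain N M where
    N: "\<forall>j\<ge>N. \<forall>k\<ge>N. formal_norm g n (tensor_diff (s j) (s k)) < e / 2" and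
    M: "\<forall>j\<ge>M. \<forall>k\<ge>M. formal_norm g n (tensor_diff (t j) (t k)) < e / 2" by blast
  show "\<exists>N. \<forall>j\<ge>N. \<forall>k\<ge>N. formal_norm g n (tensor_diff (s j @ t j) (s k @ t k)) < e"
  proof (intro exI[of _ "max N M"] allI impI)
    fix j k assume "max N M \<le> j" "max N M \<le> k"
    then have "formal_norm g n (tensor_diff (s j) (s k)) < e / 2"
      "formal_norm g n (tensor_diff (t j) (t k)) < e / 2" using N M by auto
    then show "formal_norm g n (tensor_diff (s j @ t j) (s k @ t k)) < e"
      using formal_norm_diff_append[OF assms(1) s(1)[of j] s(1)[of k] t(1)[of j] t(1)[of k]] by linarith
  qed
qed

lemma tensor_norm_add:
  fixes V :: "'a::real_inner set"
  assumes "ip_space V g" "f \<in> sym_tensor_power V g n" "h \<in> sym_tensor_power V g n"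
  shows "(\<lambda>y. f y + h y) \<in> sym_tensor_power V g n"
    "tensor_norm V g n (\<lambda>y. f y + h y) \<le> tensor_norm V g n f + tensor_norm V g n h"
proof -
  show "(\<lambda>y. f y + h y) \<in> sym_tensor_power V g n"
    using assms(2,3) tensor_seq_append[OF assms(1)] unfolding sym_tensor_power_def by fastforce
  have 1: "tensor_norm V g n (\<lambda>y. f y + h y) \<le> r + q"
    if s: "tensor_seq V g n s f" "(\<lambda>k. formal_norm g n (s k)) \<longlonglongrightarrow> r"
      and t: "tensor_seq V g n t h" "(\<lambda>k. formal_norm g n (t k)) \<longlonglongrightarrow> q" for s t r q
  proof -
    note st = tensor_seq_append[OF assms(1) s(1) t(1)]
    obtain l where l: "(\<lambda>k. formal_norm g n (s k @ t k)) \<longlonglongrightarrow> l"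
      using tensor_seq_norms_converge[OF assms(1) st] .
    have "l \<le> r + q"
      by (rule LIMSEQ_le[OF l tendsto_add[OF s(2) t(2)]])
        (use formal_norm_append[OF assms(1) tensor_seqD(1)[OF s(1)] tensor_seqD(1)[OF t(1)]] in blast)
    then show ?thesis using tensor_norm_le_limit[OF assms(1) st l] by linarith
  qed
  have "tensor_norm V g n (\<lambda>y. f y + h y) - q \<le> tensor_norm V g n f"
    if t: "tensor_seq V g n t h" "(\<lambda>k. formal_norm g n (t k)) \<longlonglongrightarrow> q" for t q
  proof (rule tensor_norm_lower[OF assms(1,2)])
    fix s r assume "tensor_seq V g n s f" "(\<lambda>k. formal_norm g n (s k)) \<longlonglongrightarrow> r"
    from 1[OF this t] show "tensor_norm V g n (\<lambda>y. f y + h y) - q \<le> r" by linarith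
  qed
  then have 2: "tensor_norm V g n (\<lambda>y. f y + h y) - tensor_norm V g n f \<le> q"
    if t: "tensor_seq V g n t h" "(\<lambda>k. formal_norm g n (t k)) \<longlonglongrightarrow> q" for t q
    using that by (simp add: algebra_simps)
  have "tensor_norm V g n (\<lambda>y. f y + h y) - tensor_norm V g n f \<le> tensor_norm V g n h"
    by (rule tensor_norm_lower[OF assms(1,3) 2])
  then show "tensor_norm V g n (\<lambda>y. f y + h y) \<le> tensor_norm V g n f + tensor_norm V g n h"
    by linarith
qed

section \<open>Complexified norms and dual norms\<close>

lemma cnorm_eq: "cnorm g (a, b) = sqrt (g a a + g b b)"
  by (simp add: cnorm_def herm_def)

lemma cnorm_conj:
  assumes "ip_space V g" "\<xi> \<in> V \<times> V"
  shows "cnorm g (fst \<xi>, - snd \<xi>) = cnorm g \<xi>"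
proof -
  interpret ip_space V g by (rule assms)
  have "g (- snd \<xi>) (- snd \<xi>) = g (snd \<xi>) (snd \<xi>)"
    using assms(2) scale_left[of "snd \<xi>" "- snd \<xi>" "-1"] scale_right[of "snd \<xi>" "snd \<xi>" "-1"]
    by (auto simp: mem_Times_iff)
  then show ?thesis by (simp add: cnorm_def herm_def)
qed

lemma herm_self:
  assumes "ip_space V g" "\<xi> \<in> V \<times> V"
  shows "herm g \<xi> \<xi> = of_real ((cnorm g \<xi>)\<^sup>2)"
proof -
  interpret ip_space V g by (rule assms)
  have "fst \<xi> \<in> V" "snd \<xi> \<in> V" using assms(2) by (auto simp: mem_Times_iff)
  then show ?thesis
    using nonneg[of "fst \<xi>"] nonneg[of "snd \<xi>"] sym[of "fst \<xi>" "snd \<xi>"]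
    by (simp add: herm_def cnorm_def complex_eq_iff)
qed

lemma cnorm_nonneg:
  assumes "ip_space V g" "\<xi> \<in> V \<times> V"
  shows "cnorm g \<xi> \<ge> 0"
  using assms ip_space.nonneg[of V g "fst \<xi>"] ip_space.nonneg[of V g "snd \<xi>"]
  by (auto simp: cnorm_def herm_def mem_Times_iff)

lemma formal_norm_simple:
  assumes "ip_space V g" "\<And>i. i < n \<Longrightarrow> z i \<in> V \<times> V"
  shows "formal_norm g n [(1, z)] = (\<Prod>i<n. cnorm g (z i))"
proof -
  have "(\<Prod>i<n. herm g (z i) (z i)) = (\<Prod>i<n. of_real ((cnorm g (z i))\<^sup>2))"
    by (intro prod.cong refl herm_self[OF assms(1)]) (use assms(2) in auto)
  then have "tensor_herm g n [(1, z)] [(1, z)] = of_real ((\<Prod>i<n. cnorm g (z i))\<^sup>2)"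
    by (simp add: tensor_herm_def prod_power_distrib)
  moreover have "(\<Prod>i<n. cnorm g (z i)) \<ge> 0"
    by (intro prod_nonneg cnorm_nonneg[OF assms(1)]) (use assms(2) in auto)
  ultimately show ?thesis unfolding formal_norm_def by (simp del: of_real_power of_real_prod)
qed

lemma herm_cauchy_schwarz:
  assumes "ip_space V g" "x \<in> V \<times> V" "y \<in> V \<times> V"
  shows "cmod (herm g x y) \<le> cnorm g x * cnorm g y"
proof -
  have "[(1, \<lambda>_. x)] \<in> formal_tensors V 1" "[(1, \<lambda>_. y)] \<in> formal_tensors V 1"
    using assms by (simp_all add: formal_tensors_def)
  from tensor_cauchy_schwarz[OF assms(1) this] show ?thesis
    using assms formal_norm_simple[OF assms(1), of 1 "\<lambda>_. x"] formal_norm_simple[OF assms(1), of 1 "\<lambda>_. y"]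
    by (simp add: tensor_herm_def)
qed

context nuclear_space_chain
begin

abbreviation "N p \<equiv> dual_norm (H p) (ip p)"

lemma ips: "ip_space (H p) (ip p)"
  using completion[of p] by (simp add: hilbert_completion_def ip_space_def)

lemma complete: "ip_complete (H p) (ip p)"
  and dense: "ip_dense (ip p) E (H p)"
  and subspace_E: "subspace E"
  and E_sub: "E \<subseteq> H p"
  using completion[of p] by (simp_all add: hilbert_completion_def ip_dense_def)

lemma E_mem [simp]:
  shows "0 \<in> E" "x \<in> E \<Longrightarrow> y \<in> E \<Longrightarrow> x + y \<in> E" "x \<in> E \<Longrightarrow> y \<in> E \<Longrightarrow> x - y \<in> E"
    "x \<in> E \<Longrightarrow> c *\<^sub>R x \<in> E"
  using subspace_E subspace_0 subspace_add subspace_diff subspace_scale by metis+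

lemma H_mono:
  assumes "p \<le> q"
  shows "H q \<subseteq> H p"
  using assms
proof (induction q rule: dec_induct)
  case (step q)
  then show ?case using inclusion[of q] by blast
qed simp

lemma ip_norm_mono:
  assumes "p \<le> q" "x \<in> H q"
  shows "ip_norm (ip p) x \<le> \<rho> ^ (q - p) * ip_norm (ip q) x"
  using assms
proof (induction q rule: dec_induct)
  case (step q)
  then have x: "x \<in> H q" using inclusion by blast
  have "ip_norm (ip p) x \<le> \<rho> ^ (q - p) * ip_norm (ip q) x" using step x by blast
  also have "\<dots> \<le> \<rho> ^ (q - p) * (\<rho> * ip_norm (ip (Suc q)) x)"
    using rho norm_le[OF step.prems] by (intro mult_left_mono) auto
  finally show ?case using step by (simp add: Suc_diff_le algebra_simps)
qed simp

lemma ip_norm_mono':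
  assumes "p \<le> q" "x \<in> H q"
  shows "ip_norm (ip p) x \<le> ip_norm (ip q) x"
proof -
  have "\<rho> ^ (q - p) * ip_norm (ip q) x \<le> 1 * ip_norm (ip q) x"
    using rho ip_space.norm_nonneg[OF ips assms(2)] by (intro mult_right_mono power_le_one) auto
  then show ?thesis using ip_norm_mono[OF assms] by linarith
qed

lemma ip_norm_0: "ip_norm (ip 0) x = norm x"
  by (simp add: ip_norm_def ambient norm_eq_sqrt_inner)

lemma norm_le_ip_norm: "x \<in> H p \<Longrightarrow> norm x \<le> ip_norm (ip p) x"
  using ip_norm_mono'[of 0 p x] by (simp add: ip_norm_0)

text \<open>The basis in the definition of a Hilbert--Schmidt map may be indexed by an arbitrary set, but
  since the inclusion is injective all terms of the convergent sum are positive. So the basis is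
  countable, and all spaces of the chain are separable.\<close>

lemma hilbert_schmidt_sequence:
  obtains p e S where "q \<le> p" "ip_space.orthoseq (H p) (ip p) e" "ip_space.total (H p) (ip p) e"
    "\<And>m. (\<Sum>i<m. (ip_norm (ip q) (e i))\<^sup>2) \<le> S"
proof -
  obtain p where p: "q \<le> p" "hilbert_schmidt (H p) (ip p) (ip q) (\<lambda>x. x)" using nuclear by blast
  interpret ip_space "H p" "ip p" by (rule ips)
  obtain B where B: "orthonormal_basis_of (H p) (ip p) B"
    "(\<lambda>x. (ip_norm (ip q) x)\<^sup>2) summable_on B" using p(2) unfolding hilbert_schmidt_def by blast
  have BH: "B \<subseteq> H p" and on: "\<And>e e'. e \<in> B \<Longrightarrow> e' \<in> B \<Longrightarrow> ip p e e' = (if e = e' then 1 else 0)"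
    and dn: "ip_dense (ip p) (span B) (H p)" using B(1) unfolding orthonormal_basis_of_def by auto
  have "{x \<in> B. (ip_norm (ip q) x)\<^sup>2 \<noteq> 0} = B"
  proof -
    have "(ip_norm (ip q) x)\<^sup>2 \<noteq> 0" if "x \<in> B" for x
    proof -
      have "x \<in> H q" "x \<noteq> 0" using BH H_mono[OF p(1)] on[OF that that] that by auto
      then show ?thesis using ip_space.norm_eq_0[OF ips] by simp
    qed
    then show ?thesis by blast
  qed
  then have cB: "countable B" using summable_countable_real[OF B(2)] by simp
  define e where "e i = (if i \<in> to_nat_on B ` B then from_nat_into B i else 0)" for i
  have e: "e i \<in> B \<and> to_nat_on B (e i) = i \<or> e i = 0" for i
    using cB unfolding e_def by (auto simp: from_nat_into_to_nat_on)
  have eH: "e i \<in> H p" for i using e[of i] BH by auto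
  have "orthoseq e"
    unfolding orthoseq_def
  proof (intro conjI allI impI eH)
    fix j k :: nat
    show "ip p (e k) (e k) = 1 \<or> e k = 0" using e[of k] on by auto
    assume jk: "j \<noteq> k"
    show "ip p (e j) (e k) = 0"
    proof (cases "e j = 0 \<or> e k = 0")
      case True
      then show ?thesis using eH by auto
    next
      case False
      then have "e j \<in> B" "e k \<in> B" "e j \<noteq> e k" using e[of j] e[of k] jk by auto
      then show ?thesis using on by simp
    qed
  qed
  moreover have "total e"
    unfolding total_def
  proof (intro ballI impI)
    fix a assume a: "a \<in> H p" "\<forall>k. ip p a (e k) = 0"
    have "ip p a b = 0" if "b \<in> B" for b
    proof -
      have "e (to_nat_on B b) = b" using that cB unfolding e_def by (simp add: from_nat_into_to_nat_on)
      then show ?thesis using a(2) by metis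
    qed
    then have "ip p a y = 0" if "y \<in> span B" for y
      using ip_zero_on_span[OF a(1) BH _ that] by simp
    then show "a = 0" using orthogonal_to_dense[OF dn a(1)] by simp
  qed
  moreover have "(\<Sum>i<m. (ip_norm (ip q) (e i))\<^sup>2) \<le> infsum (\<lambda>x. (ip_norm (ip q) x)\<^sup>2) B" for m
  proof -
    let ?I = "{i \<in> {..<m}. e i \<noteq> 0}"
    have q0: "ip_norm (ip q) 0 = 0" using ip_space.norm_eq_0[OF ips, of 0 q] ip_space.mem(1)[OF ips] by simp
    have inj: "inj_on e ?I" using e by (intro inj_onI) (auto, metis)
    have "(\<Sum>i<m. (ip_norm (ip q) (e i))\<^sup>2) = (\<Sum>i\<in>?I. (ip_norm (ip q) (e i))\<^sup>2)"
      by (rule sum.mono_neutral_right) (auto simp: q0)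
    also have "\<dots> = (\<Sum>x\<in>e ` ?I. (ip_norm (ip q) x)\<^sup>2)" by (simp only: sum.reindex[OF inj] o_def)
    also have "\<dots> \<le> infsum (\<lambda>x. (ip_norm (ip q) x)\<^sup>2) B"
      using e by (intro finite_sum_le_infsum[OF B(2)]) auto
    finally show ?thesis .
  qed
  ultimately show ?thesis using that p(1) by blast
qed

lemma ex_basis:
  obtains b where "ip_space.orthoseq (H q) (ip q) b" "ip_space.total (H q) (ip q) b"
proof -
  obtain p e S where p: "q \<le> p" and e: "ip_space.orthoseq (H p) (ip p) e" "ip_space.total (H p) (ip p) e"
    by (rule hilbert_schmidt_sequence)
  interpret p: ip_space "H p" "ip p" by (rule ips)
  interpret q: ip_space "H q" "ip q" by (rule ips)
  have eq: "e k \<in> H q" for k using p.orthoseqD(1)[OF e(1)] H_mono[OF p] by blast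
  \<comment> \<open>An orthonormal basis of the smaller space is total in the larger one, because its span is
    dense in the smaller space, which contains the dense subspace \<open>E\<close> of the larger one.\<close>
  have "q.total e"
    unfolding q.total_def
  proof (intro ballI impI)
    fix a assume a: "a \<in> H q" "\<forall>k. ip q a (e k) = 0"
    have "ip q a y = 0" if y: "y \<in> E" for y
    proof -
      let ?s = "\<lambda>m. \<Sum>k<m. ip p (e k) y *\<^sub>R e k"
      have yp: "y \<in> H p" and yq: "y \<in> H q" using y E_sub by auto
      have sp: "?s m \<in> H p" and sq: "?s m \<in> H q" for m using p.orthoseqD(1)[OF e(1)] eq by auto
      have "(\<lambda>m. ip_norm (ip q) (?s m - y)) \<longlonglongrightarrow> 0"
      proof (rule Lim_null_comparison[OF always_eventually p.basis_expansion[OF complete e yp]], rule allI)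
        fix m
        have "?s m - y \<in> H p" "?s m - y \<in> H q" using sp sq yp yq by simp_all
        then show "norm (ip_norm (ip q) (?s m - y)) \<le> ip_norm (ip p) (?s m - y)"
          using ip_norm_mono'[OF p] by simp
      qed
      then have "(\<lambda>m. ip q (?s m) a) \<longlonglongrightarrow> ip q y a"
        by (intro q.tendsto_ip_left sq yq a(1))
      moreover have "ip q (?s m) a = 0" for m
        using eq a q.sym[OF a(1) eq] by (subst q.sum_left) (auto simp: q.scale_left)
      ultimately have "ip q y a = 0" by (simp add: LIMSEQ_const_iff)
      then show ?thesis using q.sym[OF a(1) yq] by simp
    qed
    then show "a = 0" using q.orthogonal_to_dense[OF dense a(1)] by simp
  qed
  then obtain b where "q.orthoseq b \<and> q.total b \<and> (\<forall>n. b n \<in> span (range e))"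
    using q.countable_total_orthoseq[of e, OF eq] by metis
  then show ?thesis using that[of b] by simp
qed

text \<open>\<open>J p \<xi>\<close> represents the functional of \<open>\<xi>\<close>, given by the pairing of the ambient space, as an
  element of \<open>H p\<close>. It is the isometry of the dual norm onto the norm of \<open>H p\<close>, and turns dual
  norms into values of a Hermitian form.\<close>

definition J :: "nat \<Rightarrow> 'a \<Rightarrow> 'a" where
  "J p x = (SOME r. r \<in> H p \<and> (\<forall>a\<in>H p. ip p r a = inner x a))"

lemma J: "J p x \<in> H p" "a \<in> H p \<Longrightarrow> ip p (J p x) a = inner x a"
proof -
  interpret ip_space "H p" "ip p" by (rule ips)
  obtain b where b: "orthoseq b" "total b" by (rule ex_basis)
  have "\<exists>r\<in>H p. \<forall>a\<in>H p. ip p r a = inner x a"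
  proof (rule riesz[OF complete b, where C = "norm x"])
    fix a assume a: "a \<in> H p"
    have "\<bar>inner x a\<bar> \<le> norm x * norm a" by (rule Cauchy_Schwarz_ineq2)
    also have "\<dots> \<le> norm x * ip_norm (ip p) a" using norm_le_ip_norm[OF a] by (simp add: mult_left_mono)
    finally show "\<bar>inner x a\<bar> \<le> norm x * ip_norm (ip p) a" .
  qed (simp_all add: inner_add_right)
  then have "\<exists>r. r \<in> H p \<and> (\<forall>a\<in>H p. ip p r a = inner x a)" by blast
  from someI_ex[OF this] show "J p x \<in> H p" "a \<in> H p \<Longrightarrow> ip p (J p x) a = inner x a"
    unfolding J_def by blast+
qed

lemma J_unique:
  assumes "r \<in> H p" "\<And>a. a \<in> H p \<Longrightarrow> ip p r a = inner x a"
  shows "J p x = r"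
proof -
  interpret ip_space "H p" "ip p" by (rule ips)
  have "ip p (J p x - r) (J p x - r) = 0" using assms J(1)[of p x] J(2)[of _ p x] by (simp add: diff_left)
  then have "J p x - r = 0" using pos[of "J p x - r"] assms(1) J(1) by fastforce
  then show ?thesis by simp
qed

lemma J_add: "J p (x + y) = J p x + J p y"
  using ip_space.add_left[OF ips] ip_space.mem(2)[OF ips] J by (intro J_unique) (simp_all add: inner_add_left)

lemma J_scale: "J p (c *\<^sub>R x) = c *\<^sub>R J p x"
  using ip_space.scale_left[OF ips] ip_space.mem(4)[OF ips] J by (intro J_unique) simp_all

lemma J_diff: "J p (x - y) = J p x - J p y"
  using J_add[of p "x - y" y] by simp

lemma J_0: "J 0 x = x"
  by (rule J_unique) (simp_all add: ambient)

definition cJ :: "nat \<Rightarrow> 'a cplx \<Rightarrow> 'a cplx" where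
  "cJ p \<xi> = (J p (fst \<xi>), J p (snd \<xi>))"

lemma cJ_mem: "cJ p \<xi> \<in> H p \<times> H p" "(fst (cJ p \<xi>), - snd (cJ p \<xi>)) \<in> H p \<times> H p"
  using J(1) ip_space.mem(5)[OF ips] by (simp_all add: cJ_def)

lemma bilin_eq_herm:
  assumes "\<eta> \<in> H p \<times> H p"
  shows "bilin inner \<eta> \<xi> = herm (ip p) \<eta> (fst (cJ p \<xi>), - snd (cJ p \<xi>))"
proof -
  interpret ip_space "H p" "ip p" by (rule ips)
  have \<eta>: "fst \<eta> \<in> H p" "snd \<eta> \<in> H p" using assms by (auto simp: mem_Times_iff)
  have "ip p a (J p x) = inner a x" "ip p a (- J p x) = - inner a x" if "a \<in> H p" for a x
    using that J(1)[of p x] J(2)[of _ p x] sym[of a "J p x"] scale_right[of "J p x" a "-1"] inner_commute[of a x]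
    by auto
  then show ?thesis using \<eta> by (simp add: bilin_def herm_def cJ_def)
qed

lemma bilin_commute: "bilin inner \<xi> \<eta> = bilin inner \<eta> \<xi>"
  by (simp add: bilin_def inner_commute)

lemma dual_norm_eq: "N p \<xi> = cnorm (ip p) (cJ p \<xi>)"
  unfolding dual_norm_def
proof (rule cSup_eq_maximum)
  interpret ip_space "H p" "ip p" by (rule ips)
  define c where "c = cnorm (ip p) (cJ p \<xi>)"
  have c0: "c \<ge> 0" unfolding c_def by (rule cnorm_nonneg[OF ips cJ_mem(1)])
  define z where "z = (fst (cJ p \<xi>), - snd (cJ p \<xi>))"
  define \<eta> where "\<eta> = (1 / c) *\<^sub>R z"
  have zH: "fst z \<in> H p" "snd z \<in> H p" using cJ_mem(2)[of p \<xi>] by (auto simp: z_def mem_Times_iff)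
  have zz: "herm (ip p) z z = of_real (c\<^sup>2)"
    unfolding c_def z_def cnorm_conj[OF ips cJ_mem(1), symmetric]
    by (rule herm_self[OF ips cJ_mem(2)])
  have \<eta>H: "\<eta> \<in> H p \<times> H p" using zH by (simp add: \<eta>_def mem_Times_iff)
  have sc: "herm (ip p) (t *\<^sub>R z) w = t *\<^sub>R herm (ip p) z w" if "w \<in> H p \<times> H p" for t w
    using zH that by (auto simp: herm_def complex_eq_iff scale_left mem_Times_iff algebra_simps)
  have sc2: "herm (ip p) w (t *\<^sub>R z) = t *\<^sub>R herm (ip p) w z" if "w \<in> H p \<times> H p" for t w
    using zH that by (auto simp: herm_def complex_eq_iff scale_right mem_Times_iff algebra_simps)
  have zT: "z \<in> H p \<times> H p" using zH by (simp add: mem_Times_iff)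
  have "herm (ip p) \<eta> \<eta> = (1 / c) *\<^sub>R (1 / c) *\<^sub>R herm (ip p) z z"
    using sc[OF \<eta>H, of "1 / c"] sc2[OF zT, of "1 / c"] unfolding \<eta>_def by simp
  then have "cnorm (ip p) \<eta> = sqrt ((1 / c) * ((1 / c) * c\<^sup>2))"
    unfolding cnorm_def zz by (simp del: of_real_power)
  then have "cnorm (ip p) \<eta> \<le> 1"
    by (cases "c = 0") (simp_all add: power2_eq_square)
  moreover have "bilin inner \<xi> \<eta> = of_real c"
    unfolding bilin_commute[of \<xi>] bilin_eq_herm[OF \<eta>H] z_def[symmetric] unfolding \<eta>_def sc[OF zT] zz
    using c0 by (cases "c = 0") (auto simp: power2_eq_square scaleR_conv_of_real)
  then have "c = cmod (bilin inner \<xi> \<eta>)" using c0 by simp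
  ultimately show "cnorm (ip p) (cJ p \<xi>) \<in> {cmod (bilin inner \<xi> \<eta>) |\<eta>. \<eta> \<in> H p \<times> H p \<and> cnorm (ip p) \<eta> \<le> 1}"
    unfolding c_def[symmetric] using \<eta>H by blast
next
  fix x assume "x \<in> {cmod (bilin inner \<xi> \<eta>) |\<eta>. \<eta> \<in> H p \<times> H p \<and> cnorm (ip p) \<eta> \<le> 1}"
  then obtain \<eta> where \<eta>: "x = cmod (bilin inner \<xi> \<eta>)" "\<eta> \<in> H p \<times> H p" "cnorm (ip p) \<eta> \<le> 1" by blast
  have "x \<le> cnorm (ip p) \<eta> * cnorm (ip p) (cJ p \<xi>)"
    unfolding \<eta>(1) bilin_commute[of \<xi>] bilin_eq_herm[OF \<eta>(2)] cnorm_conj[OF ips cJ_mem(1), symmetric]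
    by (rule herm_cauchy_schwarz[OF ips \<eta>(2) cJ_mem(2)])
  also have "\<dots> \<le> 1 * cnorm (ip p) (cJ p \<xi>)"
    using \<eta>(3) cnorm_nonneg[OF ips cJ_mem(1)] by (intro mult_right_mono) auto
  finally show "x \<le> cnorm (ip p) (cJ p \<xi>)" by simp
qed

lemma dual_norm_sq: "N p \<xi> = sqrt ((ip_norm (ip p) (J p (fst \<xi>)))\<^sup>2 + (ip_norm (ip p) (J p (snd \<xi>)))\<^sup>2)"
  using ip_space.norm_sq[OF ips] J(1) by (simp add: dual_norm_eq cnorm_eq cJ_def)

lemma dual_norm_nonneg [simp]: "N p \<xi> \<ge> 0"
  by (simp add: dual_norm_sq)

lemma dual_norm_triangle: "N p (\<xi> + \<eta>) \<le> N p \<xi> + N p \<eta>"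
proof -
  interpret ip_space "H p" "ip p" by (rule ips)
  have "N p (\<xi> + \<eta>) \<le> sqrt ((ip_norm (ip p) (J p (fst \<xi>)) + ip_norm (ip p) (J p (fst \<eta>)))\<^sup>2 +
      (ip_norm (ip p) (J p (snd \<xi>)) + ip_norm (ip p) (J p (snd \<eta>)))\<^sup>2)"
    unfolding dual_norm_sq using J(1)
    by (intro real_sqrt_le_mono add_mono power_mono) (simp_all add: J_add norm_triangle)
  also have "\<dots> \<le> N p \<xi> + N p \<eta>" unfolding dual_norm_sq by (rule real_sqrt_sum_squares_triangle_ineq)
  finally show ?thesis .
qed

lemma dual_norm_cscale: "N p (cscale z \<xi>) = cmod z * N p \<xi>"
proof -
  interpret ip_space "H p" "ip p" by (rule ips)
  let ?a = "J p (fst \<xi>)" and ?b = "J p (snd \<xi>)"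
  have ab: "?a \<in> H p" "?b \<in> H p" using J(1) by auto
  have e: "J p (fst (cscale z \<xi>)) = Re z *\<^sub>R ?a - Im z *\<^sub>R ?b" "J p (snd (cscale z \<xi>)) = Re z *\<^sub>R ?b + Im z *\<^sub>R ?a"
    by (simp_all add: cscale_def J_add J_diff J_scale)
  have m: "Re z *\<^sub>R ?a - Im z *\<^sub>R ?b \<in> H p" "Re z *\<^sub>R ?b + Im z *\<^sub>R ?a \<in> H p" using ab by simp_all
  have "(ip_norm (ip p) (Re z *\<^sub>R ?a - Im z *\<^sub>R ?b))\<^sup>2 + (ip_norm (ip p) (Re z *\<^sub>R ?b + Im z *\<^sub>R ?a))\<^sup>2
      = (cmod z)\<^sup>2 * ((ip_norm (ip p) ?a)\<^sup>2 + (ip_norm (ip p) ?b)\<^sup>2)"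
    unfolding norm_sq[OF m(1)] norm_sq[OF m(2)] norm_sq[OF ab(1)] norm_sq[OF ab(2)] cmod_power2
    using ab sym[OF ab]
    by (simp add: add_left add_right diff_left diff_right scale_left scale_right
        power2_eq_square algebra_simps)
  then show ?thesis unfolding dual_norm_sq e by (simp add: real_sqrt_mult)
qed

lemma dual_norm_minus: "N p (- \<xi>) = N p \<xi>"
proof -
  have "cscale (-1) \<xi> = - \<xi>" by (simp add: cscale_def prod_eq_iff)
  then show ?thesis using dual_norm_cscale[of p "-1" \<xi>] by simp
qed

lemma dual_norm_0: "N 0 \<xi> = norm \<xi>"
  by (simp add: dual_norm_sq J_0 ip_norm_0 norm_prod_def)

text \<open>\<open>J q x\<close> and \<open>J p x\<close> represent the same functional on \<open>H q\<close>, so the square of the norm of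
  \<open>J q x\<close> is the product \<open>ip p (J p x) (J q x)\<close> of level \<open>p\<close>.\<close>

lemma J_norm_mono:
  assumes "p \<le> q"
  shows "ip_norm (ip q) (J q x) \<le> \<rho> ^ (q - p) * ip_norm (ip p) (J p x)"
proof -
  interpret p: ip_space "H p" "ip p" by (rule ips)
  interpret q: ip_space "H q" "ip q" by (rule ips)
  let ?n = "ip_norm (ip q) (J q x)"
  have Jp: "J q x \<in> H p" using J(1) H_mono[OF assms] by blast
  have "?n * ?n = ip q (J q x) (J q x)" using q.norm_sq[OF J(1)] by (simp add: power2_eq_square)
  also have "\<dots> = ip p (J p x) (J q x)" using J Jp by simp
  also have "\<dots> \<le> ip_norm (ip p) (J p x) * ip_norm (ip p) (J q x)"
    using p.cauchy_schwarz[OF J(1) Jp] by (simp add: abs_le_iff)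
  also have "\<dots> \<le> ip_norm (ip p) (J p x) * (\<rho> ^ (q - p) * ?n)"
    using ip_norm_mono[OF assms J(1)] p.norm_nonneg[OF J(1)] by (intro mult_left_mono)
  finally have "?n * ?n \<le> (\<rho> ^ (q - p) * ip_norm (ip p) (J p x)) * ?n" by (simp add: algebra_simps)
  moreover have "?n \<ge> 0" using q.norm_nonneg[OF J(1)] .
  moreover have "\<rho> ^ (q - p) * ip_norm (ip p) (J p x) \<ge> 0" using rho p.norm_nonneg[OF J(1)] by simp
  ultimately show ?thesis by (metis mult_right_le_imp_le order_le_less)
qed

lemma dual_norm_mono:
  assumes "p \<le> q"
  shows "N q \<xi> \<le> \<rho> ^ (q - p) * N p \<xi>"
proof -
  have "N q \<xi> \<le> sqrt ((\<rho> ^ (q - p) * ip_norm (ip p) (J p (fst \<xi>)))\<^sup>2 + (\<rho> ^ (q - p) * ip_norm (ip p) (J p (snd \<xi>)))\<^sup>2)"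
    unfolding dual_norm_sq using ip_space.norm_nonneg[OF ips J(1)] J_norm_mono[OF assms]
    by (intro real_sqrt_le_mono add_mono power_mono)
  also have "\<dots> = sqrt ((\<rho> ^ (q - p))\<^sup>2 * ((ip_norm (ip p) (J p (fst \<xi>)))\<^sup>2 + (ip_norm (ip p) (J p (snd \<xi>)))\<^sup>2))"
    by (simp add: power_mult_distrib distrib_left)
  also have "\<dots> = \<rho> ^ (q - p) * N p \<xi>"
    unfolding dual_norm_sq real_sqrt_mult using rho by (simp add: power_le_one)
  finally show ?thesis .
qed

lemma dual_norm_mono':
  assumes "p \<le> q"
  shows "N q \<xi> \<le> N p \<xi>"
proof -
  have "\<rho> ^ (q - p) * N p \<xi> \<le> 1 * N p \<xi>" using rho by (intro mult_right_mono power_le_one) auto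
  then show ?thesis using dual_norm_mono[OF assms, of \<xi>] by simp
qed

lemma dual_norm_le_norm: "N p \<xi> \<le> norm \<xi>"
  using dual_norm_mono'[of 0 p \<xi>] by (simp add: dual_norm_0)

lemma tensor_pair_bound:
  assumes "t \<in> formal_tensors (H p) n"
  shows "cmod (tensor_pair n t y) \<le> formal_norm (ip p) n t * (\<Prod>i<n. N p (y i))"
proof -
  define z where "z i = (fst (cJ p (y i)), - snd (cJ p (y i)))" for i
  have z: "z i \<in> H p \<times> H p" for i unfolding z_def by (rule cJ_mem)
  have *: "(\<Prod>i<n. bilin inner (x i) (y i)) = (\<Prod>i<n. herm (ip p) (x i) (z i))"
    if "(c, x) \<in> set t" for c x
  proof -
    have "\<forall>i<n. x i \<in> H p \<times> H p" using assms that by (fastforce simp: formal_tensors_def)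
    then show ?thesis unfolding z_def by (intro prod.cong refl bilin_eq_herm) simp
  qed
  have "tensor_pair n t y = tensor_herm (ip p) n t [(1, z)]"
    unfolding tensor_pair_def tensor_herm_def
    by (intro arg_cong[where f = sum_list] map_cong refl) (auto simp: *)
  moreover have "cmod (tensor_herm (ip p) n t [(1, z)]) \<le> formal_norm (ip p) n t * formal_norm (ip p) n [(1, z)]"
    by (rule tensor_cauchy_schwarz[OF ips assms]) (use z in \<open>simp add: formal_tensors_def\<close>)
  moreover have "formal_norm (ip p) n [(1, z)] = (\<Prod>i<n. N p (y i))"
    unfolding formal_norm_simple[OF ips z] dual_norm_eq
    unfolding z_def cnorm_conj[OF ips cJ_mem(1)] ..
  ultimately show ?thesis by simp
qed

text \<open>Nuclearity enters the proof only through the following sequence. The \<open>\<xi> k\<close> are orthonormal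
  for the dual norm of level \<open>q\<close>; since the dual of a Hilbert--Schmidt inclusion is again
  Hilbert--Schmidt, their dual norms of a higher level are square summable, and going up
  further multiplies the sum by powers of \<open>\<rho>\<^sup>2\<close>.\<close>

lemma dual_basis:
  assumes "\<epsilon> > 0"
  obtains p \<xi> where "q \<le> p" "\<And>k. \<xi> k \<in> E" "ip_space.orthoseq (H q) (ip q) (\<lambda>k. J q (\<xi> k))"
    "ip_space.total (H q) (ip q) (\<lambda>k. J q (\<xi> k))" "\<And>m. (\<Sum>k<m. (N p (\<xi> k, 0))\<^sup>2) \<le> \<epsilon>"
proof -
  interpret q: ip_space "H q" "ip q" by (rule ips)
  interpret o: ip_space "H 0" "ip 0" by (rule ips)
  obtain b where b: "o.orthoseq b" "o.total b" by (rule ex_basis)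
  have ap: "\<exists>y\<in>E. norm (b k - y) < inverse (real (Suc m))" for k m
    using dense[of 0] unfolding ip_dense_def ip_norm_0 by (simp add: ambient)
  define x where "x i = (SOME y. y \<in> E \<and> norm (b (fst (prod_decode i)) - y) <
      inverse (real (Suc (snd (prod_decode i)))))" for i
  have x: "x i \<in> E \<and> norm (b (fst (prod_decode i)) - x i) < inverse (real (Suc (snd (prod_decode i))))" for i
    unfolding x_def by (rule someI_ex) (use ap in blast)
  \<comment> \<open>The sequence \<open>x\<close> in \<open>E\<close> approximates a basis of the ambient space, so it separates points, and
    its images under \<open>J q\<close> can be orthonormalized without leaving the image of \<open>E\<close>.\<close>
  have sep: "a = 0" if a: "\<And>i. inner a (x i) = 0" for a
  proof -
    have "inner a (b k) = 0" for k
    proof -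
      let ?y = "\<lambda>m. x (prod_encode (k, m))"
      have "(\<lambda>m. b k - ?y m) \<longlonglongrightarrow> 0"
      proof (rule Lim_null_comparison[OF always_eventually LIMSEQ_inverse_real_of_nat], rule allI)
        fix m
        show "norm (b k - ?y m) \<le> inverse (real (Suc m))" using x[of "prod_encode (k, m)"] by simp
      qed
      then have "(\<lambda>m. inner a (b k - ?y m)) \<longlonglongrightarrow> inner a 0" by (intro tendsto_intros)
      then show ?thesis using a by (simp add: inner_diff_right LIMSEQ_const_iff)
    qed
    then show "a = 0" using b(2) unfolding o.total_def by (simp add: ambient)
  qed
  have "q.total (\<lambda>i. J q (x i))"
    unfolding q.total_def
  proof (intro ballI impI)
    fix a assume a: "a \<in> H q" "\<forall>k. ip q a (J q (x k)) = 0"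
    have "inner a (x i) = 0" for i
      using J(2)[OF a(1), of "x i"] a(2) q.sym[OF a(1) J(1), of "x i"] inner_commute[of a "x i"]
      by simp
    then show "a = 0" by (rule sep)
  qed
  then obtain d where d: "q.orthoseq d \<and> q.total d \<and> (\<forall>n. d n \<in> span (range (\<lambda>i. J q (x i))))"
    using q.countable_total_orthoseq[of "\<lambda>i. J q (x i)", OF J(1)] by metis
  have "\<exists>w\<in>E. d k = J q w" for k
  proof -
    have "d k \<in> span (range (\<lambda>i. J q (x i)))" using d by blast
    then show ?thesis
    proof (induction rule: span_induct_alt)
      case base
      show ?case using J_scale[of q 0 0] by (intro bexI[of _ 0]) simp_all
    next
      case (step c v w)
      then obtain i w' where "v = J q (x i)" "w' \<in> E" "w = J q w'" by blast
      then show ?case using x[of i] by (intro bexI[of _ "c *\<^sub>R x i + w'"]) (simp_all add: J_add J_scale)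
    qed
  qed
  then obtain \<xi> where \<xi>: "\<And>k. \<xi> k \<in> E" "\<And>k. d k = J q (\<xi> k)" by metis
  have dJ: "d = (\<lambda>k. J q (\<xi> k))" using \<xi>(2) by blast
  obtain r e S where r: "q \<le> r" and e: "ip_space.orthoseq (H r) (ip r) e" "ip_space.total (H r) (ip r) e"
    and S: "\<And>m. (\<Sum>i<m. (ip_norm (ip q) (e i))\<^sup>2) \<le> S"
    by (rule hilbert_schmidt_sequence[of q]) (rule that, assumption+)
  interpret r: ip_space "H r" "ip r" by (rule ips)
  have eq: "e i \<in> H q" for i using r.orthoseqD(1)[OF e(1)] H_mono[OF r] by blast
  have NS: "(\<Sum>k<m. (N r (\<xi> k, 0))\<^sup>2) \<le> S" for m
  proof -
    have J0: "J r 0 = 0" using J_scale[of r 0 0] by simp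
    have "(\<lambda>i. (ip q (d k) (e i))\<^sup>2) sums ((N r (\<xi> k, 0))\<^sup>2)" for k
    proof -
      have "ip r (e i) (J r (\<xi> k)) = ip q (d k) (e i)" for i
        using J r.orthoseqD(1)[OF e(1), of i] eq[of i] r.sym[OF r.orthoseqD(1)[OF e(1)] J(1)]
        by (simp add: \<xi>(2))
      moreover have "(N r (\<xi> k, 0))\<^sup>2 = ip r (J r (\<xi> k)) (J r (\<xi> k))"
        using r.norm_sq[OF J(1)] r.norm_sq[of 0] r.nonneg[OF J(1)] by (simp add: dual_norm_sq J0)
      ultimately show ?thesis using r.parseval[OF complete e J(1), of "\<xi> k"] by simp
    qed
    then have s: "(\<lambda>i. \<Sum>k<m. (ip q (d k) (e i))\<^sup>2) sums (\<Sum>k<m. (N r (\<xi> k, 0))\<^sup>2)"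
      by (intro sums_sum)
    have "(\<Sum>i<j. \<Sum>k<m. (ip q (d k) (e i))\<^sup>2) \<le> S" for j
    proof -
      have "(\<Sum>i<j. \<Sum>k<m. (ip q (d k) (e i))\<^sup>2) \<le> (\<Sum>i<j. (ip_norm (ip q) (e i))\<^sup>2)"
        using d eq by (intro sum_mono) (simp add: q.bessel q.norm_sq)
      then show ?thesis using S[of j] by linarith
    qed
    then show ?thesis using s unfolding sums_def by (intro LIMSEQ_le_const2) auto
  qed
  have "(\<lambda>j. (\<rho> ^ j)\<^sup>2 * S) \<longlonglongrightarrow> 0\<^sup>2 * S"
    using rho by (intro tendsto_mult tendsto_power LIMSEQ_realpow_zero tendsto_const) auto
  then have "\<forall>\<^sub>F j in sequentially. (\<rho> ^ j)\<^sup>2 * S < \<epsilon>"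
    by (rule order_tendstoD(2)) (use assms in simp)
  then obtain j where j: "(\<rho> ^ j)\<^sup>2 * S < \<epsilon>" unfolding eventually_sequentially by blast
  have "(\<Sum>k<m. (N (r + j) (\<xi> k, 0))\<^sup>2) \<le> \<epsilon>" for m
  proof -
    have "(\<Sum>k<m. (N (r + j) (\<xi> k, 0))\<^sup>2) \<le> (\<Sum>k<m. (\<rho> ^ j * N r (\<xi> k, 0))\<^sup>2)"
      using dual_norm_mono[of r "r + j"] by (intro sum_mono power_mono) auto
    also have "\<dots> = (\<rho> ^ j)\<^sup>2 * (\<Sum>k<m. (N r (\<xi> k, 0))\<^sup>2)"
      by (simp add: power_mult_distrib sum_distrib_left)
    also have "\<dots> \<le> (\<rho> ^ j)\<^sup>2 * S" using NS by (intro mult_left_mono) auto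
    finally show ?thesis using j by linarith
  qed
  moreover have "q \<le> r + j" using r by simp
  ultimately show ?thesis using that[of "r + j" \<xi>] d \<xi>(1) unfolding dJ by blast
qed

end

section \<open>Multilinear forms\<close>

definition csubspace :: "'a::real_vector cplx set \<Rightarrow> bool" where
  "csubspace W \<longleftrightarrow> 0 \<in> W \<and> (\<forall>a\<in>W. \<forall>b\<in>W. a + b \<in> W) \<and> (\<forall>z. \<forall>a\<in>W. cscale z a \<in> W)"

lemma csubspaceD:
  assumes "csubspace W"
  shows "0 \<in> W" "a \<in> W \<Longrightarrow> b \<in> W \<Longrightarrow> a + b \<in> W" "a \<in> W \<Longrightarrow> cscale z a \<in> W"
  using assms by (auto simp: csubspace_def)

lemma cscale_simps [simp]:
  "cscale 0 a = 0" "cscale 1 a = a" "cscale z 0 = 0" "cscale (-1) a = - a"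
  "cscale z (cscale w a) = cscale (z * w) a"
  by (simp_all add: cscale_def prod_eq_iff algebra_simps)

lemma cscale_add: "cscale (z + w) a = cscale z a + cscale w a" "cscale z (a + b) = cscale z a + cscale z b"
  by (simp_all add: cscale_def prod_eq_iff algebra_simps)

lemma csubspace_diff:
  assumes "csubspace W" "a \<in> W" "b \<in> W"
  shows "a - b \<in> W"
  using csubspaceD(2)[OF assms(1,2), of "cscale (-1) b"] csubspaceD(3)[OF assms(1,3), of "-1"] by simp

lemma csubspace_sum:
  assumes "csubspace W" "\<And>j. j \<in> I \<Longrightarrow> x j \<in> W"
  shows "sum x I \<in> W"
  using assms(2) by (induction I rule: infinite_finite_induct) (auto simp: csubspaceD[OF assms(1)])

lemma csubspace_UNIV [simp]: "csubspace UNIV"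
  by (simp add: csubspace_def)

definition mlin ::
    "nat \<Rightarrow> 'a::real_vector cplx set \<Rightarrow> ((nat \<Rightarrow> 'a cplx) \<Rightarrow> complex) \<Rightarrow> bool" where
  "mlin n W f \<longleftrightarrow>
     (\<forall>y y'. (\<forall>i<n. y i = y' i) \<longrightarrow> f y = f y') \<and>
     (\<forall>y i a b. (\<forall>j<n. y j \<in> W) \<longrightarrow> i < n \<longrightarrow> a \<in> W \<longrightarrow> b \<in> W \<longrightarrow>
        f (y(i := a + b)) = f (y(i := a)) + f (y(i := b))) \<and>
     (\<forall>y i a z. (\<forall>j<n. y j \<in> W) \<longrightarrow> i < n \<longrightarrow> a \<in> W \<longrightarrow>
        f (y(i := cscale z a)) = z * f (y(i := a)))"

lemma mlinD:
  assumes "mlin n W f"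
  shows "(\<And>i. i < n \<Longrightarrow> y i = y' i) \<Longrightarrow> f y = f y'"
    "(\<And>j. j < n \<Longrightarrow> y j \<in> W) \<Longrightarrow> i < n \<Longrightarrow> a \<in> W \<Longrightarrow> b \<in> W \<Longrightarrow>
       f (y(i := a + b)) = f (y(i := a)) + f (y(i := b))"
    "(\<And>j. j < n \<Longrightarrow> y j \<in> W) \<Longrightarrow> i < n \<Longrightarrow> a \<in> W \<Longrightarrow>
       f (y(i := cscale z a)) = z * f (y(i := a))"
  using assms unfolding mlin_def by blast+

lemma mlin_subset: "mlin n W f \<Longrightarrow> U \<subseteq> W \<Longrightarrow> mlin n U f"
  unfolding mlin_def by (meson subsetD)

lemma mlin_sum:
  assumes "mlin n W f" "csubspace W" "\<And>j. j < n \<Longrightarrow> y j \<in> W" "i < n" "finite J" "\<And>j. j \<in> J \<Longrightarrow> x j \<in> W"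
  shows "f (y(i := \<Sum>j\<in>J. cscale (a j) (x j))) = (\<Sum>j\<in>J. a j * f (y(i := x j)))"
proof -
  define g where "g v = f (y(i := v))" for v
  have add: "g (v + w) = g v + g w" if "v \<in> W" "w \<in> W" for v w
    unfolding g_def by (rule mlinD(2)[OF assms(1,3,4) that])
  have scale: "g (cscale z v) = z * g v" if "v \<in> W" for v z
    unfolding g_def by (rule mlinD(3)[OF assms(1,3,4) that])
  have "g 0 = 0" using scale[of 0 0] csubspaceD(1)[OF assms(2)] by simp
  with assms(5,6) have "g (\<Sum>j\<in>J. cscale (a j) (x j)) = (\<Sum>j\<in>J. a j * g (x j))"
    by (induction J rule: finite_induct)
      (simp_all add: add scale csubspaceD(3)[OF assms(2)] csubspace_sum[OF assms(2)])
  then show ?thesis unfolding g_def .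
qed

text \<open>The arguments are expanded one after the other; \<open>m\<close> counts those already treated.\<close>

lemma mlin_expand:
  fixes x :: "'j \<Rightarrow> 'a::real_vector cplx"
  assumes f: "mlin n W f" "csubspace W" and J: "finite J" "\<And>j. j \<in> J \<Longrightarrow> x j \<in> W"
  shows "f (\<lambda>i. \<Sum>j\<in>J. cscale (a i j) (x j)) =
    (\<Sum>h\<in>PiE {..<n} (\<lambda>_. J). (\<Prod>i<n. a i (h i)) * f (\<lambda>i. x (h i)))"
proof -
  let ?S = "\<lambda>i. \<Sum>j\<in>J. cscale (a i j) (x j)"
  have S: "?S i \<in> W" for i by (intro csubspace_sum[OF f(2)] csubspaceD(3)[OF f(2)] J)
  have "f (\<lambda>i. if i < m then ?S i else y i) =
      (\<Sum>h\<in>PiE {..<m} (\<lambda>_. J). (\<Prod>i<m. a i (h i)) * f (\<lambda>i. if i < m then x (h i) else y i))"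
    if "m \<le> n" "\<And>i. i < n \<Longrightarrow> y i \<in> W" for m y
    using that
  proof (induction m arbitrary: y)
    case (Suc m)
    let ?y = "\<lambda>i. if i < m then ?S i else y i"
    let ?t = "\<lambda>j h. a m j * ((\<Prod>i<m. a i (h i)) * f (\<lambda>i. if i < m then x (h i) else (y(m := x j)) i))"
    have "(\<lambda>i. if i < Suc m then ?S i else y i) = ?y(m := ?S m)" by (auto simp: less_Suc_eq)
    then have "f (\<lambda>i. if i < Suc m then ?S i else y i) = f (?y(m := ?S m))" by (simp only:)
    also have "\<dots> = (\<Sum>j\<in>J. a m j * f (?y(m := x j)))"
      by (rule mlin_sum[OF f _ _ J]) (use S Suc.prems in auto)
    also have "\<dots> = (\<Sum>j\<in>J. \<Sum>h\<in>PiE {..<m} (\<lambda>_. J). ?t j h)"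
    proof (intro sum.cong refl)
      fix j assume j: "j \<in> J"
      have "?y(m := x j) = (\<lambda>i. if i < m then ?S i else (y(m := x j)) i)" by auto
      then have "f (?y(m := x j)) = f (\<lambda>i. if i < m then ?S i else (y(m := x j)) i)" by (simp only:)
      also have "\<dots> = (\<Sum>h\<in>PiE {..<m} (\<lambda>_. J). (\<Prod>i<m. a i (h i)) *
          f (\<lambda>i. if i < m then x (h i) else (y(m := x j)) i))"
        by (rule Suc.IH) (use Suc.prems J(2)[OF j] in auto)
      finally show "a m j * f (?y(m := x j)) = (\<Sum>h\<in>PiE {..<m} (\<lambda>_. J). ?t j h)"
        by (simp only: sum_distrib_left)
    qed
    also have "\<dots> = (\<Sum>(j, h)\<in>J \<times> PiE {..<m} (\<lambda>_. J). ?t j h)"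
      by (rule sum.cartesian_product)
    also have "\<dots> = (\<Sum>h\<in>(\<lambda>(j, h). h(m := j)) ` (J \<times> PiE {..<m} (\<lambda>_. J)).
        (\<Prod>i<Suc m. a i (h i)) * f (\<lambda>i. if i < Suc m then x (h i) else y i))"
    proof (subst sum.reindex)
      show "inj_on (\<lambda>(j, h). h(m := j)) (J \<times> PiE {..<m} (\<lambda>_. J))"
        using inj_combinator[of m "{..<m}" "\<lambda>_. J"] by simp
      show "(\<Sum>(j, h)\<in>J \<times> PiE {..<m} (\<lambda>_. J). ?t j h) = sum ((\<lambda>h. (\<Prod>i<Suc m. a i (h i)) *
          f (\<lambda>i. if i < Suc m then x (h i) else y i)) \<circ> (\<lambda>(j, h). h(m := j))) (J \<times> PiE {..<m} (\<lambda>_. J))"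
      proof (intro sum.cong refl, clarify)
        fix j h
        have 1: "(\<lambda>i. if i < Suc m then x ((h(m := j)) i) else y i) =
            (\<lambda>i. if i < m then x (h i) else (y(m := x j)) i)" by (auto simp: less_Suc_eq)
        have 2: "(\<Prod>i<Suc m. a i ((h(m := j)) i)) = a m j * (\<Prod>i<m. a i (h i))"
          by (simp add: mult.commute)
        show "?t j h = ((\<lambda>h. (\<Prod>i<Suc m. a i (h i)) *
          f (\<lambda>i. if i < Suc m then x (h i) else y i)) \<circ> (\<lambda>(j, h). h(m := j))) (j, h)"
          unfolding o_apply prod.case 1 2 by (simp only: mult.assoc)
      qed
    qed
    also have "(\<lambda>(j, h). h(m := j)) ` (J \<times> PiE {..<m} (\<lambda>_. J)) = PiE {..<Suc m} (\<lambda>_. J)"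
      unfolding lessThan_Suc PiE_insert_eq ..
    finally show ?case .
  qed simp
  from this[of n "\<lambda>_. 0"] have "f (\<lambda>i. if i < n then ?S i else 0) =
      (\<Sum>h\<in>PiE {..<n} (\<lambda>_. J). (\<Prod>i<n. a i (h i)) * f (\<lambda>i. if i < n then x (h i) else 0))"
    using csubspaceD(1)[OF f(2)] by simp
  moreover have "f (\<lambda>i. if i < n then w i else 0) = f w" for w by (rule mlinD(1)[OF f(1)]) simp
  ultimately show ?thesis by simp
qed

lemma mlin_scale_diagonal:
  assumes "mlin n W f" "csubspace W" "\<xi> \<in> W"
  shows "f (\<lambda>_. cscale z \<xi>) = z ^ n * f (\<lambda>_. \<xi>)"
proof -
  have "PiE {..<n} (\<lambda>_. {()}) = {restrict (\<lambda>_. ()) {..<n}}" by (simp add: PiE_eq_singleton)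
  then show ?thesis
    using mlin_expand[OF assms(1,2), of "{()}" "\<lambda>_. \<xi>" "\<lambda>_ _. z"] assms(3) by simp
qed

section \<open>Polarization\<close>

lemma alternating_sum_supersets:
  assumes "finite T" "A \<subset> T"
  shows "(\<Sum>S\<in>Pow T. (-1) ^ card S * of_bool (A \<subseteq> S)) = (0 :: complex)"
proof -
  obtain a where a: "a \<in> T" "a \<notin> A" using assms(2) by blast
  define R where "R = T - {a}"
  have T: "T = insert a R" "a \<notin> R" "finite R" using a assms(1) by (auto simp: R_def)
  let ?t = "\<lambda>S. (-1) ^ card S * of_bool (A \<subseteq> S) :: complex"
  have "sum ?t (Pow T) = sum ?t (Pow R) + sum ?t (insert a ` Pow R)"
    unfolding T(1) Pow_insert using T by (intro sum.union_disjoint) auto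
  also have "sum ?t (insert a ` Pow R) = (\<Sum>S\<in>Pow R. ?t (insert a S))"
    using T by (subst sum.reindex) (auto simp: inj_on_def)
  also have "\<dots> = (\<Sum>S\<in>Pow R. - ?t S)"
  proof (intro sum.cong refl)
    fix S assume "S \<in> Pow R"
    then have "finite S" "a \<notin> S" using T finite_subset by auto
    moreover have "A \<subseteq> insert a S \<longleftrightarrow> A \<subseteq> S" using a by blast
    ultimately show "?t (insert a S) = - ?t S" by simp
  qed
  finally show ?thesis by (simp add: sum_negf)
qed

text \<open>Inclusion--exclusion over the subsets of the arguments isolates the terms of the expanded
  diagonal values in which every argument occurs, and by symmetry these all agree.\<close>

lemma polarization:
  assumes f: "mlin n W f" "csubspace W" and y: "\<And>i. i < n \<Longrightarrow> y i \<in> W"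
    and sym: "\<And>\<pi> y. \<pi> permutes {..<n} \<Longrightarrow> f (y \<circ> \<pi>) = f y"
  shows "of_nat (card {h \<in> PiE {..<n} (\<lambda>_. {..<n}). h ` {..<n} = {..<n}}) * f y =
    (-1) ^ n * (\<Sum>S\<in>Pow {..<n}. (-1) ^ card S * f (\<lambda>_. \<Sum>j\<in>S. y j))"
proof -
  let ?P = "PiE {..<n} (\<lambda>_. {..<n})"
  have fin: "finite ?P" by (intro finite_PiE) auto
  have diag: "f (\<lambda>_. \<Sum>j\<in>S. y j) = (\<Sum>h\<in>?P. of_bool (h ` {..<n} \<subseteq> S) * f (\<lambda>i. y (h i)))"
    if S: "S \<subseteq> {..<n}" for S
  proof -
    have "f (\<lambda>_. \<Sum>j\<in>S. y j) = (\<Sum>h\<in>PiE {..<n} (\<lambda>_. S). f (\<lambda>i. y (h i)))"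
      using mlin_expand[OF f, of S y "\<lambda>_ _. 1"] S y finite_subset[OF S] by auto
    also have "\<dots> = (\<Sum>h\<in>?P. of_bool (h ` {..<n} \<subseteq> S) * f (\<lambda>i. y (h i)))"
    proof (rule sum.mono_neutral_cong_left)
      show "PiE {..<n} (\<lambda>_. S) \<subseteq> ?P" using S by (intro PiE_mono) auto
      show "\<forall>h\<in>?P - PiE {..<n} (\<lambda>_. S). of_bool (h ` {..<n} \<subseteq> S) * f (\<lambda>i. y (h i)) = 0"
        by (auto simp: PiE_def Pi_def)
    qed (use fin in auto)
    finally show ?thesis .
  qed
  have "(\<Sum>S\<in>Pow {..<n}. (-1) ^ card S * f (\<lambda>_. \<Sum>j\<in>S. y j)) =
      (\<Sum>S\<in>Pow {..<n}. \<Sum>h\<in>?P. ((-1) ^ card S * of_bool (h ` {..<n} \<subseteq> S)) * f (\<lambda>i. y (h i)))"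
    by (intro sum.cong refl) (simp add: diag sum_distrib_left mult.assoc)
  also have "\<dots> = (\<Sum>h\<in>?P. (\<Sum>S\<in>Pow {..<n}. (-1) ^ card S * of_bool (h ` {..<n} \<subseteq> S)) * f (\<lambda>i. y (h i)))"
    by (subst sum.swap) (simp only: sum_distrib_right)
  also have "\<dots> = (\<Sum>h\<in>?P. if h ` {..<n} = {..<n} then (-1) ^ n * f y else 0)"
  proof (intro sum.cong refl)
    fix h assume h: "h \<in> ?P"
    show "(\<Sum>S\<in>Pow {..<n}. (-1) ^ card S * of_bool (h ` {..<n} \<subseteq> S)) * f (\<lambda>i. y (h i)) =
        (if h ` {..<n} = {..<n} then (-1) ^ n * f y else 0)"
    proof (cases "h ` {..<n} = {..<n}")
      case False
      then have "h ` {..<n} \<subset> {..<n}" using h by auto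
      from alternating_sum_supersets[OF _ this] False show ?thesis by simp
    next
      case True
      have "(\<Sum>S\<in>Pow {..<n}. (-1) ^ card S * of_bool ({..<n} \<subseteq> S)) = (\<Sum>S\<in>{{..<n}}. (-1) ^ card S :: complex)"
        by (rule sum.mono_neutral_cong_right) auto
      then have 1: "(\<Sum>S\<in>Pow {..<n}. (-1) ^ card S * of_bool ({..<n} \<subseteq> S)) = ((-1) ^ n :: complex)"
        by simp
      define \<pi> where "\<pi> i = (if i < n then h i else i)" for i
      have "inj_on h {..<n}" using True by (intro eq_card_imp_inj_on) auto
      then have "bij_betw h {..<n} {..<n}" using True by (simp add: bij_betw_def)
      then have "bij_betw \<pi> {..<n} {..<n}" by (rule bij_betw_cong[THEN iffD1, rotated]) (simp add: \<pi>_def)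
      then have "\<pi> permutes {..<n}" by (rule bij_imp_permutes) (simp add: \<pi>_def)
      then have "f (y \<circ> \<pi>) = f y" by (rule sym)
      moreover have "f (\<lambda>i. y (h i)) = f (y \<circ> \<pi>)" by (rule mlinD(1)[OF f(1)]) (simp add: \<pi>_def)
      ultimately show ?thesis using True 1 by simp
    qed
  qed
  also have "\<dots> = (\<Sum>h\<in>{h \<in> ?P. h ` {..<n} = {..<n}}. (-1) ^ n * f y)"
    using fin by (intro sum.mono_neutral_cong_right) auto
  finally show ?thesis by (simp flip: power_add mult.assoc)
qed

lemma mlin_eq_of_diagonal:
  assumes f: "mlin n W f" "\<And>\<pi> y. \<pi> permutes {..<n} \<Longrightarrow> f (y \<circ> \<pi>) = f y"
    and h: "mlin n W h" "\<And>\<pi> y. \<pi> permutes {..<n} \<Longrightarrow> h (y \<circ> \<pi>) = h y"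
    and W: "csubspace W" and diag: "\<And>\<xi>. \<xi> \<in> W \<Longrightarrow> f (\<lambda>_. \<xi>) = h (\<lambda>_. \<xi>)"
    and y: "\<And>i. i < n \<Longrightarrow> y i \<in> W"
  shows "f y = h y"
proof -
  let ?C = "{h \<in> PiE {..<n} (\<lambda>_. {..<n}). h ` {..<n} = {..<n}}"
  have "restrict id {..<n} \<in> ?C" by auto
  moreover have "finite ?C" by (intro finite_Collect_conjI disjI1) (simp add: finite_PiE)
  ultimately have "card ?C \<noteq> 0" using card_0_eq[of ?C] by blast
  moreover have "of_nat (card ?C) * f y = of_nat (card ?C) * h y"
  proof -
    have "(\<Sum>S\<in>Pow {..<n}. (-1) ^ card S * f (\<lambda>_. \<Sum>j\<in>S. y j)) =
        (\<Sum>S\<in>Pow {..<n}. (-1) ^ card S * h (\<lambda>_. \<Sum>j\<in>S. y j))"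
    proof (intro sum.cong refl)
      fix S assume "S \<in> Pow {..<n}"
      then have "(\<Sum>j\<in>S. y j) \<in> W" by (intro csubspace_sum[OF W] y) auto
      then show "(-1) ^ card S * f (\<lambda>_. \<Sum>j\<in>S. y j) = (-1) ^ card S * h (\<lambda>_. \<Sum>j\<in>S. y j)"
        by (simp only: diag)
    qed
    then show ?thesis
      using polarization[OF f(1) W y f(2)] polarization[OF h(1) W y h(2)] by (simp only:)
  qed
  ultimately show ?thesis by simp
qed

text \<open>The zeros of a power series with a nonzero coefficient are isolated.\<close>

lemma powser_coeffs_unique:
  fixes a b :: "nat \<Rightarrow> complex"
  assumes "\<And>z. (\<lambda>n. a n * z ^ n) sums F z" "\<And>z. (\<lambda>n. b n * z ^ n) sums F z"
  shows "a = b"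
proof
  fix m
  have s: "(\<lambda>n. (a n - b n) * z ^ n) sums 0" for z
    using sums_diff[OF assms(1)[of z] assms(2)[of z]] by (simp add: algebra_simps)
  show "a m = b m"
  proof (rule ccontr)
    assume m: "a m \<noteq> b m"
    show False
    proof (cases "m = 0")
      case True
      then show False using s[of 0] m by simp
    next
      case False
      obtain r :: real where r: "0 < r" "\<And>z::complex. z \<in> cball 0 r - {0} \<Longrightarrow> (\<lambda>_. 0::complex) z \<noteq> 0"
        by (rule powser_0_nonzero[of 1 0 "\<lambda>n. a n - b n" "\<lambda>_. 0" m]) (use s m False in auto)
      from r(2)[of "of_real r"] r(1) show False by simp
    qed
  qed
qed

section \<open>Elements of the tensor powers as multilinear forms\<close>

context nuclear_space_chain
begin

lemma csubspace_E: "csubspace (E \<times> E)"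
  by (auto simp: csubspace_def cscale_def zero_prod_def)

text \<open>The arguments are replaced by their limits one at a time: the difference between two
  consecutive steps is a value of the form with one argument tending to zero and the others
  bounded.\<close>

lemma mlin_tendsto:
  assumes f: "mlin n W f" "csubspace W"
    and bound: "\<And>y. (\<And>i. i < n \<Longrightarrow> y i \<in> W) \<Longrightarrow> cmod (f y) \<le> A * (\<Prod>i<n. N p (y i))"
    and Y: "\<And>k i. i < n \<Longrightarrow> Y k i \<in> W" and y: "\<And>i. i < n \<Longrightarrow> y i \<in> W"
    and lim: "\<And>i. i < n \<Longrightarrow> (\<lambda>k. N p (Y k i - y i)) \<longlonglongrightarrow> 0"
  shows "(\<lambda>k. f (Y k)) \<longlonglongrightarrow> f y"
proof -
  have NY: "(\<lambda>k. N p (Y k i)) \<longlonglongrightarrow> N p (y i)" if i: "i < n" for i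
  proof (rule LIM_zero_cancel, rule Lim_null_comparison[OF always_eventually lim[OF i]], rule allI)
    fix k
    have "N p (Y k i) \<le> N p (Y k i - y i) + N p (y i)" "N p (y i) \<le> N p (- (Y k i - y i)) + N p (Y k i)"
      using dual_norm_triangle[of p "Y k i - y i" "y i"] dual_norm_triangle[of p "- (Y k i - y i)" "Y k i"]
      by auto
    then show "norm (N p (Y k i) - N p (y i)) \<le> N p (Y k i - y i)"
      unfolding dual_norm_minus by simp
  qed
  have "(\<lambda>k. f (\<lambda>i. if i < m then Y k i else y i)) \<longlonglongrightarrow> f y" if "m \<le> n" for m
    using that
  proof (induction m)
    case (Suc m)
    then have m: "m < n" by simp
    let ?z = "\<lambda>k i. if i < m then Y k i else y i"
    let ?d = "\<lambda>k. (?z k)(m := Y k m - y m)"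
    have dW: "Y k m - y m \<in> W" for k by (rule csubspace_diff[OF f(2) Y[OF m] y[OF m]])
    have zW: "?z k i \<in> W" if "i < n" for k i using Y[OF that] y[OF that] by simp
    have dW': "?d k i \<in> W" if "i < n" for k i using dW zW[OF that] by simp
    have e: "f (\<lambda>i. if i < Suc m then Y k i else y i) = f (?d k) + f (?z k)" for k
    proof -
      have "(\<lambda>i. if i < Suc m then Y k i else y i) = (?z k)(m := (Y k m - y m) + y m)"
        by (auto simp: less_Suc_eq)
      then have "f (\<lambda>i. if i < Suc m then Y k i else y i) = f ((?z k)(m := (Y k m - y m) + y m))"
        by (simp only:)
      also have "\<dots> = f (?d k) + f ((?z k)(m := y m))"
        by (rule mlinD(2)[OF f(1) zW m dW y[OF m]])
      also have "(?z k)(m := y m) = ?z k" by auto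
      finally show ?thesis .
    qed
    have "(\<lambda>k. f (?d k)) \<longlonglongrightarrow> 0"
    proof (rule Lim_null_comparison[OF always_eventually], rule allI)
      show "norm (f (?d k)) \<le> A * (\<Prod>i<n. N p (?d k i))" for k by (rule bound[OF dW'])
      have "(\<lambda>k. \<Prod>i<n. N p (?d k i)) \<longlonglongrightarrow> (\<Prod>i<n. if i = m then 0 else N p (y i))"
      proof (rule tendsto_prod)
        fix i assume "i \<in> {..<n}"
        then have i: "i < n" by simp
        show "(\<lambda>k. N p (?d k i)) \<longlonglongrightarrow> (if i = m then 0 else N p (y i))"
          using lim[OF i] NY[OF i] by (cases "i = m"; cases "i < m") auto
      qed
      moreover have "(\<Prod>i<n. if i = m then 0 else N p (y i)) = 0"
        by (rule prod_zero) (use m in auto)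
      ultimately have "(\<lambda>k. A * (\<Prod>i<n. N p (?d k i))) \<longlonglongrightarrow> A * 0"
        by (intro tendsto_mult tendsto_const) simp
      then show "(\<lambda>k. A * (\<Prod>i<n. N p (?d k i))) \<longlonglongrightarrow> 0" by simp
    qed
    from tendsto_add[OF this Suc.IH] show ?case using Suc.prems unfolding e by simp
  qed simp
  from this[of n] have "(\<lambda>k. f (\<lambda>i. if i < n then Y k i else y i)) \<longlonglongrightarrow> f y" by simp
  moreover have "f (\<lambda>i. if i < n then Y k i else y i) = f (Y k)" for k by (rule mlinD(1)[OF f(1)]) simp
  ultimately show ?thesis by simp
qed

lemma bilin_linear:
  fixes x a b :: "'b::real_inner cplx"
  shows "bilin inner x (a + b) = bilin inner x a + bilin inner x b"
    "bilin inner x (cscale z a) = z * bilin inner x a"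
  by (simp_all add: bilin_def cscale_def complex_eq_iff inner_add_right inner_diff_right algebra_simps)

lemma mlin_tensor_pair:
  fixes t :: "'b::real_inner formal_tensor"
  shows "mlin n UNIV (tensor_pair n t)"
proof -
  have upd: "tensor_pair n t (y(i := a)) =
      (\<Sum>(c, x)\<leftarrow>t. c * (bilin inner (x i) a * (\<Prod>j\<in>{..<n} - {i}. bilin inner (x j) (y j))))"
    if "i < n" for y i a
  proof -
    have "(\<Prod>j<n. bilin inner (x j) ((y(i := a)) j)) =
        bilin inner (x i) a * (\<Prod>j\<in>{..<n} - {i}. bilin inner (x j) (y j))" for x
      using that by (subst prod.remove[of _ i]) (auto intro!: arg_cong2[where f = "(*)"] prod.cong)
    then show ?thesis by (simp only: tensor_pair_def)
  qed
  show ?thesis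
    unfolding mlin_def
  proof (intro conjI allI impI)
    fix y y' :: "nat \<Rightarrow> 'b cplx" assume "\<forall>i<n. y i = y' i"
    then have "(\<Prod>i<n. bilin inner (x i) (y i)) = (\<Prod>i<n. bilin inner (x i) (y' i))" for x
      by (intro prod.cong) auto
    then show "tensor_pair n t y = tensor_pair n t y'" by (simp only: tensor_pair_def)
  next
    fix y :: "nat \<Rightarrow> 'b cplx" and i a b assume i: "i < n"
    show "tensor_pair n t (y(i := a + b)) = tensor_pair n t (y(i := a)) + tensor_pair n t (y(i := b))"
      unfolding upd[OF i] by (induction t) (auto simp: bilin_linear algebra_simps)
  next
    fix y :: "nat \<Rightarrow> 'b cplx" and i a z assume i: "i < n"
    show "tensor_pair n t (y(i := cscale z a)) = z * tensor_pair n t (y(i := a))"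
      unfolding upd[OF i] by (induction t) (auto simp: bilin_linear algebra_simps)
  qed
qed

lemma mlin_limit:
  fixes h :: "(nat \<Rightarrow> 'b::real_vector cplx) \<Rightarrow> complex"
  assumes "\<And>k. mlin n W (f k)" "\<And>y. (\<lambda>k. f k y) \<longlonglongrightarrow> h y"
  shows "mlin n W h"
  unfolding mlin_def
proof (intro conjI allI impI)
  fix y y' :: "nat \<Rightarrow> 'b cplx" assume "\<forall>i<n. y i = y' i"
  then have "f k y = f k y'" for k by (intro mlinD(1)[OF assms(1)]) auto
  then show "h y = h y'" using LIMSEQ_unique[OF assms(2)[of y]] assms(2)[of y'] by simp
next
  fix y :: "nat \<Rightarrow> 'b cplx" and i a b assume A: "\<forall>j<n. y j \<in> W" "i < n" "a \<in> W" "b \<in> W"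
  have "f k (y(i := a + b)) = f k (y(i := a)) + f k (y(i := b))" for k
    by (rule mlinD(2)[OF assms(1)]) (use A in auto)
  then have "(\<lambda>k. f k (y(i := a + b))) \<longlonglongrightarrow> h (y(i := a)) + h (y(i := b))"
    using tendsto_add[OF assms(2) assms(2)] by simp
  then show "h (y(i := a + b)) = h (y(i := a)) + h (y(i := b))"
    by (rule LIMSEQ_unique[OF assms(2)])
next
  fix y :: "nat \<Rightarrow> 'b cplx" and i a z assume A: "\<forall>j<n. y j \<in> W" "i < n" "a \<in> W"
  have "f k (y(i := cscale z a)) = z * f k (y(i := a))" for k
    by (rule mlinD(3)[OF assms(1)]) (use A in auto)
  then have "(\<lambda>k. f k (y(i := cscale z a))) \<longlonglongrightarrow> z * h (y(i := a))"
    using tendsto_mult[OF tendsto_const assms(2)] by simp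
  then show "h (y(i := cscale z a)) = z * h (y(i := a))"
    by (rule LIMSEQ_unique[OF assms(2)])
qed

lemma sym_tensorD:
  assumes "f \<in> sym_tensor_power (H p) (ip p) n"
  shows "mlin n UNIV f" "\<pi> permutes {..<n} \<Longrightarrow> f (y \<circ> \<pi>) = f y"
    "cmod (f y) \<le> tensor_norm (H p) (ip p) n f * (\<Prod>i<n. N p (y i))"
proof -
  obtain t0 where t0: "tensor_seq (H p) (ip p) n t0 f" using assms unfolding sym_tensor_power_def by blast
  show "mlin n UNIV f" by (rule mlin_limit[OF mlin_tensor_pair tensor_seqD(2)[OF t0]])
  show "f (y \<circ> \<pi>) = f y" if "\<pi> permutes {..<n}" using assms that unfolding sym_tensor_power_def by blast
  let ?P = "\<Prod>i<n. N p (y i)"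
  have le: "cmod (f y) \<le> r * ?P"
    if t: "tensor_seq (H p) (ip p) n t f" and r: "(\<lambda>k. formal_norm (ip p) n (t k)) \<longlonglongrightarrow> r" for t r
    by (rule LIMSEQ_le[OF tendsto_norm[OF tensor_seqD(2)[OF t]] tendsto_mult_right[OF r]])
      (use tensor_pair_bound[OF tensor_seqD(1)[OF t]] in blast)
  show "cmod (f y) \<le> tensor_norm (H p) (ip p) n f * ?P"
  proof (cases "?P = 0")
    case True
    obtain r where "(\<lambda>k. formal_norm (ip p) n (t0 k)) \<longlonglongrightarrow> r"
      using tensor_seq_norms_converge[OF ips t0] .
    from le[OF t0 this] show ?thesis unfolding True by simp
  next
    case False
    have "?P \<ge> 0" by (intro prod_nonneg) simp
    then have P: "?P > 0" using False by linarith
    have "cmod (f y) / ?P \<le> tensor_norm (H p) (ip p) n f"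
    proof (rule tensor_norm_lower[OF ips assms])
      fix t r assume "tensor_seq (H p) (ip p) n t f" "(\<lambda>k. formal_norm (ip p) n (t k)) \<longlonglongrightarrow> r"
      from le[OF this] show "cmod (f y) / ?P \<le> r" using P by (simp add: pos_divide_le_eq)
    qed
    then show ?thesis using P by (simp add: pos_divide_le_eq)
  qed
qed

lemma dense_E_cplx:
  obtains Y where "\<And>k. Y k \<in> E \<times> E" "(\<lambda>k. N p (Y k - \<xi>)) \<longlonglongrightarrow> 0"
proof -
  have "\<exists>e\<in>E. norm (e - v) < inverse (real (Suc k))" for v k
  proof -
    have "\<exists>e\<in>E. norm (v - e) < inverse (real (Suc k))"
      using dense[of 0] unfolding ip_dense_def ip_norm_0 by (simp add: ambient)
    then show ?thesis by (simp only: norm_minus_commute)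
  qed
  then obtain e where e: "\<And>v k. e v k \<in> E" "\<And>v k. norm (e v k - v) < inverse (real (Suc k))" by metis
  define Y where "Y k = (e (fst \<xi>) k, e (snd \<xi>) k)" for k
  have "(\<lambda>k. N p (Y k - \<xi>)) \<longlonglongrightarrow> 0"
  proof (rule Lim_null_comparison[OF always_eventually], rule allI)
    fix k
    have "N p (Y k - \<xi>) \<le> norm (Y k - \<xi>)" by (rule dual_norm_le_norm)
    also have "\<dots> = norm (e (fst \<xi>) k - fst \<xi>, e (snd \<xi>) k - snd \<xi>)"
      unfolding Y_def by (cases \<xi>) simp
    also have "\<dots> \<le> norm (e (fst \<xi>) k - fst \<xi>) + norm (e (snd \<xi>) k - snd \<xi>)" by (rule norm_Pair_le)
    also have "\<dots> \<le> 2 * inverse (real (Suc k))" using e(2)[of "fst \<xi>" k] e(2)[of "snd \<xi>" k] by linarith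
    finally show "norm (N p (Y k - \<xi>)) \<le> 2 * inverse (real (Suc k))" by simp
    show "(\<lambda>k. 2 * inverse (real (Suc k))) \<longlonglongrightarrow> 0"
      using tendsto_mult[OF tendsto_const LIMSEQ_inverse_real_of_nat, of 2] by simp
  qed
  then show ?thesis using that[of Y] e(1) by (simp add: Y_def)
qed

text \<open>Both forms are continuous in the dual norm and \<open>E\<close> is dense, so polarization on \<open>E\<close> is
  enough.\<close>

lemma sym_tensor_unique:
  assumes f: "f \<in> sym_tensor_power (H p) (ip p) n" and h: "h \<in> sym_tensor_power (H p) (ip p) n"
    and diag: "\<And>\<xi>. \<xi> \<in> E \<times> E \<Longrightarrow> f (\<lambda>_. \<xi>) = h (\<lambda>_. \<xi>)"
  shows "f = h"
proof
  fix y :: "nat \<Rightarrow> 'a cplx"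
  have "\<exists>Y. (\<forall>k. Y k \<in> E \<times> E) \<and> (\<lambda>k. N p (Y k - y i)) \<longlonglongrightarrow> 0" for i
    by (rule dense_E_cplx[of p "y i"]) blast
  then obtain Z where Z: "\<And>i k. Z i k \<in> E \<times> E" "\<And>i. (\<lambda>k. N p (Z i k - y i)) \<longlonglongrightarrow> 0" by metis
  let ?Y = "\<lambda>k i. Z i k"
  have "f (?Y k) = h (?Y k)" for k
  proof (rule mlin_eq_of_diagonal[where W = "E \<times> E"])
    show "mlin n (E \<times> E) f" "mlin n (E \<times> E) h"
      using mlin_subset[OF sym_tensorD(1)[OF f] subset_UNIV] mlin_subset[OF sym_tensorD(1)[OF h] subset_UNIV] by blast+
    show "f (y \<circ> \<pi>) = f y" "h (y \<circ> \<pi>) = h y" if "\<pi> permutes {..<n}" for \<pi> y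
      using sym_tensorD(2)[OF f that] sym_tensorD(2)[OF h that] by blast+
    show "csubspace (E \<times> E)" by (rule csubspace_E)
    show "f (\<lambda>_. \<xi>) = h (\<lambda>_. \<xi>)" if "\<xi> \<in> E \<times> E" for \<xi> by (rule diag[OF that])
    show "Z i k \<in> E \<times> E" for i by (rule Z(1))
  qed
  moreover have "(\<lambda>k. f (?Y k)) \<longlonglongrightarrow> f y"
    by (rule mlin_tendsto[OF sym_tensorD(1)[OF f] csubspace_UNIV sym_tensorD(3)[OF f] _ _ Z(2)]) auto
  moreover have "(\<lambda>k. h (?Y k)) \<longlonglongrightarrow> h y"
    by (rule mlin_tendsto[OF sym_tensorD(1)[OF h] csubspace_UNIV sym_tensorD(3)[OF h] _ _ Z(2)]) auto
  ultimately show "f y = h y" using LIMSEQ_unique by simp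
qed

lemma tensor_expansion_unique:
  assumes "tensor_expansion E (H p) (ip p) F f" "tensor_expansion E (H p) (ip p) F h"
  shows "f = h"
proof
  fix n
  have mem: "f n \<in> sym_tensor_power (H p) (ip p) n" "h n \<in> sym_tensor_power (H p) (ip p) n" for n
    using assms unfolding tensor_expansion_def by blast+
  show "f n = h n"
  proof (rule sym_tensor_unique[OF mem])
    fix \<xi> assume \<xi>: "\<xi> \<in> E \<times> E"
    have "(\<lambda>n. f n (\<lambda>_. cscale z \<xi>)) sums F (cscale z \<xi>)" "(\<lambda>n. h n (\<lambda>_. cscale z \<xi>)) sums F (cscale z \<xi>)" for z
      using assms csubspaceD(3)[OF csubspace_E \<xi>] unfolding tensor_expansion_def by blast+
    then have "(\<lambda>n. f n (\<lambda>_. \<xi>) * z ^ n) sums F (cscale z \<xi>)" "(\<lambda>n. h n (\<lambda>_. \<xi>) * z ^ n) sums F (cscale z \<xi>)" for z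
      unfolding mlin_scale_diagonal[OF sym_tensorD(1)[OF mem(1)] csubspace_UNIV UNIV_I]
        mlin_scale_diagonal[OF sym_tensorD(1)[OF mem(2)] csubspace_UNIV UNIV_I]
      by (simp_all add: mult.commute)
    from powser_coeffs_unique[OF this] show "f n (\<lambda>_. \<xi>) = h n (\<lambda>_. \<xi>)" by metis
  qed
qed

end

section \<open>Bounded multilinear forms as Hilbert tensors\<close>

lemma tensor_herm_diff:
  "tensor_herm g n (tensor_diff s t) (tensor_diff s t) =
    tensor_herm g n s s - tensor_herm g n s t - tensor_herm g n t s + tensor_herm g n t t"
proof -
  have neg: "(\<Sum>(c, x)\<leftarrow>map (\<lambda>(c, x). (- c, x)) t. G c x) = (\<Sum>(c, x)\<leftarrow>t. G (- c) x)"
    for G :: "complex \<Rightarrow> _ \<Rightarrow> complex"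
    by (induction t) auto
  have right: "(\<Sum>(d, y)\<leftarrow>tensor_diff s t. c * cnj d * P y) =
      (\<Sum>(d, y)\<leftarrow>s. c * cnj d * P y) - (\<Sum>(d, y)\<leftarrow>t. c * cnj d * P y)" for c P
  proof -
    have "(\<Sum>(d, y)\<leftarrow>t. c * cnj (- d) * P y) = - (\<Sum>(d, y)\<leftarrow>t. c * cnj d * P y)"
      by (induction t) auto
    then show ?thesis unfolding tensor_diff_def map_append sum_list_append neg by simp
  qed
  have left: "tensor_herm g n (tensor_diff s t) u = tensor_herm g n s u - tensor_herm g n t u" for u
  proof -
    have "(\<Sum>(c, x)\<leftarrow>t. \<Sum>(d, y)\<leftarrow>u. - c * cnj d * (\<Prod>i<n. herm g (x i) (y i))) = - tensor_herm g n t u"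
      unfolding tensor_herm_def
    proof (induction t)
      case (Cons a t)
      have "(\<Sum>b\<leftarrow>u. - (fst a * cnj (fst b) * (\<Prod>i<n. herm g (snd a i) (snd b i)))) =
          - (\<Sum>b\<leftarrow>u. fst a * cnj (fst b) * (\<Prod>i<n. herm g (snd a i) (snd b i)))"
        by (induction u) auto
      then show ?case using Cons by (simp add: case_prod_beta)
    qed simp
    then show ?thesis unfolding tensor_herm_def tensor_diff_def map_append sum_list_append neg by simp
  qed
  have right': "tensor_herm g n u (tensor_diff s t) = tensor_herm g n u s - tensor_herm g n u t" for u
    unfolding tensor_herm_def right by (induction u) auto
  show ?thesis unfolding left right' by simp
qed

lemma tensor_pair_diff:
  "tensor_pair n (tensor_diff s t) y = tensor_pair n s y - tensor_pair n t y"
proof -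
  have "(\<Sum>(c, x)\<leftarrow>map (\<lambda>(c, x). (- c, x)) t. c * P x) = - (\<Sum>(c, x)\<leftarrow>t. c * P x)"
    for P :: "(nat \<Rightarrow> 'a cplx) \<Rightarrow> complex"
    by (induction t) auto
  then show ?thesis by (simp add: tensor_pair_def tensor_diff_def)
qed

definition basis_tensor ::
    "(nat \<Rightarrow> 'a::zero) \<Rightarrow> ((nat \<Rightarrow> nat) \<Rightarrow> complex) \<Rightarrow> (nat \<Rightarrow> nat) set \<Rightarrow> 'a formal_tensor" where
  "basis_tensor d c I = map (\<lambda>j. (c j, \<lambda>i. (d (j i), 0))) (SOME l. distinct l \<and> set l = I)"

lemma sum_list_basis_tensor:
  assumes "finite I"
  shows "(\<Sum>(e, x)\<leftarrow>basis_tensor d c I. G e x) = (\<Sum>j\<in>I. G (c j) (\<lambda>i. (d (j i), 0)) :: complex)"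
proof -
  define l where "l = (SOME l. distinct l \<and> set l = I)"
  have "\<exists>l. distinct l \<and> set l = I" using finite_distinct_list[OF assms] by blast
  then have l: "distinct l \<and> set l = I" unfolding l_def by (rule someI_ex)
  then show ?thesis
    unfolding basis_tensor_def l_def[symmetric] by (simp add: o_def sum_list_distinct_conv_sum_set)
qed

lemma basis_tensor_mem:
  assumes "finite I" "\<And>k. d k \<in> V" "0 \<in> V"
  shows "basis_tensor d c I \<in> formal_tensors V n"
  using assms by (auto simp: basis_tensor_def formal_tensors_def)

text \<open>Products of distinct multi-indices are orthogonal. The zero vectors admitted in \<open>d\<close> are the
  reason for the factor in addition to the squared coefficient; it is zero or one.\<close>

lemma tensor_herm_basis_tensor:
  assumes "ip_space V g" "ip_space.orthoseq V g d"
    and I: "finite I" "finite I'" "I \<subseteq> PiE {..<n} (\<lambda>_. UNIV)" "I' \<subseteq> PiE {..<n} (\<lambda>_. UNIV)"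
  shows "tensor_herm g n (basis_tensor d c I) (basis_tensor d c I') =
    (\<Sum>j\<in>I \<inter> I'. of_real ((cmod (c j))\<^sup>2 * (\<Prod>i<n. g (d (j i)) (d (j i)))))"
proof -
  interpret ip_space V g by (rule assms)
  note d = orthoseqD[OF assms(2)]
  have h: "herm g (d k, 0) (d l, 0) = (if k = l then of_real (g (d k) (d k)) else 0)" for k l
    using d(1) d(2)[of k l] by (auto simp: herm_def complex_eq_iff)
  have pr: "(\<Prod>i<n. herm g (d (j i), 0) (d (j' i), 0)) =
      (if j = j' then of_real (\<Prod>i<n. g (d (j i)) (d (j i))) else 0)"
    if "j \<in> I" "j' \<in> I'" for j j'
  proof (cases "j = j'")
    case False
    have "j \<in> PiE {..<n} (\<lambda>_. UNIV)" "j' \<in> PiE {..<n} (\<lambda>_. UNIV)" using that I(3,4) by blast+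
    from PiE_ext[OF this] False obtain i where i: "i < n" "j i \<noteq> j' i" by auto
    then have "(\<Prod>i<n. herm g (d (j i), 0) (d (j' i), 0)) = 0"
      by (intro prod_zero bexI[of _ i]) (auto simp: h)
    then show ?thesis using False by simp
  qed (simp add: h)
  have "tensor_herm g n (basis_tensor d c I) (basis_tensor d c I') =
      (\<Sum>j\<in>I. \<Sum>j'\<in>I'. c j * cnj (c j') * (\<Prod>i<n. herm g (d (j i), 0) (d (j' i), 0)))"
    unfolding tensor_herm_def sum_list_basis_tensor[OF I(1)] sum_list_basis_tensor[OF I(2)] ..
  also have "\<dots> = (\<Sum>j\<in>I. \<Sum>j'\<in>I'. if j = j' then of_real ((cmod (c j))\<^sup>2 * (\<Prod>i<n. g (d (j i)) (d (j i)))) else 0)"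
  proof (intro sum.cong refl)
    fix j j' assume "j \<in> I" "j' \<in> I'"
    note p = pr[OF this]
    have "c j * cnj (c j) = of_real ((cmod (c j))\<^sup>2)" by (rule complex_norm_square[symmetric])
    then show "c j * cnj (c j') * (\<Prod>i<n. herm g (d (j i), 0) (d (j' i), 0)) =
        (if j = j' then of_real ((cmod (c j))\<^sup>2 * (\<Prod>i<n. g (d (j i)) (d (j i)))) else 0)"
      unfolding p by (cases "j = j'") (simp_all only: of_real_mult if_True if_False mult_zero_right simp_thms)
  qed
  also have "\<dots> = (\<Sum>j\<in>I. if j \<in> I' then of_real ((cmod (c j))\<^sup>2 * (\<Prod>i<n. g (d (j i)) (d (j i)))) else 0)"
    by (simp add: I(2))
  also have "\<dots> = (\<Sum>j\<in>I \<inter> I'. of_real ((cmod (c j))\<^sup>2 * (\<Prod>i<n. g (d (j i)) (d (j i)))))"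
    by (rule sum.inter_restrict[OF I(1), symmetric])
  finally show ?thesis .
qed

context nuclear_space_chain
begin

text \<open>A form that is bounded for the dual norm of a level \<open>p\<close> is only a weak limit of tensors
  over \<open>H p\<close>. Expanding it along the basis \<open>\<xi>\<close>, which is orthonormal for the dual norm of
  level \<open>q\<close>, the squares of the coefficients are dominated by a product of copies of the
  convergent sum of the squared dual norms of level \<open>p\<close>; this makes it a Hilbert tensor over
  \<open>H q\<close>.\<close>

lemma tensor_of_form:
  assumes qp: "q \<le> p" and \<xi>: "\<And>k. \<xi> k \<in> E"
    and on: "ip_space.orthoseq (H q) (ip q) (\<lambda>k. J q (\<xi> k))"
    and tot: "ip_space.total (H q) (ip q) (\<lambda>k. J q (\<xi> k))"
    and S: "\<And>m. (\<Sum>k<m. (N p (\<xi> k, 0))\<^sup>2) \<le> S"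
    and f: "mlin n (E \<times> E) f"
    and sym: "\<And>\<pi> y. \<pi> permutes {..<n} \<Longrightarrow> (\<And>i. i < n \<Longrightarrow> y i \<in> E \<times> E) \<Longrightarrow> f (y \<circ> \<pi>) = f y"
    and A: "A \<ge> 0" "\<And>y. (\<And>i. i < n \<Longrightarrow> y i \<in> E \<times> E) \<Longrightarrow> cmod (f y) \<le> A * (\<Prod>i<n. N p (y i))"
  obtains h where "h \<in> sym_tensor_power (H q) (ip q) n"
    "\<And>y. (\<And>i. i < n \<Longrightarrow> y i \<in> E \<times> E) \<Longrightarrow> h y = f y"
    "tensor_norm (H q) (ip q) n h \<le> sqrt (A\<^sup>2 * S ^ n)"
proof -
  interpret q: ip_space "H q" "ip q" by (rule ips)
  define d where "d k = J q (\<xi> k)" for k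
  have d_on: "q.orthoseq d" and d_tot: "q.total d" using on tot unfolding d_def by simp_all
  note d = q.orthoseqD[OF d_on]
  define x where "x k = (\<xi> k, 0 :: 'a)" for k
  have xE: "x k \<in> E \<times> E" for k using \<xi> by (simp add: x_def)
  define c where "c j = f (\<lambda>i. x (j i))" for j
  define I where "I k = PiE {..<n} (\<lambda>_. {..<k::nat})" for k
  have I: "finite (I k)" "I k \<subseteq> PiE {..<n} (\<lambda>_. UNIV)" for k
    unfolding I_def by (auto intro: finite_PiE)
  have I_mono: "I j \<subseteq> I k" if "j \<le> k" for j k unfolding I_def using that by (intro PiE_mono) auto
  define t where "t k = basis_tensor d c (I k)" for k
  have tm: "t k \<in> formal_tensors (H q) n" for k
    unfolding t_def by (rule basis_tensor_mem[OF I(1) d(1)]) simp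
  define w where "w j = (cmod (c j))\<^sup>2 * (\<Prod>i<n. ip q (d (j i)) (d (j i)))" for j
  have w0: "w j \<ge> 0" for j unfolding w_def using q.nonneg[OF d(1)] by (intro mult_nonneg_nonneg prod_nonneg) auto
  define s where "s k = (\<Sum>j\<in>I k. w j)" for k
  have s_mono: "s j \<le> s k" if "j \<le> k" for j k
    unfolding s_def using I_mono[OF that] I(1) w0 by (intro sum_mono2) auto
  have herm: "tensor_herm (ip q) n (t j) (t k) = of_real (s (min j k))" for j k
  proof -
    have "I j \<inter> I k = I (min j k)" using I_mono[of j k] I_mono[of k j] by (cases "j \<le> k") (auto simp: min_def)
    then show ?thesis
      unfolding t_def tensor_herm_basis_tensor[OF ips d_on I(1) I(1) I(2) I(2)] s_def w_def by simp
  qed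
  have fn: "formal_norm (ip q) n (t k) = sqrt (s k)" for k
    unfolding formal_norm_def herm by simp
  have fnd: "formal_norm (ip q) n (tensor_diff (t j) (t k)) = sqrt \<bar>s j - s k\<bar>" for j k
    unfolding formal_norm_def tensor_herm_diff herm using s_mono[of j k] s_mono[of k j]
    by (cases "j \<le> k") (auto simp: min_def)
  have s_le: "s k \<le> A\<^sup>2 * S ^ n" for k
  proof -
    have "w j \<le> A\<^sup>2 * (\<Prod>i<n. (N p (x (j i)))\<^sup>2)" for j
    proof -
      have "(\<Prod>i<n. ip q (d (j i)) (d (j i))) \<le> 1" using q.nonneg[OF d(1)] d(4) by (intro prod_le_1) auto
      then have "w j \<le> (cmod (c j))\<^sup>2 * 1" unfolding w_def by (intro mult_left_mono) auto
      also have "\<dots> \<le> (A * (\<Prod>i<n. N p (x (j i))))\<^sup>2"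
        using A(2)[of "\<lambda>i. x (j i)"] xE unfolding c_def by (simp add: power_mono)
      finally show ?thesis by (simp add: power_mult_distrib prod_power_distrib)
    qed
    then have "s k \<le> (\<Sum>j\<in>I k. A\<^sup>2 * (\<Prod>i<n. (N p (x (j i)))\<^sup>2))" unfolding s_def by (rule sum_mono)
    also have "\<dots> = A\<^sup>2 * (\<Prod>i<n. \<Sum>l<k. (N p (x l))\<^sup>2)"
      unfolding I_def by (subst prod_sum_PiE) (auto simp: sum_distrib_left)
    also have "\<dots> = A\<^sup>2 * (\<Sum>l<k. (N p (x l))\<^sup>2) ^ n" by simp
    also have "\<dots> \<le> A\<^sup>2 * S ^ n"
      using S[of k] unfolding x_def by (intro mult_left_mono power_mono sum_nonneg) auto
    finally show ?thesis .
  qed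
  have "incseq s" using s_mono by (simp add: incseq_def)
  then obtain l where "s \<longlonglongrightarrow> l" using incseq_convergent[of s "A\<^sup>2 * S ^ n"] s_le by blast
  then have sC: "Cauchy s" by (rule LIMSEQ_imp_Cauchy)
  have cauchy: "\<exists>M. \<forall>j\<ge>M. \<forall>k\<ge>M. formal_norm (ip q) n (tensor_diff (t j) (t k)) < e" if "e > 0" for e
  proof -
    have "e\<^sup>2 > 0" using that by simp
    from CauchyD[OF sC this] obtain M where M: "\<forall>j\<ge>M. \<forall>k\<ge>M. norm (s j - s k) < e\<^sup>2" ..
    show ?thesis
    proof (intro exI[of _ M] allI impI)
      fix j k assume "M \<le> j" "M \<le> k"
      then have "\<bar>s j - s k\<bar> < e\<^sup>2" using M by simp
      then have "sqrt \<bar>s j - s k\<bar> < sqrt (e\<^sup>2)" by (rule real_sqrt_less_mono)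
      then show "formal_norm (ip q) n (tensor_diff (t j) (t k)) < e" unfolding fnd using that by simp
    qed
  qed
  have conv: "convergent (\<lambda>k. tensor_pair n (t k) y)" for y
  proof -
    define B where "B = (\<Prod>i<n. N q (y i)) + 1"
    have "(\<Prod>i<n. N q (y i)) \<ge> 0" by (intro prod_nonneg) simp
    then have B: "B > 0" by (simp add: B_def)
    have "Cauchy (\<lambda>k. tensor_pair n (t k) y)"
    proof (rule CauchyI)
      fix e :: real assume e: "e > 0"
      then have "e / B > 0" using B by simp
      from cauchy[OF this] obtain M where
        M: "\<forall>j\<ge>M. \<forall>k\<ge>M. formal_norm (ip q) n (tensor_diff (t j) (t k)) < e / B" ..
      show "\<exists>M. \<forall>j\<ge>M. \<forall>k\<ge>M. norm (tensor_pair n (t j) y - tensor_pair n (t k) y) < e"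
      proof (intro exI[of _ M] allI impI)
        fix j k assume jk: "M \<le> j" "M \<le> k"
        let ?D = "tensor_diff (t j) (t k)"
        have "norm (tensor_pair n (t j) y - tensor_pair n (t k) y) = cmod (tensor_pair n ?D y)"
          by (simp add: tensor_pair_diff)
        also have "\<dots> \<le> formal_norm (ip q) n ?D * (\<Prod>i<n. N q (y i))"
          by (rule tensor_pair_bound[OF formal_tensors_diff[OF tm tm]])
        also have "\<dots> \<le> formal_norm (ip q) n ?D * B"
          unfolding B_def using fnd by (intro mult_left_mono) auto
        also have "\<dots> < e / B * B" using M jk B by (intro mult_strict_right_mono) auto
        finally show "norm (tensor_pair n (t j) y - tensor_pair n (t k) y) < e" using B by simp
      qed
    qed
    then show ?thesis by (simp add: Cauchy_convergent_iff)
  qed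
  define h where "h y = lim (\<lambda>k. tensor_pair n (t k) y)" for y
  have lim: "(\<lambda>k. tensor_pair n (t k) y) \<longlonglongrightarrow> h y" for y
    unfolding h_def using conv by (simp add: convergent_LIMSEQ_iff)
  have seq: "tensor_seq (H q) (ip q) n t h"
    unfolding tensor_seq_def by (intro conjI allI impI tm cauchy lim)
  \<comment> \<open>Pairing with the partial sums applies the form to the projections onto the first basis
    vectors. This gives the symmetry of the limit, and its agreement with the form on \<open>E\<close>.\<close>
  define P where "P k v = (\<Sum>j<k. cscale (bilin inner (d j, 0) v) (x j))" for k :: nat and v
  have PE: "P k v \<in> E \<times> E" for k v
    unfolding P_def by (intro csubspace_sum[OF csubspace_E] csubspaceD(3)[OF csubspace_E] xE)
  have pair: "tensor_pair n (t k) y = f (\<lambda>i. P k (y i))" for k y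
  proof -
    have "f (\<lambda>i. P k (y i)) =
        (\<Sum>j\<in>I k. (\<Prod>i<n. bilin inner (d (j i), 0) (y i)) * f (\<lambda>i. x (j i)))"
      unfolding P_def I_def
      by (rule mlin_expand[OF f csubspace_E, of "{..<k}" x "\<lambda>i j. bilin inner (d j, 0) (y i)"])
        (auto simp: xE)
    moreover have "tensor_pair n (t k) y = (\<Sum>j\<in>I k. c j * (\<Prod>i<n. bilin inner (d (j i), 0) (y i)))"
      unfolding tensor_pair_def t_def sum_list_basis_tensor[OF I(1)] ..
    ultimately show ?thesis unfolding c_def by (simp add: mult.commute)
  qed
  have h_sym: "h (y \<circ> \<pi>) = h y" if "\<pi> permutes {..<n}" for \<pi> y
  proof -
    have "tensor_pair n (t k) (y \<circ> \<pi>) = tensor_pair n (t k) y" for k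
      using sym[OF that, of "\<lambda>i. P k (y i)"] PE by (simp add: pair o_def)
    then show ?thesis unfolding h_def by simp
  qed
  have h_eq: "h y = f y" if y: "\<And>i. i < n \<Longrightarrow> y i \<in> E \<times> E" for y
  proof -
    define s' where "s' a k = (\<Sum>j<k. inner (d j) a *\<^sub>R \<xi> j)" for a and k :: nat
    define err where "err a k = ip_norm (ip q) (J q (s' a k - a))" for a k
    have Jlim: "err a \<longlonglongrightarrow> 0" for a
    proof -
      have J0: "J q 0 = 0" using J_scale[of q 0 0] by simp
      have Js: "J q (s' a k) = (\<Sum>j<k. ip q (d j) (J q a) *\<^sub>R d j)" for k
      proof (induction k)
        case (Suc k)
        have "inner (d k) a = ip q (d k) (J q a)"
          using J(2)[OF d(1)[of k], of a] q.sym[OF J(1)[of q a] d(1)[of k]] inner_commute[of "d k" a] by simp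
        then show ?case using Suc by (simp add: s'_def J_add J_scale flip: d_def)
      qed (simp add: J0 s'_def)
      show ?thesis
        unfolding err_def J_diff Js by (rule q.basis_expansion[OF complete d_on d_tot J(1)])
    qed
    have Plim: "(\<lambda>k. N q (P k v - v)) \<longlonglongrightarrow> 0" for v
    proof -
      have "cscale (bilin inner (d j, 0) v) (x j) = (inner (d j) (fst v) *\<^sub>R \<xi> j, inner (d j) (snd v) *\<^sub>R \<xi> j)" for j
        by (simp add: x_def bilin_def cscale_def)
      then have "P k v = (s' (fst v) k, s' (snd v) k)" for k
        unfolding P_def s'_def by (induction k) (simp_all add: zero_prod_def)
      then have 1: "N q (P k v - v) = sqrt ((err (fst v) k)\<^sup>2 + (err (snd v) k)\<^sup>2)" for k
        by (simp add: dual_norm_sq err_def)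
      have "(\<lambda>k. sqrt ((err (fst v) k)\<^sup>2 + (err (snd v) k)\<^sup>2)) \<longlonglongrightarrow> sqrt (0\<^sup>2 + 0\<^sup>2)"
        by (intro tendsto_real_sqrt tendsto_add tendsto_power Jlim)
      then show ?thesis unfolding 1 by simp
    qed
    have bound: "cmod (f y) \<le> A * (\<Prod>i<n. N q (y i))" if "\<And>i. i < n \<Longrightarrow> y i \<in> E \<times> E" for y
    proof -
      have "A * (\<Prod>i<n. N p (y i)) \<le> A * (\<Prod>i<n. N q (y i))"
        by (intro mult_left_mono prod_mono A(1)) (simp add: dual_norm_mono'[OF qp])
      then show ?thesis using A(2)[of y, OF that] by linarith
    qed
    have "(\<lambda>k. f (\<lambda>i. P k (y i))) \<longlonglongrightarrow> f y"
    proof (rule mlin_tendsto[OF f csubspace_E])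
      show "cmod (f y) \<le> A * (\<Prod>i<n. N q (y i))" if "\<And>i. i < n \<Longrightarrow> y i \<in> E \<times> E" for y
        by (rule bound[OF that])
      show "P k (y i) \<in> E \<times> E" for k i by (rule PE)
      show "y i \<in> E \<times> E" if "i < n" for i by (rule y[OF that])
      show "(\<lambda>k. N q (P k (y i) - y i)) \<longlonglongrightarrow> 0" for i by (rule Plim)
    qed
    moreover have "(\<lambda>k. f (\<lambda>i. P k (y i))) \<longlonglongrightarrow> h y" using lim[of y] by (simp only: pair)
    ultimately show ?thesis using LIMSEQ_unique by metis
  qed
  have mem: "h \<in> sym_tensor_power (H q) (ip q) n"
    unfolding sym_tensor_power_def using seq h_sym by blast
  have norm: "tensor_norm (H q) (ip q) n h \<le> sqrt (A\<^sup>2 * S ^ n)"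
    by (rule tensor_norm_le[OF ips seq]) (simp add: fn s_le)
  show ?thesis by (rule that[OF mem h_eq norm])
qed

end

section \<open>Directional derivatives of Gateaux holomorphic functions\<close>

locale gateaux =
  fixes W :: "'a::real_vector cplx set" and nrm :: "'a cplx \<Rightarrow> real"
  assumes W: "csubspace W"
    and nrm_nonneg: "nrm \<xi> \<ge> 0"
    and nrm_triangle: "nrm (\<xi> + \<eta>) \<le> nrm \<xi> + nrm \<eta>"
    and nrm_cscale: "nrm (cscale z \<xi>) = cmod z * nrm \<xi>"
begin

lemma W_mem [simp]:
  shows "0 \<in> W" "a \<in> W \<Longrightarrow> b \<in> W \<Longrightarrow> a + b \<in> W" "a \<in> W \<Longrightarrow> cscale z a \<in> W"
  by (simp_all add: csubspaceD[OF W])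

definition hol :: "('a cplx \<Rightarrow> complex) \<Rightarrow> bool" where
  "hol G \<longleftrightarrow> (\<forall>\<xi>. \<xi> \<notin> W \<longrightarrow> G \<xi> = 0) \<and>
     (\<forall>\<xi>\<in>W. \<forall>\<eta>\<in>W. (\<lambda>z. G (cscale z \<xi> + \<eta>)) holomorphic_on UNIV) \<and>
     (\<forall>R. \<exists>M. \<forall>\<eta>\<in>W. nrm \<eta> \<le> R \<longrightarrow> cmod (G \<eta>) \<le> M)"

text \<open>The directional derivative is set to zero off its domain, in all arguments, so that
  derivatives commute as functions and a repeated derivative depends only on the multiset of
  directions.\<close>

definition D :: "'a cplx \<Rightarrow> ('a cplx \<Rightarrow> complex) \<Rightarrow> 'a cplx \<Rightarrow> complex" where
  "D \<xi> G = (if hol G \<and> \<xi> \<in> W then (\<lambda>\<eta>. if \<eta> \<in> W then deriv (\<lambda>z. G (cscale z \<xi> + \<eta>)) 0 else 0)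
     else (\<lambda>_. 0))"

lemma holD:
  assumes "hol G"
  shows "\<xi> \<in> W \<Longrightarrow> \<eta> \<in> W \<Longrightarrow> (\<lambda>z. G (cscale z \<xi> + \<eta>)) holomorphic_on A"
    "\<exists>M. \<forall>\<eta>\<in>W. nrm \<eta> \<le> R \<longrightarrow> cmod (G \<eta>) \<le> M"
proof -
  show "(\<lambda>z. G (cscale z \<xi> + \<eta>)) holomorphic_on A" if "\<xi> \<in> W" "\<eta> \<in> W"
    using assms that holomorphic_on_subset[OF _ subset_UNIV] unfolding hol_def by blast
  show "\<exists>M. \<forall>\<eta>\<in>W. nrm \<eta> \<le> R \<longrightarrow> cmod (G \<eta>) \<le> M" using assms unfolding hol_def by blast
qed

lemma hol_zero: "hol (\<lambda>_. 0)"
  unfolding hol_def by (auto intro: exI[of _ 0])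

lemma D_eq: "hol G \<Longrightarrow> \<xi> \<in> W \<Longrightarrow> \<eta> \<in> W \<Longrightarrow> D \<xi> G \<eta> = deriv (\<lambda>z. G (cscale z \<xi> + \<eta>)) 0"
  by (simp add: D_def)

lemma nrm_line: "nrm (cscale z \<xi> + \<eta>) \<le> cmod z * nrm \<xi> + nrm \<eta>"
  using nrm_triangle[of "cscale z \<xi>" \<eta>] by (simp add: nrm_cscale)

lemma D_bound:
  assumes G: "hol G" "\<xi> \<in> W" "\<eta> \<in> W"
    and M: "\<And>\<eta>. \<eta> \<in> W \<Longrightarrow> nrm \<eta> \<le> R \<Longrightarrow> cmod (G \<eta>) \<le> M"
    and r: "r > 0" "nrm \<eta> + r * nrm \<xi> \<le> R"
  shows "cmod (D \<xi> G \<eta>) \<le> M / r"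
proof -
  have "cmod ((deriv ^^ 1) (\<lambda>z. G (cscale z \<xi> + \<eta>)) 0) \<le> fact 1 * M / r ^ 1"
  proof (rule Cauchy_inequality)
    show "(\<lambda>z. G (cscale z \<xi> + \<eta>)) holomorphic_on ball 0 r" by (rule holD(1)[OF G])
    show "continuous_on (cball 0 r) (\<lambda>z. G (cscale z \<xi> + \<eta>))"
      by (rule holomorphic_on_imp_continuous_on[OF holD(1)[OF G]])
    show "cmod (G (cscale x \<xi> + \<eta>)) \<le> M" if "cmod (0 - x) = r" for x
      using that nrm_line[of x \<xi> \<eta>] r by (intro M) (use G in auto)
  qed (rule r)
  then show ?thesis using D_eq[OF G] by simp
qed

text \<open>The error of the difference quotient is controlled by the second derivative along a line, and
  by Cauchy's inequality that derivative is bounded uniformly on bounded sets of base points.\<close>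

lemma difference_quotient:
  assumes G: "hol G" "\<xi> \<in> W"
  obtains C where "C \<ge> 0" "\<And>\<eta> h. \<eta> \<in> W \<Longrightarrow> nrm \<eta> \<le> R \<Longrightarrow> h \<noteq> 0 \<Longrightarrow> cmod h \<le> 1 \<Longrightarrow>
    cmod ((G (cscale h \<xi> + \<eta>) - G \<eta>) / h - D \<xi> G \<eta>) \<le> C * cmod h"
proof -
  obtain M where M: "\<And>\<eta>. \<eta> \<in> W \<Longrightarrow> nrm \<eta> \<le> R + 2 * nrm \<xi> \<Longrightarrow> cmod (G \<eta>) \<le> M"
    using holD(2)[OF G(1), of "R + 2 * nrm \<xi>"] by blast
  show ?thesis
  proof (rule that[of "2 * \<bar>M\<bar>"])
    fix \<eta> h assume \<eta>: "\<eta> \<in> W" "nrm \<eta> \<le> R" and h: "h \<noteq> 0" "cmod h \<le> 1"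
    define g where "g z = G (cscale z \<xi> + \<eta>)" for z
    have g: "g holomorphic_on A" for A unfolding g_def by (rule holD(1)[OF G \<eta>(1)])
    have "cmod (g h - (\<Sum>i\<le>1. (deriv ^^ i) g 0 * (h - 0) ^ i / fact i)) \<le> (2 * \<bar>M\<bar>) * cmod (h - 0) ^ Suc 1 / fact 1"
    proof (rule complex_Taylor[of "cball 0 1" 1 "\<lambda>i. (deriv ^^ i) g", simplified funpow_0])
      show "((deriv ^^ i) g has_field_derivative (deriv ^^ Suc i) g x) (at x within cball 0 1)" for i x
        using holomorphic_derivI[OF holomorphic_higher_deriv[OF g open_UNIV], of x i "cball 0 1"] by simp
      fix x :: complex assume x: "x \<in> cball 0 1"
      have "cmod ((deriv ^^ 2) g x) \<le> fact 2 * M / 1 ^ 2"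
      proof (rule Cauchy_inequality[OF g holomorphic_on_imp_continuous_on[OF g]])
        fix w assume w: "cmod (x - w) = 1"
        have "cmod w \<le> 2" using w x norm_triangle_ineq4[of x "x - w"] by simp
        then have "cmod w * nrm \<xi> \<le> 2 * nrm \<xi>" using nrm_nonneg by (intro mult_right_mono)
        then show "cmod (g w) \<le> M" unfolding g_def using nrm_line[of w \<xi> \<eta>] \<eta> G by (intro M) auto
      qed simp
      then show "cmod ((deriv ^^ Suc 1) g x) \<le> 2 * \<bar>M\<bar>" by (simp add: numeral_2_eq_2)
    qed (use h in auto)
    then have T: "cmod (g h - (g 0 + deriv g 0 * h)) \<le> 2 * \<bar>M\<bar> * (cmod h * cmod h)" by simp
    have "(G (cscale h \<xi> + \<eta>) - G \<eta>) / h - D \<xi> G \<eta> = (g h - (g 0 + deriv g 0 * h)) / h"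
      using h D_eq[OF G \<eta>(1)] by (simp add: g_def[abs_def] field_simps)
    then have "cmod ((G (cscale h \<xi> + \<eta>) - G \<eta>) / h - D \<xi> G \<eta>) = cmod (g h - (g 0 + deriv g 0 * h)) / cmod h"
      by (simp add: norm_divide)
    also have "\<dots> \<le> 2 * \<bar>M\<bar> * cmod h" using T h by (simp add: pos_divide_le_eq mult.assoc)
    finally show "cmod ((G (cscale h \<xi> + \<eta>) - G \<eta>) / h - D \<xi> G \<eta>) \<le> 2 * \<bar>M\<bar> * cmod h" .
  qed simp
qed

definition step :: "nat \<Rightarrow> complex" where
  "step n = of_real (inverse (real (Suc n)))"

lemma step: "step n \<noteq> 0" "cmod (step n) \<le> 1" "(\<lambda>n. C * cmod (step n)) \<longlonglongrightarrow> 0" "step \<longlonglongrightarrow> 0"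
proof -
  show "step n \<noteq> 0" "cmod (step n) \<le> 1"
    by (auto simp: step_def norm_divide inverse_eq_divide simp del: of_nat_Suc)
  have "cmod (step n) = inverse (real (Suc n))" for n
    unfolding step_def norm_of_real by simp
  then show "(\<lambda>n. C * cmod (step n)) \<longlonglongrightarrow> 0"
    using tendsto_mult[OF tendsto_const LIMSEQ_inverse_real_of_nat, of C] by simp
  show "step \<longlonglongrightarrow> 0"
    unfolding step_def[abs_def] using tendsto_of_real[OF LIMSEQ_inverse_real_of_nat, where 'a = complex] by (simp only: of_real_0)
qed

lemma difference_quotient_tendsto:
  assumes "hol G" "\<xi> \<in> W" "\<And>n. X n \<in> W" "\<And>n. nrm (X n) \<le> R"
  shows "(\<lambda>n. (G (cscale (step n) \<xi> + X n) - G (X n)) / step n - D \<xi> G (X n)) \<longlonglongrightarrow> 0"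
proof -
  obtain C where C: "\<And>\<eta> h. \<eta> \<in> W \<Longrightarrow> nrm \<eta> \<le> R \<Longrightarrow> h \<noteq> 0 \<Longrightarrow> cmod h \<le> 1 \<Longrightarrow>
    cmod ((G (cscale h \<xi> + \<eta>) - G \<eta>) / h - D \<xi> G \<eta>) \<le> C * cmod h"
    by (rule difference_quotient[OF assms(1,2), of R]) blast
  show ?thesis
    by (rule Lim_null_comparison[OF always_eventually step(3)[of C]], rule allI,
        rule C[OF assms(3,4) step(1,2)])
qed

lemma difference_quotient_uniform:
  assumes G: "hol G" "\<xi> \<in> W" "\<zeta> \<in> W" "\<eta> \<in> W"
  shows "uniform_limit (cball x 1)
    (\<lambda>n w. (G (cscale w \<zeta> + (cscale (step n) \<xi> + \<eta>)) - G (cscale w \<zeta> + \<eta>)) / step n)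
    (\<lambda>w. D \<xi> G (cscale w \<zeta> + \<eta>)) sequentially"
proof -
  define R where "R = (cmod x + 1) * nrm \<zeta> + nrm \<eta>"
  obtain C where C: "\<And>\<eta> h. \<eta> \<in> W \<Longrightarrow> nrm \<eta> \<le> R \<Longrightarrow> h \<noteq> 0 \<Longrightarrow> cmod h \<le> 1 \<Longrightarrow>
    cmod ((G (cscale h \<xi> + \<eta>) - G \<eta>) / h - D \<xi> G \<eta>) \<le> C * cmod h"
    by (rule difference_quotient[OF G(1,2), of R]) blast
  have R: "nrm (cscale w \<zeta> + \<eta>) \<le> R" if "w \<in> cball x 1" for w
  proof -
    have "cmod w \<le> cmod x + 1"
      using that norm_triangle_ineq2[of w x] by (simp add: dist_norm norm_minus_commute)
    then have "cmod w * nrm \<zeta> \<le> (cmod x + 1) * nrm \<zeta>" using nrm_nonneg by (intro mult_right_mono)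
    then show ?thesis using nrm_line[of w \<zeta> \<eta>] unfolding R_def by linarith
  qed
  show ?thesis
  proof (rule uniform_limitI)
    fix e :: real assume "e > 0"
    then have "\<forall>\<^sub>F n in sequentially. C * cmod (step n) < e" by (rule order_tendstoD(2)[OF step(3)])
    then show "\<forall>\<^sub>F n in sequentially. \<forall>w\<in>cball x 1.
        dist ((G (cscale w \<zeta> + (cscale (step n) \<xi> + \<eta>)) - G (cscale w \<zeta> + \<eta>)) / step n)
          (D \<xi> G (cscale w \<zeta> + \<eta>)) < e"
    proof eventually_elim
      case (elim n)
      have e: "cscale w \<zeta> + (cscale (step n) \<xi> + \<eta>) = cscale (step n) \<xi> + (cscale w \<zeta> + \<eta>)" for w
        by (simp add: algebra_simps)
      show ?case
        unfolding e dist_norm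
        using le_less_trans[OF C[OF _ R step(1) step(2)] elim] G by simp
    qed
  qed
qed

text \<open>Along a line in another direction \<open>\<zeta>\<close> the difference quotients are entire and converge locally
  uniformly, so the limit is entire.\<close>

lemma hol_D_raw:
  assumes G: "hol G" "\<xi> \<in> W"
  shows "hol (D \<xi> G)"
  unfolding hol_def
proof (intro conjI allI impI ballI)
  show "D \<xi> G \<eta> = 0" if "\<eta> \<notin> W" for \<eta> using that by (simp add: D_def)
next
  fix \<zeta> \<eta> assume W: "\<zeta> \<in> W" "\<eta> \<in> W"
  show "(\<lambda>w. D \<xi> G (cscale w \<zeta> + \<eta>)) holomorphic_on UNIV"
  proof (rule holomorphic_uniform_sequence[OF open_UNIV])
    show "(\<lambda>w. (G (cscale w \<zeta> + (cscale (step n) \<xi> + \<eta>)) - G (cscale w \<zeta> + \<eta>)) / step n) holomorphic_on UNIV" for n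
      using step(1)[of n] W G by (intro holomorphic_intros holD(1)[OF G(1)]) auto
    show "\<exists>d>0. cball x d \<subseteq> UNIV \<and> uniform_limit (cball x d)
        (\<lambda>n w. (G (cscale w \<zeta> + (cscale (step n) \<xi> + \<eta>)) - G (cscale w \<zeta> + \<eta>)) / step n)
        (\<lambda>w. D \<xi> G (cscale w \<zeta> + \<eta>)) sequentially" for x
      using difference_quotient_uniform[OF G W, of x] by (intro exI[of _ 1]) simp
  qed
next
  fix R
  obtain M where M: "\<And>\<eta>. \<eta> \<in> W \<Longrightarrow> nrm \<eta> \<le> R + nrm \<xi> \<Longrightarrow> cmod (G \<eta>) \<le> M"
    using holD(2)[OF G(1), of "R + nrm \<xi>"] by blast
  have "cmod (D \<xi> G \<eta>) \<le> M" if "\<eta> \<in> W" "nrm \<eta> \<le> R" for \<eta>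
  proof -
    have "cmod (D \<xi> G \<eta>) \<le> M / 1"
    proof (rule D_bound[OF G that(1)])
      show "cmod (G \<zeta>) \<le> M" if "\<zeta> \<in> W" "nrm \<zeta> \<le> R + nrm \<xi>" for \<zeta> by (rule M[OF that])
    qed (use that in auto)
    then show ?thesis by simp
  qed
  then show "\<exists>M. \<forall>\<eta>\<in>W. nrm \<eta> \<le> R \<longrightarrow> cmod (D \<xi> G \<eta>) \<le> M" by blast
qed

lemma hol_D: "hol (D \<xi> G)"
proof (cases "hol G \<and> \<xi> \<in> W")
  case False
  then have "D \<xi> G = (\<lambda>_. 0)" by (auto simp: D_def)
  then show ?thesis using hol_zero by simp
qed (simp add: hol_D_raw)

lemma D_tendsto:
  assumes "hol G" "\<xi> \<in> W" "\<eta> \<in> W"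
  shows "(\<lambda>n. (G (cscale (step n) \<xi> + \<eta>) - G \<eta>) / step n) \<longlonglongrightarrow> D \<xi> G \<eta>"
  by (rule LIM_zero_cancel) (rule difference_quotient_tendsto[OF assms(1,2), of "\<lambda>_. \<eta>" "nrm \<eta>"], simp_all add: assms)

text \<open>Only holomorphy along lines is given. The increment in the direction \<open>\<xi> + \<zeta>\<close> is split into one
  along \<open>\<zeta>\<close> from \<open>\<eta>\<close> and one along \<open>\<xi>\<close> from a base point that moves to \<open>\<eta>\<close>; the latter is
  handled by the uniformity of the error.\<close>

lemma D_add:
  assumes G: "hol G" and W: "\<xi> \<in> W" "\<zeta> \<in> W" "\<eta> \<in> W"
  shows "D (\<xi> + \<zeta>) G \<eta> = D \<xi> G \<eta> + D \<zeta> G \<eta>"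
proof -
  define X where "X n = cscale (step n) \<zeta> + \<eta>" for n
  have X: "X n \<in> W" for n using W by (simp add: X_def)
  have XR: "nrm (X n) \<le> nrm \<zeta> + nrm \<eta>" for n
  proof -
    have "cmod (step n) * nrm \<zeta> \<le> 1 * nrm \<zeta>" by (intro mult_right_mono step nrm_nonneg)
    then show ?thesis using nrm_line[of "step n" \<zeta> \<eta>] by (simp add: X_def)
  qed
  have "isCont (\<lambda>w. D \<xi> G (cscale w \<zeta> + \<eta>)) 0"
    using holomorphic_on_imp_continuous_on[OF holD(1)[OF hol_D W(2,3), of \<xi> G UNIV]]
    by (simp add: continuous_on_eq_continuous_at)
  from isCont_tendsto_compose[OF this step(4)]
  have c: "(\<lambda>n. D \<xi> G (X n)) \<longlonglongrightarrow> D \<xi> G \<eta>" by (simp add: X_def)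
  have "(\<lambda>n. ((G (cscale (step n) \<xi> + X n) - G (X n)) / step n - D \<xi> G (X n)) + D \<xi> G (X n) +
      (G (cscale (step n) \<zeta> + \<eta>) - G \<eta>) / step n) \<longlonglongrightarrow> 0 + D \<xi> G \<eta> + D \<zeta> G \<eta>"
    by (intro tendsto_add difference_quotient_tendsto[OF G W(1) X XR] c D_tendsto[OF G W(2,3)])
  moreover have "((G (cscale (step n) \<xi> + X n) - G (X n)) / step n - D \<xi> G (X n)) + D \<xi> G (X n) +
      (G (cscale (step n) \<zeta> + \<eta>) - G \<eta>) / step n = (G (cscale (step n) (\<xi> + \<zeta>) + \<eta>) - G \<eta>) / step n" for n
    by (simp add: X_def cscale_add(2) add.assoc diff_divide_distrib)
  ultimately have "(\<lambda>n. (G (cscale (step n) (\<xi> + \<zeta>) + \<eta>) - G \<eta>) / step n) \<longlonglongrightarrow> D \<xi> G \<eta> + D \<zeta> G \<eta>"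
    by simp
  then show ?thesis using D_tendsto[OF G W_mem(2)[OF W(1,2)] W(3)] LIMSEQ_unique by blast
qed

lemma D_has_derivative:
  assumes "hol G" "\<xi> \<in> W" "\<eta> \<in> W"
  shows "((\<lambda>z. G (cscale z \<xi> + \<eta>)) has_field_derivative D \<xi> G \<eta>) (at 0)"
  unfolding D_eq[OF assms] by (rule holomorphic_derivI[OF holD(1)[OF assms] open_UNIV]) simp

lemma D_cscale:
  assumes G: "hol G" and W: "\<xi> \<in> W" "\<eta> \<in> W"
  shows "D (cscale c \<xi>) G \<eta> = c * D \<xi> G \<eta>"
proof -
  have "((\<lambda>z. G (cscale z \<xi> + \<eta>)) has_field_derivative D \<xi> G \<eta>) (at (0 * c))"
    using D_has_derivative[OF G W] by simp
  moreover have "((\<lambda>z. z * c) has_field_derivative c) (at 0)" by (auto intro!: derivative_eq_intros)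
  ultimately have "((\<lambda>z. G (cscale (z * c) \<xi> + \<eta>)) has_field_derivative D \<xi> G \<eta> * c) (at 0)"
    by (rule DERIV_chain2)
  moreover have "((\<lambda>z. G (cscale z (cscale c \<xi>) + \<eta>)) has_field_derivative D (cscale c \<xi>) G \<eta>) (at 0)"
    using W by (intro D_has_derivative[OF G]) auto
  ultimately have "D (cscale c \<xi>) G \<eta> = D \<xi> G \<eta> * c" using DERIV_unique by simp
  then show ?thesis by simp
qed

text \<open>Locally uniform convergence of holomorphic functions may be differentiated, so the derivative
  along \<open>\<zeta>\<close> can be taken inside the difference quotients that define the one along \<open>\<xi>\<close>.\<close>

lemma D_commute_at:
  assumes G: "hol G" and W: "\<xi> \<in> W" "\<zeta> \<in> W" "\<eta> \<in> W"
  shows "D \<zeta> (D \<xi> G) \<eta> = D \<xi> (D \<zeta> G) \<eta>"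
proof -
  let ?f = "\<lambda>n w. (G (cscale w \<zeta> + (cscale (step n) \<xi> + \<eta>)) - G (cscale w \<zeta> + \<eta>)) / step n"
  have f: "?f n holomorphic_on UNIV" for n
    using step(1)[of n] W by (intro holomorphic_intros holD(1)[OF G(1)]) auto
  obtain g' where g': "\<And>x. ((\<lambda>w. D \<xi> G (cscale w \<zeta> + \<eta>)) has_field_derivative g' x) (at x)"
    "\<And>x. (\<lambda>n. deriv (?f n) x) \<longlonglongrightarrow> g' x"
  proof -
    have "\<exists>g'. \<forall>x\<in>UNIV. ((\<lambda>w. D \<xi> G (cscale w \<zeta> + \<eta>)) has_field_derivative g' x) (at x) \<and>
        (\<lambda>n. deriv (?f n) x) \<longlonglongrightarrow> g' x"
    proof (rule has_complex_derivative_uniform_sequence[OF open_UNIV])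
      show "(?f n has_field_derivative deriv (?f n) x) (at x)" for n x
        by (rule holomorphic_derivI[OF f open_UNIV]) simp
      show "\<exists>d>0. cball x d \<subseteq> UNIV \<and> uniform_limit (cball x d) ?f (\<lambda>w. D \<xi> G (cscale w \<zeta> + \<eta>)) sequentially" for x
        using difference_quotient_uniform[OF G W, of x] by (intro exI[of _ 1]) simp
    qed
    then show ?thesis using that by blast
  qed
  have "g' 0 = D \<zeta> (D \<xi> G) \<eta>"
    using DERIV_unique[OF g'(1) D_has_derivative[OF hol_D W(2,3)]] .
  moreover have "deriv (?f n) 0 = (D \<zeta> G (cscale (step n) \<xi> + \<eta>) - D \<zeta> G \<eta>) / step n" for n
    by (rule DERIV_imp_deriv, rule DERIV_cdivide, rule DERIV_diff)
      (use W in \<open>auto intro!: D_has_derivative[OF G]\<close>)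
  ultimately have "(\<lambda>n. (D \<zeta> G (cscale (step n) \<xi> + \<eta>) - D \<zeta> G \<eta>) / step n) \<longlonglongrightarrow> D \<zeta> (D \<xi> G) \<eta>"
    using g'(2)[of 0] by simp
  then show ?thesis using D_tendsto[OF hol_D W(1,3)] LIMSEQ_unique by blast
qed

lemma D_zero [simp]: "D \<xi> (\<lambda>_. 0) = (\<lambda>_. 0)"
  by (auto simp: D_def)

lemma D_commute: "D \<zeta> \<circ> D \<xi> = D \<xi> \<circ> D \<zeta>"
proof
  fix G
  have off: "D \<xi> G = (\<lambda>_. 0)" if "\<not> (hol G \<and> \<xi> \<in> W)" for \<xi> G using that by (auto simp: D_def)
  have "D \<zeta> (D \<xi> G) = D \<xi> (D \<zeta> G)"
  proof (cases "hol G \<and> \<xi> \<in> W \<and> \<zeta> \<in> W")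
    case True
    show ?thesis
    proof
      fix \<eta>
      show "D \<zeta> (D \<xi> G) \<eta> = D \<xi> (D \<zeta> G) \<eta>"
        using D_commute_at[of G \<xi> \<zeta> \<eta>] True by (cases "\<eta> \<in> W") (auto simp: D_def)
    qed
  next
    case False
    then show ?thesis using off[of G \<xi>] off[of G \<zeta>] off[of _ \<xi>] off[of _ \<zeta>] by (cases "hol G") auto
  qed
  then show "(D \<zeta> \<circ> D \<xi>) G = (D \<xi> \<circ> D \<zeta>) G" by simp
qed

section \<open>Taylor coefficients\<close>

definition taylor_form :: "('a cplx \<Rightarrow> complex) \<Rightarrow> nat \<Rightarrow> (nat \<Rightarrow> 'a cplx) \<Rightarrow> complex" where
  "taylor_form F n y = fold D (map y [0..<n]) F 0 / fact n"

lemma fold_D_mset: "mset xs = mset ys \<Longrightarrow> fold D xs = fold D ys"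
  by (rule fold_multiset_equiv[OF D_commute])

lemma hol_fold: "hol F \<Longrightarrow> hol (fold D xs F)"
  by (induction xs arbitrary: F) (auto simp: hol_D)

text \<open>By commutation the direction in a given position can be moved to the last derivative, where
  linearity is linearity of a single directional derivative at zero.\<close>

lemma taylor_form_mlin:
  assumes F: "hol F"
  shows "mlin n W (taylor_form F n)"
proof -
  have slot: "\<exists>K. hol K \<and> (\<forall>a. taylor_form F n (y(i := a)) = D a K 0 / fact n)" if "i < n" for i y
  proof -
    let ?r = "map y [0..<i] @ map y [Suc i..<n]"
    have "[0..<n] = [0..<i] @ i # [Suc i..<n]"
      using that upt_add_eq_append[of 0 i "n - i"] upt_conv_Cons[of i n] by simp
    then have "map (y(i := a)) [0..<n] = map y [0..<i] @ a # map y [Suc i..<n]" for a by simp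
    then have "mset (map (y(i := a)) [0..<n]) = mset (?r @ [a])" for a by simp
    from fold_D_mset[OF this] have "fold D (map (y(i := a)) [0..<n]) F = D a (fold D ?r F)" for a
      by (simp add: fold_append)
    then show ?thesis unfolding taylor_form_def using hol_fold[OF F] by metis
  qed
  show ?thesis
    unfolding mlin_def
  proof (intro conjI allI impI)
    fix y y' :: "nat \<Rightarrow> 'a cplx" assume "\<forall>i<n. y i = y' i"
    then have "map y [0..<n] = map y' [0..<n]" by simp
    then show "taylor_form F n y = taylor_form F n y'" by (simp only: taylor_form_def)
  next
    fix y :: "nat \<Rightarrow> 'a cplx" and i a b assume i: "i < n" and ab: "a \<in> W" "b \<in> W"
    obtain K where K: "hol K" "\<And>a. taylor_form F n (y(i := a)) = D a K 0 / fact n"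
      using slot[OF i, of y] by blast
    then show "taylor_form F n (y(i := a + b)) = taylor_form F n (y(i := a)) + taylor_form F n (y(i := b))"
      unfolding K(2) using ab by (simp add: D_add[OF K(1)] add_divide_distrib)
  next
    fix y :: "nat \<Rightarrow> 'a cplx" and i a z assume i: "i < n" and a: "a \<in> W"
    obtain K where K: "hol K" "\<And>a. taylor_form F n (y(i := a)) = D a K 0 / fact n"
      using slot[OF i, of y] by blast
    then show "taylor_form F n (y(i := cscale z a)) = z * taylor_form F n (y(i := a))"
      unfolding K(2) using a by (simp add: D_cscale[OF K(1)])
  qed
qed

lemma taylor_form_sym:
  assumes "\<pi> permutes {..<n}"
  shows "taylor_form F n (y \<circ> \<pi>) = taylor_form F n y"
proof -
  have m: "mset [0..<n] = mset_set {..<n}" by (simp add: lessThan_atLeast0)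
  have "mset (map (y \<circ> \<pi>) [0..<n]) = image_mset y (image_mset \<pi> (mset [0..<n]))"
    by (simp add: image_mset.compositionality)
  also have "\<dots> = mset (map y [0..<n])" unfolding m permutes_image_mset[OF assms] by (simp add: m[symmetric])
  finally show ?thesis unfolding taylor_form_def using fold_D_mset by metis
qed

text \<open>Each derivative costs a shrinking of the ball by \<open>\<delta>\<close>. The weights \<open>s\<close> are strictly positive so
  that \<open>\<delta> / s \<xi>\<close> can serve as a radius also for directions of norm zero.\<close>

lemma fold_D_bound:
  fixes \<delta> R M :: real
  assumes F: "hol F" and M: "\<And>\<eta>. \<eta> \<in> W \<Longrightarrow> nrm \<eta> \<le> R \<Longrightarrow> cmod (F \<eta>) \<le> M"
    and \<delta>: "\<delta> > 0" and s: "\<And>\<xi>. \<xi> \<in> set L \<Longrightarrow> \<xi> \<in> W \<and> nrm \<xi> \<le> s \<xi> \<and> s \<xi> > 0"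
    and \<eta>: "\<eta> \<in> W" "nrm \<eta> + \<delta> * length L \<le> R"
  shows "cmod (fold D L F \<eta>) \<le> M * (\<Prod>\<xi>\<leftarrow>L. s \<xi> / \<delta>)"
  using s \<eta>
proof (induction L arbitrary: \<eta> rule: rev_induct)
  case Nil
  then show ?case using M by simp
next
  case (snoc a L)
  have a: "a \<in> W" "nrm a \<le> s a" "s a > 0" using snoc.prems by auto
  have "cmod (D a (fold D L F) \<eta>) \<le> M * (\<Prod>\<xi>\<leftarrow>L. s \<xi> / \<delta>) / (\<delta> / s a)"
  proof (rule D_bound[OF hol_fold[OF F] a(1) snoc.prems(2)])
    show "cmod (fold D L F \<zeta>) \<le> M * (\<Prod>\<xi>\<leftarrow>L. s \<xi> / \<delta>)" if "\<zeta> \<in> W" "nrm \<zeta> \<le> R - \<delta> * length L" for \<zeta>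
      by (rule snoc.IH) (use snoc.prems(1) that in auto)
    show "\<delta> / s a > 0" using \<delta> a by simp
    have "\<delta> / s a * nrm a \<le> \<delta> / s a * s a" using a \<delta> by (intro mult_left_mono) auto
    then show "nrm \<eta> + \<delta> / s a * nrm a \<le> R - \<delta> * length L"
      using snoc.prems(3) a by (simp add: algebra_simps)
  qed
  then show ?case by simp
qed

text \<open>Cauchy's estimate on a polydisc whose radii are inversely proportional to the norms of the
  directions.\<close>

lemma taylor_form_bound:
  assumes F: "hol F" and M: "\<And>\<eta>. \<eta> \<in> W \<Longrightarrow> nrm \<eta> \<le> R \<Longrightarrow> cmod (F \<eta>) \<le> M"
    and R: "R > 0" and y: "\<And>i. i < n \<Longrightarrow> y i \<in> W"
  shows "cmod (taylor_form F n y) \<le> M * (real (n + 1) / R) ^ n / fact n * (\<Prod>i<n. nrm (y i))"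
proof -
  define \<delta> where "\<delta> = R / real (n + 1)"
  have \<delta>: "\<delta> > 0" using R by (simp add: \<delta>_def)
  have "\<delta> * n \<le> \<delta> * real (n + 1)" using \<delta> by (intro mult_left_mono) auto
  then have \<delta>n: "\<delta> * n \<le> R" using R by (simp add: \<delta>_def)
  have nrm0: "nrm 0 = 0" using nrm_cscale[of 0 0] by simp
  have pl: "(\<Prod>\<xi>\<leftarrow>map y [0..<n]. g \<xi>) = (\<Prod>i<n. g (y i))" for g :: "'a cplx \<Rightarrow> real"
    by (induction n) (auto simp: mult.commute)
  have le: "cmod (fold D (map y [0..<n]) F 0) \<le> M * (\<Prod>i<n. (nrm (y i) + inverse (real (Suc k))) / \<delta>)" for k
  proof -
    have "cmod (fold D (map y [0..<n]) F 0) \<le> M * (\<Prod>\<xi>\<leftarrow>map y [0..<n]. (nrm \<xi> + inverse (real (Suc k))) / \<delta>)"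
    proof (rule fold_D_bound[OF F M \<delta>])
      fix \<xi> assume "\<xi> \<in> set (map y [0..<n])"
      then show "\<xi> \<in> W \<and> nrm \<xi> \<le> nrm \<xi> + inverse (real (Suc k)) \<and> nrm \<xi> + inverse (real (Suc k)) > 0"
        using y nrm_nonneg[of \<xi>] by (auto intro: add_nonneg_pos)
    qed (use \<delta>n in \<open>auto simp: nrm0\<close>)
    then show ?thesis unfolding pl .
  qed
  have "(\<lambda>k. M * (\<Prod>i<n. (nrm (y i) + inverse (real (Suc k))) / \<delta>)) \<longlonglongrightarrow> M * (\<Prod>i<n. (nrm (y i) + 0) / \<delta>)"
    using \<delta> by (intro tendsto_intros LIMSEQ_inverse_real_of_nat) auto
  then have "cmod (fold D (map y [0..<n]) F 0) \<le> M * (\<Prod>i<n. (nrm (y i) + 0) / \<delta>)"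
    by (rule LIMSEQ_le_const) (use le in blast)
  also have "(\<Prod>i<n. (nrm (y i) + 0) / \<delta>) = (\<Prod>i<n. nrm (y i)) * (1 / \<delta>) ^ n"
    by (simp add: divide_inverse prod.distrib power_inverse)
  also have "1 / \<delta> = real (n + 1) / R" by (simp add: \<delta>_def)
  finally show ?thesis unfolding taylor_form_def
    by (simp add: norm_divide field_simps)
qed

text \<open>On the diagonal the repeated directional derivatives are the derivatives of \<open>F\<close> along the
  complex line through \<open>\<xi>\<close>.\<close>

lemma taylor_form_sums:
  assumes F: "hol F" and \<xi>: "\<xi> \<in> W"
  shows "(\<lambda>n. taylor_form F n (\<lambda>_. \<xi>)) sums F \<xi>"
proof -
  define g where "g z = F (cscale z \<xi>)" for z
  have "g holomorphic_on ball 0 2"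
    using holD(1)[OF F \<xi> W_mem(1), of "ball 0 2"] by (simp add: g_def[abs_def])
  from holomorphic_power_series[OF this, of 1]
  have "(\<lambda>n. (deriv ^^ n) g 0 / fact n) sums g 1" by simp
  moreover have "fold D (replicate n \<xi>) F (cscale z \<xi>) = (deriv ^^ n) g z" for n z
  proof (induction n arbitrary: z)
    case (Suc n)
    let ?K = "fold D (replicate n \<xi>) F"
    have "fold D (replicate (Suc n) \<xi>) F = fold D (replicate n \<xi> @ [\<xi>]) F"
      by (simp only: replicate_append_same replicate_Suc)
    then have "fold D (replicate (Suc n) \<xi>) F (cscale z \<xi>) = D \<xi> ?K (cscale z \<xi>)" by simp
    also have "\<dots> = deriv (\<lambda>w. ?K (cscale w \<xi> + cscale z \<xi>)) 0"
      using \<xi> by (intro D_eq[OF hol_fold[OF F]]) auto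
    also have "(\<lambda>w. ?K (cscale w \<xi> + cscale z \<xi>)) = (deriv ^^ n) g \<circ> (\<lambda>w. z + w)"
    proof
      fix w
      have "cscale w \<xi> + cscale z \<xi> = cscale (z + w) \<xi>" by (simp add: cscale_add)
      then show "?K (cscale w \<xi> + cscale z \<xi>) = ((deriv ^^ n) g \<circ> (\<lambda>w. z + w)) w"
        by (simp only: Suc.IH o_apply)
    qed
    also have "deriv ((deriv ^^ n) g \<circ> (\<lambda>w. z + w)) 0 = deriv ((deriv ^^ n) g) z"
      by (rule deriv_shift_0[symmetric])
    finally show ?case by simp
  qed (simp add: g_def)
  from this[of _ 0] have "taylor_form F n (\<lambda>_. \<xi>) = (deriv ^^ n) g 0 / fact n" for n
    unfolding taylor_form_def by (simp add: map_replicate_const)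
  ultimately show ?thesis by (simp add: g_def)
qed

end

section \<open>Growth functions\<close>

locale growth_function =
  fixes u :: "real \<Rightarrow> real"
  assumes u: "u \<in> C_plus_log" and conv: "log_exp_convex u"
begin

lemma u_cont: "continuous_on {0..} u"
  and u_pos: "r \<ge> 0 \<Longrightarrow> u r > 0"
  and u_growth: "filterlim (\<lambda>r. ln (u r) / ln r) at_top at_top"
  using u by (simp_all add: C_plus_log_def)

text \<open>A convex function on the line that stays bounded towards minus infinity cannot decrease
  anywhere, and \<open>ln (u (exp x))\<close> stays bounded there since \<open>u\<close> is continuous at zero.\<close>

lemma u_mono_pos:
  assumes "0 < r" "r < s"
  shows "u r \<le> u s"
proof (rule ccontr)
  assume "\<not> u r \<le> u s"
  then have less: "u s < u r" by simp
  define \<phi> where "\<phi> x = ln (u (exp x))" for x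
  have cvx: "convex_on UNIV \<phi>" using conv unfolding log_exp_convex_def \<phi>_def .
  define a b where "a = ln r" and "b = ln s"
  have ab: "a < b" using assms by (simp add: a_def b_def)
  have \<phi>ab: "\<phi> b < \<phi> a"
    using less assms u_pos[of r] u_pos[of s] by (simp add: \<phi>_def a_def b_def)
  define m where "m = (\<phi> a - \<phi> b) / (b - a)"
  have m: "m > 0" using ab \<phi>ab by (simp add: m_def)
  obtain B where B: "\<And>t. t \<in> {0..1} \<Longrightarrow> u t \<le> B"
  proof -
    have "compact (u ` {0..1})"
      by (intro compact_continuous_image continuous_on_subset[OF u_cont]) auto
    then have "bdd_above (u ` {0..1})" by (intro bounded_imp_bdd_above compact_imp_bounded)
    then obtain M where "\<forall>x\<in>{0..1}. u x \<le> M" unfolding bdd_above_def by auto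
    then show ?thesis by (intro that[of M]) auto
  qed
  define x where "x = min a 0 - (\<bar>ln B\<bar> + \<bar>\<phi> a\<bar> + 1) / m"
  have pos: "(\<bar>ln B\<bar> + \<bar>\<phi> a\<bar> + 1) / m > 0" using m by (intro divide_pos_pos) auto
  have x: "x < a" "x \<le> 0" using pos unfolding x_def by auto
  have "(\<phi> x - \<phi> a) / (x - a) \<le> (\<phi> a - \<phi> b) / (a - b)"
    using convex_on_slope_le[OF cvx, of x b a] x(1) ab by simp
  also have "\<dots> = - m" using ab by (simp add: m_def field_simps)
  finally have "\<phi> x - \<phi> a \<ge> m * (a - x)" using x(1) by (simp add: divide_le_eq algebra_simps)
  moreover have "m * (a - x) \<ge> \<bar>ln B\<bar> + \<bar>\<phi> a\<bar> + 1"
  proof -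
    have "a - x \<ge> (\<bar>ln B\<bar> + \<bar>\<phi> a\<bar> + 1) / m" unfolding x_def by simp
    then show ?thesis using m by (simp add: pos_divide_le_eq mult.commute)
  qed
  moreover have "\<phi> x \<le> ln B"
  proof -
    have "exp x \<in> {0..1}" using x(2) by simp
    then have "u (exp x) \<le> B" by (rule B)
    moreover have "u (exp x) > 0" by (intro u_pos) simp
    ultimately show ?thesis unfolding \<phi>_def by simp
  qed
  ultimately show False by linarith
qed

lemma u_mono:
  assumes "0 \<le> r" "r \<le> s"
  shows "u r \<le> u s"
proof (cases "r = 0 \<and> s > 0")
  case True
  have "(\<lambda>n. s * inverse (real (Suc n))) \<longlonglongrightarrow> s * 0"
    by (intro tendsto_mult tendsto_const LIMSEQ_inverse_real_of_nat)
  then have 0: "(\<lambda>n. s * inverse (real (Suc n))) \<longlonglongrightarrow> 0" by simp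
  have "(\<lambda>n. u (s * inverse (real (Suc n)))) \<longlonglongrightarrow> u 0"
  proof (rule continuous_on_tendsto_compose[OF u_cont 0])
    show "\<forall>\<^sub>F n in sequentially. s * inverse (real (Suc n)) \<in> {0..}"
      using True by (intro always_eventually) simp
  qed simp
  then have "u 0 \<le> u s"
  proof (rule LIMSEQ_le_const2, intro exI[of _ 1] allI impI)
    fix n :: nat assume "1 \<le> n"
    then have "inverse (real (Suc n)) < 1" by (simp add: field_simps)
    then have "s * inverse (real (Suc n)) < s * 1" using True by (intro mult_strict_left_mono) auto
    then show "u (s * inverse (real (Suc n))) \<le> u s" using True by (intro u_mono_pos) auto
  qed
  then show ?thesis using True by simp
next
  case False
  then show ?thesis using assms u_mono_pos[of r s] by (cases "r = s") auto
qed

abbreviation "L n \<equiv> legendre u (real n)"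

lemma legendre_eq: "L n = (INF r\<in>{0<..}. u r / r ^ n)"
  unfolding legendre_def by (intro INF_cong refl) (simp add: powr_realpow)

lemma legendre_bdd: "bdd_below ((\<lambda>r. u r / r ^ n) ` {0<..})"
proof (rule bdd_belowI2[of _ 0])
  fix r :: real assume "r \<in> {0<..}"
  then show "0 \<le> u r / r ^ n" using u_pos[of r] by (simp add: less_imp_le)
qed

lemma legendre_greatest:
  assumes "\<And>r. r > 0 \<Longrightarrow> B \<le> u r / r ^ n"
  shows "B \<le> L n"
  unfolding legendre_eq by (rule cINF_greatest) (simp_all add: assms)

text \<open>The quotient \<open>u r / r ^ n\<close> is bounded away from zero for large \<open>r\<close> by the growth of \<open>u\<close>, and for
  the other \<open>r\<close> because \<open>u\<close> is at least \<open>u 0\<close>.\<close>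

lemma legendre_pos: "L n > 0"
proof -
  have "\<forall>\<^sub>F r in at_top. ln (u r) / ln r \<ge> real n" using u_growth by (simp add: filterlim_at_top)
  then obtain R0 where R0: "\<And>r. r \<ge> R0 \<Longrightarrow> ln (u r) / ln r \<ge> real n"
    unfolding eventually_at_top_linorder by blast
  define R where "R = max R0 2"
  have R: "R > 1" unfolding R_def by simp
  define c where "c = min 1 (u 0 / R ^ n)"
  have "c > 0" using R u_pos[of 0] by (simp add: c_def)
  moreover have "c \<le> u r / r ^ n" if r: "r > 0" for r
  proof (cases "r \<ge> R")
    case True
    then have r1: "r > 1" using R by simp
    have "real n * ln r \<le> ln (u r)"
      using R0[of r] True r1 unfolding R_def by (simp add: pos_le_divide_eq)
    then have "ln (r ^ n) \<le> ln (u r)" using r by (simp add: ln_realpow)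
    then have "r ^ n \<le> u r" using r u_pos[of r] by simp
    then have "1 \<le> u r / r ^ n" using r by (simp add: pos_le_divide_eq)
    then show ?thesis unfolding c_def by linarith
  next
    case False
    have "u 0 / R ^ n \<le> u r / r ^ n"
      using r False u_mono[of 0 r] u_pos[of r] by (intro frac_le power_mono) auto
    then show ?thesis unfolding c_def by linarith
  qed
  then have "c \<le> L n" by (rule legendre_greatest)
  ultimately show ?thesis by linarith
qed

lemma legendre_le:
  assumes "r \<ge> 0"
  shows "L n * r ^ n \<le> u r"
proof (cases "r = 0")
  case False
  then have r: "r > 0" using assms by simp
  have "L n \<le> u r / r ^ n" unfolding legendre_eq by (rule cINF_lower[OF legendre_bdd]) (use r in simp)
  then show ?thesis using r by (simp add: pos_le_divide_eq)
next
  case True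
  show ?thesis
  proof (cases "n = 0")
    case False
    then show ?thesis using True u_pos[of 0] by (simp add: power_0_left)
  next
    case n: True
    have lim: "(\<lambda>k. u (inverse (real (Suc k)))) \<longlonglongrightarrow> u 0"
    proof (rule continuous_on_tendsto_compose[OF u_cont LIMSEQ_inverse_real_of_nat])
      show "\<forall>\<^sub>F k in sequentially. inverse (real (Suc k)) \<in> {0..}" by (rule always_eventually) simp
    qed simp
    have le: "L n \<le> u (inverse (real (Suc k)))" for k
    proof -
      have "L n \<le> u (inverse (real (Suc k))) / inverse (real (Suc k)) ^ n"
        unfolding legendre_eq by (rule cINF_lower[OF legendre_bdd]) simp
      then show ?thesis using n by (simp only: power_0 div_by_1)
    qed
    have "L n \<le> u 0"
      by (rule LIMSEQ_le_const[OF lim], rule exI[of _ 0], intro allI impI, rule le)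
    then show ?thesis using True n by (simp only: power_0 mult_1_right)
  qed
qed

end

section \<open>Comparison of the two families of norms\<close>

lemma exp_ge_power_div_fact:
  assumes "x \<ge> (0::real)"
  shows "x ^ n / fact n \<le> exp x"
proof -
  have "(\<lambda>n. x ^ n /\<^sub>R fact n) sums exp x" by (rule exp_converges)
  then have s: "(\<lambda>n. x ^ n / fact n) sums exp x" by (simp add: divide_inverse mult.commute)
  have "sum (\<lambda>n. x ^ n / fact n) {n} \<le> (\<Sum>n. x ^ n / fact n)"
    by (rule sum_le_suminf[OF sums_summable[OF s]]) (use assms in auto)
  then show ?thesis using sums_unique[OF s] by simp
qed

locale growth_chain = nuclear_space_chain E H ip \<rho> + growth_function u
  for E :: "'a::{real_inner, complete_space} set" and H ip \<rho> u
begin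

abbreviation "Kn p \<equiv> K_norm E u (H p) (ip p)"
abbreviation "Gn p \<equiv> G_norm E u (H p) (ip p)"
abbreviation "Ks p \<equiv> K_space E u (H p) (ip p)"
abbreviation "Gs p \<equiv> G_space E u (H p) (ip p)"
abbreviation "tn p n \<equiv> tensor_norm (H p) (ip p) n"

lemma K_norm_eq:
  assumes "tensor_expansion E (H p) (ip p) F f"
  shows "Kn p F = sqrt (\<Sum>n. 1 / L n * (tn p n (f n))\<^sup>2)"
proof -
  have "(THE f. tensor_expansion E (H p) (ip p) F f) = f"
    using assms tensor_expansion_unique by blast
  then show ?thesis by (simp add: K_norm_def)
qed

lemma K_spaceE:
  assumes "F \<in> Ks p"
  obtains f where "F \<in> holo_functions E" "tensor_expansion E (H p) (ip p) F f"
    "summable (\<lambda>n. 1 / L n * (tn p n (f n))\<^sup>2)"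
    "\<And>m. (\<Sum>n<m. 1 / L n * (tn p n (f n))\<^sup>2) \<le> (Kn p F)\<^sup>2" "Kn p F \<ge> 0"
proof -
  obtain f where f: "F \<in> holo_functions E" "tensor_expansion E (H p) (ip p) F f"
    "summable (\<lambda>n. 1 / L n * (tn p n (f n))\<^sup>2)"
    using assms unfolding K_space_def by blast
  have pos: "1 / L n * (tn p n (f n))\<^sup>2 \<ge> 0" for n using legendre_pos[of n] by simp
  have s0: "(\<Sum>n. 1 / L n * (tn p n (f n))\<^sup>2) \<ge> 0" by (intro suminf_nonneg f pos)
  have "(\<Sum>n<m. 1 / L n * (tn p n (f n))\<^sup>2) \<le> (Kn p F)\<^sup>2" for m
    unfolding K_norm_eq[OF f(2)] using s0 sum_le_suminf[OF f(3), of "{..<m}"] pos by simp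
  moreover have "Kn p F \<ge> 0" unfolding K_norm_eq[OF f(2)] using s0 by simp
  ultimately show ?thesis using that f by blast
qed

lemma K_spaceI:
  assumes "F \<in> holo_functions E" "tensor_expansion E (H p) (ip p) F f" "C \<ge> 0"
    and "\<And>m. (\<Sum>n<m. 1 / L n * (tn p n (f n))\<^sup>2) \<le> C\<^sup>2"
  shows "F \<in> Ks p" "Kn p F \<le> C"
proof -
  have pos: "1 / L n * (tn p n (f n))\<^sup>2 \<ge> 0" for n using legendre_pos[of n] by simp
  have s: "summable (\<lambda>n. 1 / L n * (tn p n (f n))\<^sup>2)"
  proof (rule bounded_imp_summable[OF pos])
    show "(\<Sum>k\<le>m. 1 / L k * (tn p k (f k))\<^sup>2) \<le> C\<^sup>2" for m
      using assms(4)[of "Suc m"] by (simp only: lessThan_Suc_atMost)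
  qed
  show "F \<in> Ks p" unfolding K_space_def using assms(1,2) s by blast
  have "(\<Sum>n. 1 / L n * (tn p n (f n))\<^sup>2) \<le> C\<^sup>2" by (rule suminf_le_const[OF s assms(4)])
  then show "Kn p F \<le> C" unfolding K_norm_eq[OF assms(2)] using assms(3) by (rule real_le_lsqrt[rotated])
qed

lemma expansion_mem: "tensor_expansion E (H p) (ip p) F f \<Longrightarrow> f n \<in> sym_tensor_power (H p) (ip p) n"
  by (simp add: tensor_expansion_def)

lemma expansion_sums:
  assumes "tensor_expansion E (H p) (ip p) F f" "\<xi> \<in> E \<times> E"
  shows "(\<lambda>n. f n (\<lambda>_. \<xi>)) sums F \<xi>"
  using assms(1)[unfolded tensor_expansion_def, THEN conjunct2] assms(2) by (rule bspec)

lemma holo_add: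
  assumes "F \<in> holo_functions E" "G \<in> holo_functions E"
  shows "(\<lambda>\<xi>. F \<xi> + G \<xi>) \<in> holo_functions E"
  using assms unfolding holo_functions_def by (auto intro: holomorphic_on_add)

lemma holo_diff:
  assumes "F \<in> holo_functions E" "G \<in> holo_functions E"
  shows "(\<lambda>\<xi>. F \<xi> - G \<xi>) \<in> holo_functions E"
  using assms unfolding holo_functions_def by (auto intro: holomorphic_on_diff)

text \<open>The triangle inequality of the tensor norms, followed by that of the weighted square summable
  sequences.\<close>

lemma K_norm_triangle:
  assumes "F \<in> Ks p" "G \<in> Ks p"
  shows "Kn p (\<lambda>\<xi>. F \<xi> + G \<xi>) \<le> Kn p F + Kn p G"
proof -
  obtain f where f: "F \<in> holo_functions E" "tensor_expansion E (H p) (ip p) F f"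
    "\<And>m. (\<Sum>n<m. 1 / L n * (tn p n (f n))\<^sup>2) \<le> (Kn p F)\<^sup>2" "Kn p F \<ge> 0"
    by (rule K_spaceE[OF assms(1)]) blast
  obtain g where g: "G \<in> holo_functions E" "tensor_expansion E (H p) (ip p) G g"
    "\<And>m. (\<Sum>n<m. 1 / L n * (tn p n (g n))\<^sup>2) \<le> (Kn p G)\<^sup>2" "Kn p G \<ge> 0"
    by (rule K_spaceE[OF assms(2)]) blast
  define h where "h n = (\<lambda>y. f n y + g n y)" for n
  note mem = expansion_mem[OF f(2)] expansion_mem[OF g(2)]
  have h: "h n \<in> sym_tensor_power (H p) (ip p) n" "tn p n (h n) \<le> tn p n (f n) + tn p n (g n)"
    "0 \<le> tn p n (h n)" for n
    unfolding h_def using tensor_norm_add[OF ips mem(1)[of n] mem(2)[of n]] tensor_norm_nonneg[OF ips] by auto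
  have ex: "tensor_expansion E (H p) (ip p) (\<lambda>\<xi>. F \<xi> + G \<xi>) h"
    unfolding tensor_expansion_def
  proof (intro conjI allI ballI h(1))
    fix \<xi> assume "\<xi> \<in> E \<times> E"
    then show "(\<lambda>n. h n (\<lambda>_. \<xi>)) sums (F \<xi> + G \<xi>)"
      unfolding h_def by (intro sums_add expansion_sums[OF f(2)] expansion_sums[OF g(2)])
  qed
  show ?thesis
  proof (rule K_spaceI(2)[OF holo_add[OF f(1) g(1)] ex])
    fix m
    let ?s = "\<lambda>f n. sqrt (1 / L n) * tn p n (f n)"
    have sq: "(?s f n)\<^sup>2 = 1 / L n * (tn p n (f n))\<^sup>2" for f n
      using legendre_pos[of n] by (simp add: power_mult_distrib real_sqrt_divide power_divide)
    have "L2_set (?s h) {..<m} \<le> L2_set (\<lambda>n. ?s f n + ?s g n) {..<m}"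
    proof (rule L2_set_mono)
      fix n
      have "sqrt (1 / L n) \<ge> 0" using legendre_pos[of n] by simp
      then show "?s h n \<le> ?s f n + ?s g n" "0 \<le> ?s h n"
        using h(2,3)[of n] by (auto simp: distrib_left[symmetric] intro!: mult_left_mono)
    qed
    also have "\<dots> \<le> L2_set (?s f) {..<m} + L2_set (?s g) {..<m}" by (rule L2_set_triangle_ineq)
    also have "\<dots> \<le> Kn p F + Kn p G"
      unfolding L2_set_def sq using f(3,4) g(3,4) by (intro add_mono real_le_lsqrt)
    finally have "(L2_set (?s h) {..<m})\<^sup>2 \<le> (Kn p F + Kn p G)\<^sup>2" by (intro power_mono) auto
    moreover have "(L2_set (?s h) {..<m})\<^sup>2 = (\<Sum>n<m. 1 / L n * (tn p n (h n))\<^sup>2)"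
      unfolding L2_set_def sq using legendre_pos by (intro real_sqrt_pow2 sum_nonneg) (simp add: less_imp_le)
    ultimately show "(\<Sum>n<m. 1 / L n * (tn p n (h n))\<^sup>2) \<le> (Kn p F + Kn p G)\<^sup>2" by simp
  qed (use f(4) g(4) in simp)
qed

lemma G_weighted_le_iff:
  "G_weighted u (H p) (ip p) F \<xi> \<le> C \<longleftrightarrow> cmod (F \<xi>) \<le> C * sqrt (u ((N p \<xi>)\<^sup>2))"
proof -
  define v where "v = u ((N p \<xi>)\<^sup>2)"
  have v: "v > 0" unfolding v_def by (rule u_pos) simp
  have "v powr (- 1 / 2) = inverse (sqrt v)"
    using powr_minus[of v "1 / 2"] powr_half_sqrt[of v] v by simp
  then have "G_weighted u (H p) (ip p) F \<xi> = cmod (F \<xi>) / sqrt v"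
    by (simp only: G_weighted_def v_def divide_inverse)
  then show ?thesis using v unfolding v_def[symmetric] by (simp add: pos_divide_le_eq)
qed

lemma zero_mem_EE: "0 \<in> E \<times> E"
  using csubspaceD(1)[OF csubspace_E] .

lemma G_spaceI:
  assumes "F \<in> holo_functions E" "\<And>\<xi>. \<xi> \<in> E \<times> E \<Longrightarrow> cmod (F \<xi>) \<le> C * sqrt (u ((N p \<xi>)\<^sup>2))"
  shows "F \<in> Gs p" "Gn p F \<le> C"
proof -
  have le: "G_weighted u (H p) (ip p) F \<xi> \<le> C" if "\<xi> \<in> E \<times> E" for \<xi>
    unfolding G_weighted_le_iff by (rule assms(2)[OF that])
  have "bdd_above (G_weighted u (H p) (ip p) F ` (E \<times> E))" by (rule bdd_aboveI2[OF le])
  then show "F \<in> Gs p" using assms(1) by (simp add: G_space_def)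
  show "Gn p F \<le> C" unfolding G_norm_def using zero_mem_EE by (intro cSUP_least[OF _ le]) auto
qed

lemma G_spaceD:
  assumes "F \<in> Gs p"
  shows "F \<in> holo_functions E" "\<xi> \<in> E \<times> E \<Longrightarrow> cmod (F \<xi>) \<le> Gn p F * sqrt (u ((N p \<xi>)\<^sup>2))" "Gn p F \<ge> 0"
proof -
  show "F \<in> holo_functions E" using assms by (simp add: G_space_def)
  have le: "G_weighted u (H p) (ip p) F \<xi> \<le> Gn p F" if "\<xi> \<in> E \<times> E" for \<xi>
    unfolding G_norm_def
  proof (rule cSUP_upper[OF that])
    show "bdd_above (G_weighted u (H p) (ip p) F ` (E \<times> E))" using assms by (simp add: G_space_def)
  qed
  show "cmod (F \<xi>) \<le> Gn p F * sqrt (u ((N p \<xi>)\<^sup>2))" if "\<xi> \<in> E \<times> E"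
    by (rule iffD1[OF G_weighted_le_iff le[OF that]])
  have "0 \<le> G_weighted u (H p) (ip p) F 0" by (simp add: G_weighted_def)
  then show "Gn p F \<ge> 0" using le[OF zero_mem_EE] by linarith
qed

lemma G_norm_triangle:
  assumes "F \<in> Gs p" "G \<in> Gs p"
  shows "Gn p (\<lambda>\<xi>. F \<xi> + G \<xi>) \<le> Gn p F + Gn p G"
proof (rule G_spaceI(2)[OF holo_add[OF G_spaceD(1)[OF assms(1)] G_spaceD(1)[OF assms(2)]]])
  fix \<xi> assume \<xi>: "\<xi> \<in> E \<times> E"
  have "cmod (F \<xi> + G \<xi>) \<le> cmod (F \<xi>) + cmod (G \<xi>)" by (rule norm_triangle_ineq)
  also have "\<dots> \<le> Gn p F * sqrt (u ((N p \<xi>)\<^sup>2)) + Gn p G * sqrt (u ((N p \<xi>)\<^sup>2))"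
    by (rule add_mono[OF G_spaceD(2)[OF assms(1) \<xi>] G_spaceD(2)[OF assms(2) \<xi>]])
  finally show "cmod (F \<xi> + G \<xi>) \<le> (Gn p F + Gn p G) * sqrt (u ((N p \<xi>)\<^sup>2))"
    by (simp only: distrib_right)
qed

lemma G_space_diff:
  assumes "F \<in> Gs p" "G \<in> Gs p"
  shows "(\<lambda>\<xi>. F \<xi> - G \<xi>) \<in> Gs p"
proof (rule G_spaceI(1)[OF holo_diff[OF G_spaceD(1)[OF assms(1)] G_spaceD(1)[OF assms(2)]]])
  fix \<xi> assume \<xi>: "\<xi> \<in> E \<times> E"
  have "cmod (F \<xi> - G \<xi>) \<le> cmod (F \<xi>) + cmod (G \<xi>)" by (rule norm_triangle_ineq4)
  also have "\<dots> \<le> Gn p F * sqrt (u ((N p \<xi>)\<^sup>2)) + Gn p G * sqrt (u ((N p \<xi>)\<^sup>2))"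
    by (rule add_mono[OF G_spaceD(2)[OF assms(1) \<xi>] G_spaceD(2)[OF assms(2) \<xi>]])
  finally show "cmod (F \<xi> - G \<xi>) \<le> (Gn p F + Gn p G) * sqrt (u ((N p \<xi>)\<^sup>2))"
    by (simp only: distrib_right)
qed

text \<open>The Cauchy--Schwarz inequality separates the coefficients from the powers of the dual norm.
  Since the dual norm of level \<open>p + 1\<close> is smaller by the factor \<open>\<rho>\<close>, each term
  \<open>legendre u n * (N (Suc p) \<xi>) ^ (2 * n)\<close> is at most \<open>\<rho> ^ (2 * n)\<close> times the
  growth function, and a geometric series remains.\<close>

lemma K_to_G:
  assumes "F \<in> Ks (Suc p)"
  shows "F \<in> Gs p" "Gn p F \<le> 1 / sqrt (1 - \<rho>\<^sup>2) * Kn (Suc p) F"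
proof -
  let ?q = "Suc p"
  obtain f where f: "F \<in> holo_functions E" "tensor_expansion E (H ?q) (ip ?q) F f"
    "\<And>m. (\<Sum>n<m. 1 / L n * (tn ?q n (f n))\<^sup>2) \<le> (Kn ?q F)\<^sup>2" "Kn ?q F \<ge> 0"
    by (rule K_spaceE[OF assms]) blast
  note mem = expansion_mem[OF f(2)]
  have \<rho>2: "0 \<le> \<rho>\<^sup>2" "\<rho>\<^sup>2 < 1" using rho by (simp_all add: power_less_one_iff)
  have "cmod (F \<xi>) \<le> 1 / sqrt (1 - \<rho>\<^sup>2) * Kn ?q F * sqrt (u ((N p \<xi>)\<^sup>2))" if \<xi>: "\<xi> \<in> E \<times> E" for \<xi>
  proof -
    define r where "r = (N p \<xi>)\<^sup>2"
    have r: "r \<ge> 0" by (simp add: r_def)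
    have ur: "u r > 0" by (rule u_pos[OF r])
    let ?a = "\<lambda>n. sqrt (1 / L n) * tn ?q n (f n)" and ?b = "\<lambda>n. sqrt (L n) * N ?q \<xi> ^ n"
    have bound: "cmod (\<Sum>n<m. f n (\<lambda>_. \<xi>)) \<le> 1 / sqrt (1 - \<rho>\<^sup>2) * Kn ?q F * sqrt (u r)" for m
    proof -
      have "cmod (\<Sum>n<m. f n (\<lambda>_. \<xi>)) \<le> (\<Sum>n<m. ?a n * ?b n)"
      proof (rule order_trans[OF norm_sum], rule sum_mono)
        fix n
        have "sqrt (1 / L n) * sqrt (L n) = 1" using legendre_pos[of n] by (simp add: real_sqrt_mult[symmetric])
        then have e: "?a n * ?b n = tn ?q n (f n) * N ?q \<xi> ^ n" by (simp add: algebra_simps)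
        have "cmod (f n (\<lambda>_. \<xi>)) \<le> tn ?q n (f n) * N ?q \<xi> ^ n"
          using sym_tensorD(3)[OF mem, of n "\<lambda>_. \<xi>"] by simp
        then show "cmod (f n (\<lambda>_. \<xi>)) \<le> ?a n * ?b n" by (simp only: e)
      qed
      also have "\<dots> \<le> sqrt ((\<Sum>n<m. (?a n)\<^sup>2) * (\<Sum>n<m. (?b n)\<^sup>2))"
        by (intro real_le_rsqrt Cauchy_Schwarz_ineq_sum)
      also have "\<dots> \<le> sqrt ((Kn ?q F)\<^sup>2 * (u r / (1 - \<rho>\<^sup>2)))"
      proof (intro real_sqrt_le_mono mult_mono)
        have "(?a n)\<^sup>2 = 1 / L n * (tn ?q n (f n))\<^sup>2" for n
          using legendre_pos[of n] by (simp add: power_mult_distrib real_sqrt_divide power_divide)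
        then show "(\<Sum>n<m. (?a n)\<^sup>2) \<le> (Kn ?q F)\<^sup>2" using f(3)[of m] by simp
        have "(?b n)\<^sup>2 \<le> u r * (\<rho>\<^sup>2) ^ n" for n
        proof -
          have Nq: "N ?q \<xi> \<le> \<rho> * N p \<xi>" using dual_norm_mono[of p ?q \<xi>] by simp
          have "(N ?q \<xi> ^ n)\<^sup>2 = ((N ?q \<xi>)\<^sup>2) ^ n" by (simp only: power_mult[symmetric] mult.commute)
          moreover have "(sqrt (L n))\<^sup>2 = L n" using legendre_pos[of n] by simp
          ultimately have "(?b n)\<^sup>2 = L n * ((N ?q \<xi>)\<^sup>2) ^ n" by (simp only: power_mult_distrib)
          also have "\<dots> \<le> L n * ((\<rho> * N p \<xi>)\<^sup>2) ^ n"
            using Nq legendre_pos[of n] by (intro mult_left_mono power_mono) auto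
          also have "\<dots> = (\<rho>\<^sup>2) ^ n * (L n * r ^ n)" by (simp add: r_def power_mult_distrib)
          also have "\<dots> \<le> (\<rho>\<^sup>2) ^ n * u r" by (intro mult_left_mono legendre_le[OF r]) simp
          finally show ?thesis by (simp add: mult.commute)
        qed
        then have "(\<Sum>n<m. (?b n)\<^sup>2) \<le> (\<Sum>n<m. u r * (\<rho>\<^sup>2) ^ n)" by (rule sum_mono)
        also have "\<dots> = u r * (\<Sum>n<m. (\<rho>\<^sup>2) ^ n)" by (simp only: sum_distrib_left)
        also have "\<dots> \<le> u r * (\<Sum>n. (\<rho>\<^sup>2) ^ n)"
          using \<rho>2 ur by (intro mult_left_mono sum_le_suminf summable_geometric) auto
        also have "\<dots> = u r / (1 - \<rho>\<^sup>2)" using \<rho>2 by (subst suminf_geometric) auto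
        finally show "(\<Sum>n<m. (?b n)\<^sup>2) \<le> u r / (1 - \<rho>\<^sup>2)" .
      qed (auto intro: sum_nonneg)
      also have "\<dots> = 1 / sqrt (1 - \<rho>\<^sup>2) * Kn ?q F * sqrt (u r)"
        using f(4) by (simp add: real_sqrt_mult real_sqrt_divide)
      finally show ?thesis .
    qed
    have "(\<lambda>n. f n (\<lambda>_. \<xi>)) sums F \<xi>"
      by (rule expansion_sums[OF f(2) \<xi>])
    then have lim: "(\<lambda>m. \<Sum>n<m. f n (\<lambda>_. \<xi>)) \<longlonglongrightarrow> F \<xi>" by (simp only: sums_def)
    have "cmod (F \<xi>) \<le> 1 / sqrt (1 - \<rho>\<^sup>2) * Kn ?q F * sqrt (u r)"
      by (rule LIMSEQ_le_const2[OF tendsto_norm[OF lim]], rule exI[of _ 0], intro allI impI, rule bound)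
    then show ?thesis unfolding r_def .
  qed
  then show "F \<in> Gs p" "Gn p F \<le> 1 / sqrt (1 - \<rho>\<^sup>2) * Kn (Suc p) F"
    using G_spaceI[OF f(1), where p = p and C = "1 / sqrt (1 - \<rho>\<^sup>2) * Kn (Suc p) F"] by simp_all
qed

sublocale gateaux: gateaux "E \<times> E" "N p" for p
  by unfold_locales (simp_all add: csubspace_E dual_norm_triangle dual_norm_cscale)

lemma G_space_hol:
  assumes "F \<in> Gs p"
  shows "gateaux.hol p F"
  unfolding gateaux.hol_def
proof (intro conjI allI)
  show "\<xi> \<notin> E \<times> E \<longrightarrow> F \<xi> = 0" for \<xi> using G_spaceD(1)[OF assms] unfolding holo_functions_def by blast
  show "\<forall>\<xi>\<in>E \<times> E. \<forall>\<eta>\<in>E \<times> E. (\<lambda>z. F (cscale z \<xi> + \<eta>)) holomorphic_on UNIV"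
    using G_spaceD(1)[OF assms] unfolding holo_functions_def by blast
  show "\<exists>M. \<forall>\<eta>\<in>E \<times> E. N p \<eta> \<le> R \<longrightarrow> cmod (F \<eta>) \<le> M" for R
  proof (intro exI[of _ "Gn p F * sqrt (u (R\<^sup>2))"] ballI impI)
    fix \<eta> assume \<eta>: "\<eta> \<in> E \<times> E" "N p \<eta> \<le> R"
    have "Gn p F * sqrt (u ((N p \<eta>)\<^sup>2)) \<le> Gn p F * sqrt (u (R\<^sup>2))"
      using \<eta>(2) by (intro mult_left_mono real_sqrt_le_mono u_mono power_mono G_spaceD(3)[OF assms]) auto
    then show "cmod (F \<eta>) \<le> Gn p F * sqrt (u (R\<^sup>2))" using G_spaceD(2)[OF assms \<eta>(1)] by linarith
  qed
qed

text \<open>Optimizing the radius in Cauchy's estimate turns the growth of \<open>F\<close> into the Legendre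
  transform.\<close>

lemma taylor_form_legendre:
  assumes F: "F \<in> Gs p" and y: "\<And>i. i < n \<Longrightarrow> y i \<in> E \<times> E"
  shows "cmod (gateaux.taylor_form p F n y) \<le> (Gn p F * exp (real (n + 1)) * sqrt (L n)) * (\<Prod>i<n. N p (y i))"
proof -
  define x where "x = cmod (gateaux.taylor_form p F n y)"
  define Q where "Q = Gn p F * exp (real (n + 1)) * (\<Prod>i<n. N p (y i))"
  have Q0: "Q \<ge> 0" unfolding Q_def using G_spaceD(3)[OF F] by (intro mult_nonneg_nonneg prod_nonneg) auto
  have x: "x\<^sup>2 \<le> Q\<^sup>2 * (u r / r ^ n)" if r: "r > 0" for r
  proof -
    define R where "R = sqrt r"
    have R: "R > 0" "R\<^sup>2 = r" using r by (simp_all add: R_def)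
    let ?M = "Gn p F * sqrt (u (R\<^sup>2))"
    have "x \<le> ?M * (real (n + 1) / R) ^ n / fact n * (\<Prod>i<n. N p (y i))"
      unfolding x_def
    proof (rule gateaux.taylor_form_bound[OF G_space_hol[OF F] _ R(1) y])
      fix \<eta> assume \<eta>: "\<eta> \<in> E \<times> E" "N p \<eta> \<le> R"
      have "Gn p F * sqrt (u ((N p \<eta>)\<^sup>2)) \<le> ?M"
        using \<eta>(2) by (intro mult_left_mono real_sqrt_le_mono u_mono power_mono G_spaceD(3)[OF F]) auto
      then show "cmod (F \<eta>) \<le> ?M" using G_spaceD(2)[OF F \<eta>(1)] by linarith
    qed
    also have "\<dots> = (real (n + 1) ^ n / fact n) * (Gn p F * (\<Prod>i<n. N p (y i)) * (sqrt (u r) / R ^ n))"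
      by (simp add: R(2) power_divide mult_ac)
    also have "\<dots> \<le> exp (real (n + 1)) * (Gn p F * (\<Prod>i<n. N p (y i)) * (sqrt (u r) / R ^ n))"
      using G_spaceD(3)[OF F] u_pos[of r] r R(1)
      by (intro mult_right_mono exp_ge_power_div_fact mult_nonneg_nonneg prod_nonneg) auto
    finally have "x \<le> Q * (sqrt (u r) / R ^ n)" by (simp add: Q_def algebra_simps)
    then have "x\<^sup>2 \<le> (Q * (sqrt (u r) / R ^ n))\<^sup>2" by (intro power_mono) (simp_all add: x_def)
    also have "\<dots> = Q\<^sup>2 * (u r / (R\<^sup>2) ^ n)"
      using u_pos[of r] r by (simp add: power_mult_distrib power_divide power_mult[symmetric] mult.commute)
    finally show ?thesis by (simp add: R(2))
  qed
  have "x\<^sup>2 \<le> Q\<^sup>2 * L n"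
  proof (cases "Q = 0")
    case True
    then show ?thesis using x[of 1] by simp
  next
    case False
    then have "Q\<^sup>2 > 0" by simp
    then have "x\<^sup>2 / Q\<^sup>2 \<le> L n"
      using x by (intro legendre_greatest) (simp add: pos_divide_le_eq mult.commute)
    then show ?thesis using \<open>Q\<^sup>2 > 0\<close> by (simp add: pos_divide_le_eq mult.commute)
  qed
  also have "\<dots> = (Q * sqrt (L n))\<^sup>2" using legendre_pos[of n] by (simp add: power_mult_distrib less_imp_le)
  finally have "x \<le> Q * sqrt (L n)"
    by (rule power2_le_imp_le) (use Q0 legendre_pos[of n] in \<open>simp add: less_imp_le\<close>)
  then show ?thesis by (simp add: x_def Q_def algebra_simps)
qed

lemma G_to_K:
  obtains p c where "c \<ge> 0" "\<And>F. F \<in> Gs p \<Longrightarrow> F \<in> Ks q" "\<And>F. F \<in> Gs p \<Longrightarrow> Kn q F \<le> c * Gn p F"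
proof -
  \<comment> \<open>The sum of squared dual norms has to beat the factor \<open>exp n\<close> left over from Cauchy's estimate.\<close>
  define S :: real where "S = exp (- 2) / 2"
  have S: "S > 0" by (simp add: S_def)
  obtain p \<xi> where b: "q \<le> p" "\<And>k. \<xi> k \<in> E" "ip_space.orthoseq (H q) (ip q) (\<lambda>k. J q (\<xi> k))"
    "ip_space.total (H q) (ip q) (\<lambda>k. J q (\<xi> k))" "\<And>m. (\<Sum>k<m. (N p (\<xi> k, 0))\<^sup>2) \<le> S"
    by (rule dual_basis[OF S, of q]) (rule that, assumption+)
  define c :: real where "c = sqrt 2 * exp 1"
  have main: "F \<in> Ks q \<and> Kn q F \<le> c * Gn p F" if F: "F \<in> Gs p" for F
  proof -
    let ?A = "\<lambda>n. Gn p F * exp (real (n + 1)) * sqrt (L n)"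
    note G0 = G_spaceD(3)[OF F]
    have "\<exists>h. h \<in> sym_tensor_power (H q) (ip q) n \<and>
        (\<forall>y. (\<forall>i<n. y i \<in> E \<times> E) \<longrightarrow> h y = gateaux.taylor_form p F n y) \<and>
        tn q n h \<le> sqrt ((?A n)\<^sup>2 * S ^ n)" for n
    proof (rule tensor_of_form[OF b(1,2,3,4,5) gateaux.taylor_form_mlin[OF G_space_hol[OF F]], of n "?A n"])
      show "gateaux.taylor_form p F n (y \<circ> \<pi>) = gateaux.taylor_form p F n y" if "\<pi> permutes {..<n}" for \<pi> y
        by (rule gateaux.taylor_form_sym[OF that])
      show "?A n \<ge> 0" using G0 legendre_pos[of n] by simp
      show "cmod (gateaux.taylor_form p F n y) \<le> ?A n * (\<Prod>i<n. N p (y i))" if "\<And>i. i < n \<Longrightarrow> y i \<in> E \<times> E" for y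
        by (rule taylor_form_legendre[OF F that])
    qed blast
    then obtain h where h: "\<And>n. h n \<in> sym_tensor_power (H q) (ip q) n"
      "\<And>n y. (\<forall>i<n. y i \<in> E \<times> E) \<Longrightarrow> h n y = gateaux.taylor_form p F n y"
      "\<And>n. tn q n (h n) \<le> sqrt ((?A n)\<^sup>2 * S ^ n)" by metis
    have ex: "tensor_expansion E (H q) (ip q) F h"
      unfolding tensor_expansion_def
    proof (intro conjI allI ballI h(1))
      fix \<zeta> assume \<zeta>: "\<zeta> \<in> E \<times> E"
      then have "h n (\<lambda>_. \<zeta>) = gateaux.taylor_form p F n (\<lambda>_. \<zeta>)" for n by (intro h(2)) simp
      then show "(\<lambda>n. h n (\<lambda>_. \<zeta>)) sums F \<zeta>"
        using gateaux.taylor_form_sums[OF G_space_hol[OF F] \<zeta>] by simp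
    qed
    have summand: "1 / L n * (tn q n (h n))\<^sup>2 \<le> (Gn p F)\<^sup>2 * (exp 1)\<^sup>2 * (1 / 2) ^ n" for n
    proof -
      have A0: "(?A n)\<^sup>2 * S ^ n \<ge> 0" using S by simp
      have "(tn q n (h n))\<^sup>2 \<le> (sqrt ((?A n)\<^sup>2 * S ^ n))\<^sup>2"
        by (rule power_mono[OF h(3) tensor_norm_nonneg[OF ips h(1)]])
      also have "\<dots> = (?A n)\<^sup>2 * S ^ n" using A0 by simp
      also have "\<dots> = (Gn p F)\<^sup>2 * (exp (real (n + 1)))\<^sup>2 * L n * S ^ n"
        using legendre_pos[of n] by (simp add: power_mult_distrib less_imp_le)
      also have "\<dots> = L n * ((Gn p F)\<^sup>2 * (exp 1)\<^sup>2 * (1 / 2) ^ n)"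
      proof -
        have "exp (real (n + 1)) = exp 1 * exp 1 ^ n" by (simp add: exp_add exp_of_nat_mult[symmetric])
        then have "(exp (real (n + 1)))\<^sup>2 * S ^ n = (exp 1)\<^sup>2 * (((exp 1)\<^sup>2 * S) ^ n)"
          by (simp add: power_mult_distrib power_mult[symmetric] mult.commute)
        also have "(exp 1)\<^sup>2 * S = 1 / 2"
          by (simp add: S_def power2_eq_square exp_add[symmetric])
        finally show ?thesis by (simp add: algebra_simps)
      qed
      finally have "(tn q n (h n))\<^sup>2 \<le> L n * ((Gn p F)\<^sup>2 * (exp 1)\<^sup>2 * (1 / 2) ^ n)" .
      then show ?thesis using legendre_pos[of n] by (simp add: pos_divide_le_eq mult.commute)
    qed
    have "(\<Sum>n<m. 1 / L n * (tn q n (h n))\<^sup>2) \<le> (c * Gn p F)\<^sup>2" for m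
    proof -
      have "(\<Sum>n<m. 1 / L n * (tn q n (h n))\<^sup>2) \<le> (\<Sum>n<m. (Gn p F)\<^sup>2 * (exp 1)\<^sup>2 * (1 / 2) ^ n)"
        by (rule sum_mono) (rule summand)
      also have "\<dots> = (Gn p F)\<^sup>2 * (exp 1)\<^sup>2 * (\<Sum>n<m. (1 / 2) ^ n)" by (simp only: sum_distrib_left)
      also have "\<dots> \<le> (Gn p F)\<^sup>2 * (exp 1)\<^sup>2 * (\<Sum>n. (1 / 2) ^ n)"
        by (intro mult_left_mono sum_le_suminf summable_geometric) auto
      also have "(\<Sum>n. (1 / 2) ^ n) = (2 :: real)" by (subst suminf_geometric) auto
      finally show ?thesis by (simp add: c_def power_mult_distrib algebra_simps)
    qed
    moreover have "c * Gn p F \<ge> 0" using G0 by (simp add: c_def)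
    ultimately show ?thesis using K_spaceI[OF G_spaceD(1)[OF F] ex] by blast
  qed
  have "c \<ge> 0" by (simp add: c_def)
  then show ?thesis using that[of c p] main by blast
qed

lemma limits_eq: "K_limit E u H ip = G_limit E u H ip"
proof (intro equalityI subsetI)
  fix F assume F: "F \<in> K_limit E u H ip"
  then have "F \<in> Gs p" for p using K_to_G(1)[of F p] by (simp add: K_limit_def)
  then show "F \<in> G_limit E u H ip" by (simp add: G_limit_def)
next
  fix F assume F: "F \<in> G_limit E u H ip"
  have "F \<in> Ks q" for q
    by (rule G_to_K[of q]) (use F in \<open>auto simp: G_limit_def\<close>)
  then show "F \<in> K_limit E u H ip" by (simp add: K_limit_def)
qed

end

section \<open>Comparison of topologies\<close>

text \<open>A point of a ball of \<open>M\<close> is not its centre in general; the triangle inequality turns the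
  remaining distance to the boundary into the radius of a ball of \<open>N\<close> around the point. Adding one
  to \<open>c\<close> keeps that radius finite and positive.\<close>

lemma openin_norms_topology_mono:
  fixes M N :: "nat \<Rightarrow> ('b \<Rightarrow> complex) \<Rightarrow> real"
  assumes zero: "\<And>p. N p (\<lambda>_. 0) \<le> 0"
    and triangle: "\<And>p F G K. F \<in> X \<Longrightarrow> G \<in> X \<Longrightarrow> K \<in> X \<Longrightarrow>
      M p (\<lambda>\<xi>. G \<xi> - F \<xi>) \<le> M p (\<lambda>\<xi>. G \<xi> - K \<xi>) + M p (\<lambda>\<xi>. K \<xi> - F \<xi>)"
    and bound: "\<And>p. \<exists>q c. c \<ge> 0 \<and> (\<forall>F\<in>X. \<forall>G\<in>X. M p (\<lambda>\<xi>. G \<xi> - F \<xi>) \<le> c * N q (\<lambda>\<xi>. G \<xi> - F \<xi>))"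
    and "openin (norms_topology X M) U"
  shows "openin (norms_topology X N) U"
proof -
  let ?S = "{{G \<in> X. M p (\<lambda>\<xi>. G \<xi> - F \<xi>) < r} | p F r. F \<in> X \<and> r > 0}"
  have gen: "generate_topology_on ?S U"
    using assms(4) unfolding norms_topology_def openin_topology_generated_by_iff .
  show ?thesis
  proof (rule generate_topology_on_coarsest[OF _ _ gen])
    show "istopology (openin (norms_topology X N))" by simp
    fix B assume "B \<in> ?S"
    then obtain p F r where B: "B = {G \<in> X. M p (\<lambda>\<xi>. G \<xi> - F \<xi>) < r}" and F: "F \<in> X" by blast
    obtain q c where c: "c \<ge> 0" "\<And>F G. F \<in> X \<Longrightarrow> G \<in> X \<Longrightarrow> M p (\<lambda>\<xi>. G \<xi> - F \<xi>) \<le> c * N q (\<lambda>\<xi>. G \<xi> - F \<xi>)"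
      using bound[of p] by blast
    show "openin (norms_topology X N) B"
      unfolding openin_subopen[of _ B]
    proof
      fix K assume "K \<in> B"
      then have K: "K \<in> X" "M p (\<lambda>\<xi>. K \<xi> - F \<xi>) < r" unfolding B by auto
      define \<delta> where "\<delta> = (r - M p (\<lambda>\<xi>. K \<xi> - F \<xi>)) / (c + 1)"
      have \<delta>: "\<delta> > 0" using K(2) c(1) by (simp add: \<delta>_def)
      let ?T = "{G \<in> X. N q (\<lambda>\<xi>. G \<xi> - K \<xi>) < \<delta>}"
      have "openin (norms_topology X N) ?T"
        unfolding norms_topology_def by (rule topology_generated_by_Basis) (use K(1) \<delta> in blast)
      moreover have "K \<in> ?T" using K(1) zero[of q] \<delta> by simp
      moreover have "?T \<subseteq> B"
      proof
        fix G assume "G \<in> ?T"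
        then have G: "G \<in> X" "N q (\<lambda>\<xi>. G \<xi> - K \<xi>) < \<delta>" by auto
        have "c * N q (\<lambda>\<xi>. G \<xi> - K \<xi>) \<le> c * \<delta>" using G(2) c(1) by (intro mult_left_mono) auto
        also have "\<dots> < (c + 1) * \<delta>" using \<delta> by simp
        also have "\<dots> = r - M p (\<lambda>\<xi>. K \<xi> - F \<xi>)" using c(1) by (simp add: \<delta>_def)
        finally have "M p (\<lambda>\<xi>. G \<xi> - F \<xi>) < r"
          using c(2)[OF K(1) G(1)] triangle[OF F G(1) K(1), of p] by linarith
        then show "G \<in> B" using G(1) unfolding B by simp
      qed
      ultimately show "\<exists>T. openin (norms_topology X N) T \<and> K \<in> T \<and> T \<subseteq> B" by blast
    qed
  qed
qed

theorem mainTheorem9: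
  fixes E :: "'a::{real_inner, complete_space} set"
    and H :: "nat \<Rightarrow> 'a set"
    and ip :: "nat \<Rightarrow> 'a \<Rightarrow> 'a \<Rightarrow> real"
    and \<rho> :: real
    and u :: "real \<Rightarrow> real"
  assumes "nuclear_space_chain E H ip \<rho>"
    and "u \<in> C_plus_log"
    and "log_exp_convex u"
  shows "K_limit E u H ip = G_limit E u H ip \<and>
         norms_topology (K_limit E u H ip) (\<lambda>p. K_norm E u (H p) (ip p)) =
         norms_topology (G_limit E u H ip) (\<lambda>p. G_norm E u (H p) (ip p))"
proof -
  interpret growth_chain E H ip \<rho> u
    using assms by (simp add: growth_chain_def growth_function_def)
  let ?X = "G_limit E u H ip"
  have XG: "F \<in> Gs p" if "F \<in> ?X" for F p using that by (simp add: G_limit_def)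
  have XK: "F \<in> Ks p" if "F \<in> ?X" for F p using that unfolding limits_eq[symmetric] by (simp add: K_limit_def)
  have diff: "(\<lambda>\<xi>. F \<xi> - G \<xi>) \<in> ?X" if "F \<in> ?X" "G \<in> ?X" for F G
    using G_space_diff XG[OF that(1)] XG[OF that(2)] by (simp add: G_limit_def)
  have split: "(\<lambda>\<xi>. G \<xi> - F \<xi>) = (\<lambda>\<xi>. (G \<xi> - K \<xi>) + (K \<xi> - F \<xi>))" for F G K :: "'a cplx \<Rightarrow> complex"
    by simp
  have zero_mem: "(\<lambda>_. 0) \<in> holo_functions E" by (simp add: holo_functions_def)
  have Gz: "(\<lambda>_. 0) \<in> Gs p" "Gn p (\<lambda>_. 0) \<le> 0" for p
    using G_spaceI[OF zero_mem, of 0 p] by simp_all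
  have Kz: "Kn q (\<lambda>_. 0) \<le> 0" for q
  proof (rule G_to_K[of q])
    fix c p assume c: "c \<ge> 0" and *: "\<And>F. F \<in> Gs p \<Longrightarrow> Kn q F \<le> c * Gn p F"
    have "c * Gn p (\<lambda>_. 0) \<le> 0" using c Gz(2)[of p] by (simp add: mult_nonneg_nonpos)
    then show "Kn q (\<lambda>_. 0) \<le> 0" using *[OF Gz(1)[of p]] by linarith
  qed
  have KG: "\<exists>p c. c \<ge> 0 \<and> (\<forall>F\<in>?X. \<forall>G\<in>?X. Kn q (\<lambda>\<xi>. G \<xi> - F \<xi>) \<le> c * Gn p (\<lambda>\<xi>. G \<xi> - F \<xi>))" for q
    by (rule G_to_K[of q]) (use diff XG in blast)
  have GK: "\<exists>q c. c \<ge> 0 \<and> (\<forall>F\<in>?X. \<forall>G\<in>?X. Gn p (\<lambda>\<xi>. G \<xi> - F \<xi>) \<le> c * Kn q (\<lambda>\<xi>. G \<xi> - F \<xi>))" for p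
  proof (intro exI[of _ "Suc p"] exI[of _ "1 / sqrt (1 - \<rho>\<^sup>2)"] conjI ballI)
    have "\<rho>\<^sup>2 \<le> 1" using rho by (simp add: power_le_one)
    then show "0 \<le> 1 / sqrt (1 - \<rho>\<^sup>2)" by simp
    show "Gn p (\<lambda>\<xi>. G \<xi> - F \<xi>) \<le> 1 / sqrt (1 - \<rho>\<^sup>2) * Kn (Suc p) (\<lambda>\<xi>. G \<xi> - F \<xi>)"
      if "F \<in> ?X" "G \<in> ?X" for F G by (rule K_to_G(2)[OF XK[OF diff[OF that(2,1)]]])
  qed
  have Kt: "Kn p (\<lambda>\<xi>. G \<xi> - F \<xi>) \<le> Kn p (\<lambda>\<xi>. G \<xi> - K \<xi>) + Kn p (\<lambda>\<xi>. K \<xi> - F \<xi>)"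
    if "F \<in> ?X" "G \<in> ?X" "K \<in> ?X" for p F G K
    unfolding split[of G F K] by (rule K_norm_triangle[OF XK[OF diff] XK[OF diff]]) (use that in auto)
  have Gt: "Gn p (\<lambda>\<xi>. G \<xi> - F \<xi>) \<le> Gn p (\<lambda>\<xi>. G \<xi> - K \<xi>) + Gn p (\<lambda>\<xi>. K \<xi> - F \<xi>)"
    if "F \<in> ?X" "G \<in> ?X" "K \<in> ?X" for p F G K
    unfolding split[of G F K] by (rule G_norm_triangle[OF XG[OF diff] XG[OF diff]]) (use that in auto)
  have "norms_topology ?X Kn = norms_topology ?X Gn"
    unfolding topology_eq
    using openin_norms_topology_mono[of Gn ?X Kn, OF Gz(2) Kt KG]
      openin_norms_topology_mono[of Kn ?X Gn, OF Kz Gt GK] by blast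
  then show ?thesis unfolding limits_eq by simp
qed

end
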